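(* Suppose that $f_\gamma(0)=0$ for every $\gamma\in\Gamma$ such that $0\in\chi_\gamma$, and let $\mathcal{T}$ be a family of forward complete trajectories of $\dot x=f(x,\sigma)$ such that $\sigma\in\mathcal{S}_a$ for every $(x,\sigma)\in\mathcal{T}$. For a pair $(V,W)$ consider the conditions (i) $\mathcal{O}_\gamma^f(f_\gamma,W_\gamma,\infty)\cap\mathcal{O}_\gamma^b(f_\gamma,W_\gamma,\infty)\subset\{0\}$ for every $\gamma\in\Gamma$; (ii) $\mathcal{O}_\gamma^b(f_\gamma,W_\gamma)\cap\mathcal{O}_{\gamma'}^f(f_{\gamma'},W_{\gamma'})\subset\{0\}$ for all $\gamma\ne\gamma'$ in $\Gamma$; (ii') $\mathcal{O}_\gamma^b(f_\gamma,W_\gamma)\cap\mathcal{O}_{\gamma'}^f(f_{\gamma'},W_{\gamma'})\cap V_\gamma^{-1}(c)\cap V_{\gamma'}^{-1}(c)\subset\{0\}$ for all $\gamma\ne\gamma'$ in $\Gamma$ and all $c\in\mathbb{R}$. Then $\mathcal{T}$ is locally asymptotically stable (LAS) if one of the following conditions holds: 1. there exists a weak Lyapunov pair $(V,W)$ for $\mathcal{T}$ such that the restriction of $V$ to $\mathrm{dom}(f)\cap(\mathcal{O}\times\Gamma)$ is continuous and (i) and (ii') hold; 2. for every $\gamma\in\Gamma$ such that $0\in\chi_\gamma$ the initial value problem $\dot x=f_\gamma(x)$, $x(0)=0$ has a unique solution, and there exists a weak Lyapunov pair $(V,W)$ for $\mathcal{T}$ such that $W$ is continuous and (i) and (ii)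 hold; 3. $\Gamma$ is finite and there exists an F-weak Lyapunov pair $(V,W)$ for $\mathcal{T}$ such that (i) and (ii) hold. If, in addition, $\mathcal{O}=\mathbb{R}^n$ and $V$ is radially unbounded, then $\mathcal{T}$ is globally asymptotically stable (GAS).
   Context: Setting: $\Gamma$ is a compact metric space, $\mathrm{dom}(f)\subset\mathbb{R}^n\times\Gamma$ is closed and $f:\mathrm{dom}(f)\to\mathbb{R}^n$ is continuous. For $\gamma\in\Gamma$, $\chi_\gamma=\{\xi\in\mathbb{R}^n:(\xi,\gamma)\in\mathrm{dom}(f)\}$ and $f_\gamma:\chi_\gamma\to\mathbb{R}^n$, $f_\gamma(\xi)=f(\xi,\gamma)$. A switching signal is a function $\sigma:\mathbb{R}\to\Gamma$ that is piecewise constant (at most finitely many jumps in each compact interval) and continuous from the right; $\Lambda(\sigma)$ is the set of times at which $\sigma$ has a jump. A solution of $\dot x=f(x,\sigma)$ corresponding to $\sigma$ is a locally absolutely continuous $x:I_x\to\mathbb{R}^n$, $I_x\subset\mathbb{R}$ a nonempty interval, with $(x(t),\sigma(t))\in\mathrm{dom}(f)$ for all $t\in I_x$ and $\dot x(t)=f(x(t),\sigma(t))$ for almost all $t\in I_x$. Then $(x,\sigma)$ is called a trajectory; it is forward complete if $\mathbb{R}_{\ge0}\subset I_x$. Uniqueness for $\dot x=f_\gamma(x)$, $x(0)=0$ means that any solution on an interval containing $0$ (forward and backward in time) coincides with the zero solution there. $\mathcal{S}_a=\bigcup_{\tau_D>0,N_0\in\mathbb{N}}\mathcal{S}_a[\tau_D,N_0]$,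 where $\mathcal{S}_a[\tau_D,N_0]$ is the set of switching signals $\sigma$ with $\mathrm{card}(\Lambda(\sigma)\cap(\tau_1,\tau_2))\le N_0+(\tau_2-\tau_1)/\tau_D$ for every finite open interval $(\tau_1,\tau_2)$. $\pi_1:\mathbb{R}^n\times\Gamma\to\mathbb{R}^n$ is the projection onto the first component. Class $\mathcal{V}$: $V:\mathrm{dom}(V)\to\mathbb{R}$ belongs to $\mathcal{V}$ if $\mathrm{dom}(V)\subset\mathbb{R}^n\times\Gamma$; for every $\gamma\in\Gamma$ the set $\mathcal{D}_\gamma=\{\xi:(\xi,\gamma)\in\mathrm{dom}(V)\}$ is open; with $\mathcal{O}=\pi_1(\mathrm{dom}(V))$ and $\mathcal{O}_\gamma=\mathcal{O}\cap\chi_\gamma$, one has $\mathcal{O}_\gamma\subset\mathcal{D}_\gamma$ for all $\gamma$; and for all $\gamma$, $V_\gamma(\cdot)=V(\cdot,\gamma)$ is differentiable on $\mathcal{O}_\gamma$. ($\mathcal{O}$ and $\mathcal{O}_\gamma$ always refer to the function $V$ under consideration.) Observability-like sets: given $\mathcal{X}\subset\mathbb{R}^n$, a continuous map $g:\mathcal{X}\to\mathbb{R}^n$, a function $h:\mathcal{X}\to\mathbb{R}$ and $\tau>0$ or $\tau=\infty$, $\mathcal{X}^f(g,h,\tau)$ (resp. $\mathcal{X}^b(g,h,\tau)$) is the set of $\xi\in\mathcal{X}$ for which there is a solution $\varphi:[0,\tau]\to\mathcal{X}$ (resp. $\varphi:[-\tau,0]\to\mathcal{X}$) of $\dot x=g(x)$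 with $\varphi(0)=\xi$ and $h(\varphi(t))=0$ for all $t\in[0,\tau]$ (resp. $t\in[-\tau,0]$); for $\tau=\infty$ the intervals are $[0,\infty)$ and $(-\infty,0]$. Also $\mathcal{X}^f(g,h)=\bigcup_{\tau>0}\mathcal{X}^f(g,h,\tau)$ and $\mathcal{X}^b(g,h)=\bigcup_{\tau>0}\mathcal{X}^b(g,h,\tau)$. The sets $\mathcal{O}_\gamma^{f}(f_\gamma,W_\gamma)$, $\mathcal{O}_\gamma^{b}(f_\gamma,W_\gamma)$, $\mathcal{O}_\gamma^{f}(f_\gamma,W_\gamma,\infty)$, $\mathcal{O}_\gamma^{b}(f_\gamma,W_\gamma,\infty)$ are these sets with $\mathcal{X}=\mathcal{O}_\gamma$, $g=f_\gamma|_{\mathcal{O}_\gamma}$, $h=W_\gamma:=W(\cdot,\gamma)$. Comparison functions: a class $\mathcal{K}$ function is $\alpha:[0,r]\to\mathbb{R}_{\ge0}$ strictly increasing, continuous, with $\alpha(0)=0$; a class $\mathcal{K}_\infty$ function is one with $r=+\infty$ (domain $[0,\infty)$) that is in addition unbounded. Stability: a family $\mathcal{T}$ of forward complete trajectories is: LUS if there exist $r>0$ and $\alpha:[0,r]\to\mathbb{R}$ of class $\mathcal{K}$ such that for all $(x,\sigma)\in\mathcal{T}$ and all $t_0\ge0$, $|x(t_0)|\le r$ implies $|x(t)|\le\alpha(|x(t_0)|)$ for all $t\ge t_0$; GUS if there exists $\alpha:[0,\infty)\to\mathbb{R}$ of class $\mathcal{K}_\infty$ such that for all $(x,\sigma)\in\mathcal{T}$,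 $|x(t)|\le\alpha(|x(t_0)|)$ for all $t\ge t_0\ge0$; LAS (locally asymptotically stable) if it is LUS and there exists $\eta>0$ such that $\lim_{t\to+\infty}x(t)=0$ for all $(x,\sigma)\in\mathcal{T}$ with $|x(0)|<\eta$; GAS (globally asymptotically stable) if it is GUS and $\lim_{t\to+\infty}x(t)=0$ for all $(x,\sigma)\in\mathcal{T}$. Lyapunov pairs: $(V,W)$ is a weak Lyapunov pair for $\mathcal{T}$ if: (1) $V\in\mathcal{V}$, $0\in\mathcal{O}$ and there exist functions $\alpha_1,\alpha_2$ of class $\mathcal{K}$ (with domains containing the values $|\xi|$ involved) such that $\alpha_1(|\xi|)\le V(\xi,\gamma)\le\alpha_2(|\xi|)$ for all $\xi\in\mathcal{O}_\gamma$, $\gamma\in\Gamma$; (2) $W:\mathrm{dom}(f)\cap(\mathcal{O}\times\Gamma)\to\mathbb{R}$ satisfies, with $W_\gamma(\cdot)=W(\cdot,\gamma)$, $-\nabla V_\gamma(\xi)f_\gamma(\xi)\ge W_\gamma(\xi)\ge0$ for all $\xi\in\mathcal{O}_\gamma$, $\gamma\in\Gamma$; (3) for every $(x,\sigma)\in\mathcal{T}$, if $x(t)\in\mathcal{O}$ for all $t\in[a,b]\subset[0,+\infty)$ then $v(t)=V(x(t),\sigma(t))$ is nonincreasing on $[a,b]$. It is an F-weak Lyapunov pair for $\mathcal{T}$ if (1) and (2) hold and: (4) for every $(x,\sigma)\in\mathcal{T}$, if $x(t)\in\mathcal{O}$ for all $t\in[a,b]\subset[0,+\infty)$ then for every $\gamma\in\Gamma$,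 $v(t)=V(x(t),\gamma)$ is nonincreasing on $[a,b]\cap\sigma^{-1}(\gamma)$. $V$ is radially unbounded if the inequality in (1) holds for some $\alpha_1,\alpha_2$ of class $\mathcal{K}_\infty$. *)

theory Defs
  imports "HOL-Analysis.Analysis"
begin

text \<open>Conventions.  The parameter space is a compact carrier set \<open>\<Gamma>\<close> in a metric space type.
  A partial map on a subset of \<open>\<real>\<^sup>n \<times> \<Gamma>\<close> (or of \<open>\<real>\<close>) is a pair consisting of a
  set, its domain, and a total function of which only the values on that set are used.  A trajectory
  \<open>(x, \<sigma>)\<close> is a triple \<open>(I, x, \<sigma>)\<close>, where \<open>I\<close> is the domain of \<open>x\<close>.\<close>

definition section_at :: "('a \<times> 'g) set \<Rightarrow> 'g \<Rightarrow> 'a set" where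
  "section_at D \<gamma> = {\<xi>. (\<xi>, \<gamma>) \<in> D}"


section \<open>Switching signals\<close>

definition jump_times :: "(real \<Rightarrow> 'g::metric_space) \<Rightarrow> real set" where
  "jump_times \<sigma> = {t. \<not> isCont \<sigma> t}"

definition switching_signal :: "'g::metric_space set \<Rightarrow> (real \<Rightarrow> 'g) \<Rightarrow> bool" where
  "switching_signal \<Gamma> \<sigma> \<longleftrightarrow>
     range \<sigma> \<subseteq> \<Gamma> \<and>
     (\<forall>a b. finite (jump_times \<sigma> \<inter> {a..b})) \<and>
     (\<forall>a b. jump_times \<sigma> \<inter> {a..b} = {} \<longrightarrow> \<sigma> constant_on {a..b}) \<and>
     (\<forall>t. continuous (at_right t) \<sigma>)"

definition signals_avg_dwell :: "'g::metric_space set \<Rightarrow> real \<Rightarrow> nat \<Rightarrow> (real \<Rightarrow> 'g) set" where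
  "signals_avg_dwell \<Gamma> \<tau>\<^sub>D N\<^sub>0 =
     {\<sigma>. switching_signal \<Gamma> \<sigma> \<and>
          (\<forall>\<tau>\<^sub>1 \<tau>\<^sub>2. \<tau>\<^sub>1 < \<tau>\<^sub>2 \<longrightarrow>
             real (card (jump_times \<sigma> \<inter> {\<tau>\<^sub>1<..<\<tau>\<^sub>2})) \<le> real N\<^sub>0 + (\<tau>\<^sub>2 - \<tau>\<^sub>1) / \<tau>\<^sub>D)}"

definition signals_a :: "'g::metric_space set \<Rightarrow> (real \<Rightarrow> 'g) set" where
  "signals_a \<Gamma> = (\<Union>\<tau>\<^sub>D\<in>{0<..}. \<Union>N\<^sub>0. signals_avg_dwell \<Gamma> \<tau>\<^sub>D N\<^sub>0)"


section \<open>Solutions and trajectories\<close>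

text \<open>The constant \<open>absolutely_continuous\<close> of the library concerns measures; this is the notion for
  functions of a real variable.\<close>

definition abs_continuous_on_Icc :: "real \<Rightarrow> real \<Rightarrow> (real \<Rightarrow> 'a::real_normed_vector) \<Rightarrow> bool" where
  "abs_continuous_on_Icc a b x \<longleftrightarrow>
     (\<forall>\<epsilon>>0. \<exists>\<delta>>0. \<forall>P :: (real \<times> real) set.
        finite P \<and> (\<forall>(s, t)\<in>P. a \<le> s \<and> s \<le> t \<and> t \<le> b) \<and>
        pairwise (\<lambda>(s, t) (s', t'). {s<..<t} \<inter> {s'<..<t'} = {}) P \<and>
        (\<Sum>(s, t)\<in>P. t - s) < \<delta>
        \<longrightarrow> (\<Sum>(s, t)\<in>P. norm (x t - x s)) < \<epsilon>)"

definition locally_abs_continuous_on :: "real set \<Rightarrow> (real \<Rightarrow> 'a::real_normed_vector) \<Rightarrow> bool" where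
  "locally_abs_continuous_on I x \<longleftrightarrow> (\<forall>a b. {a..b} \<subseteq> I \<longrightarrow> abs_continuous_on_Icc a b x)"

text \<open>\<open>x\<close> solves \<open>x' = F t x\<close> on the interval \<open>I\<close>, where \<open>F t\<close> has domain \<open>X t\<close>.\<close>

definition ode_solution ::
  "(real \<Rightarrow> 'a::euclidean_space set) \<Rightarrow> (real \<Rightarrow> 'a \<Rightarrow> 'a) \<Rightarrow> real set \<Rightarrow> (real \<Rightarrow> 'a) \<Rightarrow> bool" where
  "ode_solution X F I x \<longleftrightarrow>
     is_interval I \<and> I \<noteq> {} \<and> locally_abs_continuous_on I x \<and> (\<forall>t\<in>I. x t \<in> X t) \<and>
     (AE t in lebesgue. t \<in> I \<longrightarrow> (x has_vector_derivative F t (x t)) (at t within I))"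

abbreviation autonomous_solution ::
  "'a::euclidean_space set \<Rightarrow> ('a \<Rightarrow> 'a) \<Rightarrow> real set \<Rightarrow> (real \<Rightarrow> 'a) \<Rightarrow> bool" where
  "autonomous_solution X g \<equiv> ode_solution (\<lambda>_. X) (\<lambda>_. g)"

type_synonym ('a, 'g) traj = "real set \<times> (real \<Rightarrow> 'a) \<times> (real \<Rightarrow> 'g)"

definition trajectory ::
  "'g::metric_space set \<Rightarrow> ('a::euclidean_space \<times> 'g) set \<Rightarrow> ('a \<times> 'g \<Rightarrow> 'a) \<Rightarrow> ('a, 'g) traj \<Rightarrow> bool" where
  "trajectory \<Gamma> domf f = (\<lambda>(I, x, \<sigma>). switching_signal \<Gamma> \<sigma> \<and>
     ode_solution (\<lambda>t. section_at domf (\<sigma> t)) (\<lambda>t \<xi>. f (\<xi>, \<sigma> t)) I x)"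

definition forward_complete :: "('a, 'g) traj \<Rightarrow> bool" where
  "forward_complete = (\<lambda>(I, x, \<sigma>). {0..} \<subseteq> I)"

definition unique_zero_solution :: "'a::euclidean_space set \<Rightarrow> ('a \<Rightarrow> 'a) \<Rightarrow> bool" where
  "unique_zero_solution X g \<longleftrightarrow>
     (\<forall>I x. autonomous_solution X g I x \<and> 0 \<in> I \<and> x 0 = 0 \<longrightarrow> (\<forall>t\<in>I. x t = 0))"


section \<open>Observability-like sets\<close>

definition output_zeroing ::
  "'a::euclidean_space set \<Rightarrow> ('a \<Rightarrow> 'a) \<Rightarrow> ('a \<Rightarrow> real) \<Rightarrow> real set \<Rightarrow> 'a set" where
  "output_zeroing X g h I =
     {\<xi>\<in>X. \<exists>\<phi>. autonomous_solution X g I \<phi> \<and> \<phi> 0 = \<xi> \<and> (\<forall>t\<in>I. h (\<phi> t) = 0)}"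

text \<open>\<open>obs_f_inf\<close>, \<open>obs_b_inf\<close> are the sets for \<open>\<tau> = \<infinity>\<close>;
  \<open>obs_f\<close>, \<open>obs_b\<close> are the unions over all \<open>\<tau> > 0\<close>.\<close>

definition obs_f_inf :: "'a::euclidean_space set \<Rightarrow> ('a \<Rightarrow> 'a) \<Rightarrow> ('a \<Rightarrow> real) \<Rightarrow> 'a set" where
  "obs_f_inf X g h = output_zeroing X g h {0..}"

definition obs_b_inf :: "'a::euclidean_space set \<Rightarrow> ('a \<Rightarrow> 'a) \<Rightarrow> ('a \<Rightarrow> real) \<Rightarrow> 'a set" where
  "obs_b_inf X g h = output_zeroing X g h {..0}"

definition obs_f :: "'a::euclidean_space set \<Rightarrow> ('a \<Rightarrow> 'a) \<Rightarrow> ('a \<Rightarrow> real) \<Rightarrow> 'a set" where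
  "obs_f X g h = (\<Union>\<tau>\<in>{0<..}. output_zeroing X g h {0..\<tau>})"

definition obs_b :: "'a::euclidean_space set \<Rightarrow> ('a \<Rightarrow> 'a) \<Rightarrow> ('a \<Rightarrow> real) \<Rightarrow> 'a set" where
  "obs_b X g h = (\<Union>\<tau>\<in>{0<..}. output_zeroing X g h {-\<tau>..0})"


section \<open>Comparison functions and stability\<close>

text \<open>A class \<open>\<K>\<close> function has domain \<open>[0, r]\<close> with \<open>r > 0\<close>, or \<open>[0, \<infinity>)\<close> if \<open>r = \<infinity>\<close>.\<close>

definition K_domain :: "ereal \<Rightarrow> real set" where
  "K_domain r = {s. 0 \<le> s \<and> ereal s \<le> r}"

definition class_K :: "ereal \<Rightarrow> (real \<Rightarrow> real) \<Rightarrow> bool" where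
  "class_K r \<alpha> \<longleftrightarrow> 0 < r \<and> strict_mono_on (K_domain r) \<alpha> \<and> continuous_on (K_domain r) \<alpha> \<and> \<alpha> 0 = 0"

definition class_K_infty :: "(real \<Rightarrow> real) \<Rightarrow> bool" where
  "class_K_infty \<alpha> \<longleftrightarrow> class_K \<infinity> \<alpha> \<and> (\<forall>M. \<exists>s\<ge>0. M < \<alpha> s)"

definition LUS :: "('a::euclidean_space, 'g) traj set \<Rightarrow> bool" where
  "LUS T \<longleftrightarrow> (\<exists>(r::real) \<alpha>. 0 < r \<and> class_K (ereal r) \<alpha> \<and>
     (\<forall>(I, x, \<sigma>)\<in>T. \<forall>t\<^sub>0\<ge>0. norm (x t\<^sub>0) \<le> r \<longrightarrow> (\<forall>t\<ge>t\<^sub>0. norm (x t) \<le> \<alpha> (norm (x t\<^sub>0)))))"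

definition GUS :: "('a::euclidean_space, 'g) traj set \<Rightarrow> bool" where
  "GUS T \<longleftrightarrow> (\<exists>\<alpha>. class_K_infty \<alpha> \<and>
     (\<forall>(I, x, \<sigma>)\<in>T. \<forall>t\<^sub>0\<ge>0. \<forall>t\<ge>t\<^sub>0. norm (x t) \<le> \<alpha> (norm (x t\<^sub>0))))"

definition LAS :: "('a::euclidean_space, 'g) traj set \<Rightarrow> bool" where
  "LAS T \<longleftrightarrow> LUS T \<and>
     (\<exists>\<eta>>0. \<forall>(I, x, \<sigma>)\<in>T. norm (x 0) < \<eta> \<longrightarrow> (x \<longlongrightarrow> 0) at_top)"

definition GAS :: "('a::euclidean_space, 'g) traj set \<Rightarrow> bool" where
  "GAS T \<longleftrightarrow> GUS T \<and> (\<forall>(I, x, \<sigma>)\<in>T. (x \<longlongrightarrow> 0) at_top)"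


section \<open>Lyapunov pairs\<close>

text \<open>\<open>V_proj domV\<close> is \<open>\<O>\<close>, and \<open>V_section domf domV \<gamma>\<close> is \<open>\<O>\<^sub>\<gamma>\<close>.\<close>

definition V_proj :: "('a \<times> 'g) set \<Rightarrow> 'a set" where
  "V_proj domV = fst ` domV"

definition V_section :: "('a \<times> 'g) set \<Rightarrow> ('a \<times> 'g) set \<Rightarrow> 'g \<Rightarrow> 'a set" where
  "V_section domf domV \<gamma> = V_proj domV \<inter> section_at domf \<gamma>"

text \<open>As the sections of \<open>domV\<close> are open, differentiability of \<open>V\<^sub>\<gamma>\<close> at a point of
  \<open>\<O>\<^sub>\<gamma>\<close> does not depend on the values of \<open>V\<close> outside \<open>domV\<close>.\<close>

definition class_V ::
  "'g set \<Rightarrow> ('a::euclidean_space \<times> 'g) set \<Rightarrow> ('a \<times> 'g) set \<Rightarrow> ('a \<times> 'g \<Rightarrow> real) \<Rightarrow> bool" where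
  "class_V \<Gamma> domf domV V \<longleftrightarrow>
     domV \<subseteq> UNIV \<times> \<Gamma> \<and>
     (\<forall>\<gamma>\<in>\<Gamma>. open (section_at domV \<gamma>) \<and>
        V_section domf domV \<gamma> \<subseteq> section_at domV \<gamma> \<and>
        (\<forall>\<xi>\<in>V_section domf domV \<gamma>. (\<lambda>\<zeta>. V (\<zeta>, \<gamma>)) differentiable (at \<xi>)))"

definition V_bounds ::
  "'g set \<Rightarrow> ('a::euclidean_space \<times> 'g) set \<Rightarrow> ('a \<times> 'g) set \<Rightarrow> ('a \<times> 'g \<Rightarrow> real)
     \<Rightarrow> (real \<Rightarrow> real) \<Rightarrow> (real \<Rightarrow> real) \<Rightarrow> bool" where
  "V_bounds \<Gamma> domf domV V \<alpha>\<^sub>1 \<alpha>\<^sub>2 \<longleftrightarrow>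
     (\<forall>\<gamma>\<in>\<Gamma>. \<forall>\<xi>\<in>V_section domf domV \<gamma>. \<alpha>\<^sub>1 (norm \<xi>) \<le> V (\<xi>, \<gamma>) \<and> V (\<xi>, \<gamma>) \<le> \<alpha>\<^sub>2 (norm \<xi>))"

definition positive_definite_decrescent ::
  "'g set \<Rightarrow> ('a::euclidean_space \<times> 'g) set \<Rightarrow> ('a \<times> 'g) set \<Rightarrow> ('a \<times> 'g \<Rightarrow> real) \<Rightarrow> bool" where
  "positive_definite_decrescent \<Gamma> domf domV V \<longleftrightarrow>
     (\<exists>r\<^sub>1 r\<^sub>2 \<alpha>\<^sub>1 \<alpha>\<^sub>2. class_K r\<^sub>1 \<alpha>\<^sub>1 \<and> class_K r\<^sub>2 \<alpha>\<^sub>2 \<and>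
        (\<forall>\<gamma>\<in>\<Gamma>. norm ` V_section domf domV \<gamma> \<subseteq> K_domain r\<^sub>1 \<inter> K_domain r\<^sub>2) \<and>
        V_bounds \<Gamma> domf domV V \<alpha>\<^sub>1 \<alpha>\<^sub>2)"

definition radially_unbounded ::
  "'g set \<Rightarrow> ('a::euclidean_space \<times> 'g) set \<Rightarrow> ('a \<times> 'g) set \<Rightarrow> ('a \<times> 'g \<Rightarrow> real) \<Rightarrow> bool" where
  "radially_unbounded \<Gamma> domf domV V \<longleftrightarrow>
     (\<exists>\<alpha>\<^sub>1 \<alpha>\<^sub>2. class_K_infty \<alpha>\<^sub>1 \<and> class_K_infty \<alpha>\<^sub>2 \<and> V_bounds \<Gamma> domf domV V \<alpha>\<^sub>1 \<alpha>\<^sub>2)"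

text \<open>The Frechet derivative of \<open>V\<^sub>\<gamma>\<close> at \<open>\<xi>\<close>, applied to \<open>f\<^sub>\<gamma>(\<xi>)\<close>, is \<open>\<nabla>V\<^sub>\<gamma>(\<xi>) f\<^sub>\<gamma>(\<xi>)\<close>.\<close>

definition Lyapunov_decrease ::
  "'g set \<Rightarrow> ('a::euclidean_space \<times> 'g) set \<Rightarrow> ('a \<times> 'g \<Rightarrow> 'a) \<Rightarrow> ('a \<times> 'g) set
     \<Rightarrow> ('a \<times> 'g \<Rightarrow> real) \<Rightarrow> ('a \<times> 'g \<Rightarrow> real) \<Rightarrow> bool" where
  "Lyapunov_decrease \<Gamma> domf f domV V W \<longleftrightarrow>
     (\<forall>\<gamma>\<in>\<Gamma>. \<forall>\<xi>\<in>V_section domf domV \<gamma>.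
        - frechet_derivative (\<lambda>\<zeta>. V (\<zeta>, \<gamma>)) (at \<xi>) (f (\<xi>, \<gamma>)) \<ge> W (\<xi>, \<gamma>) \<and> W (\<xi>, \<gamma>) \<ge> 0)"

definition weak_Lyapunov_pair ::
  "'g set \<Rightarrow> ('a::euclidean_space \<times> 'g) set \<Rightarrow> ('a \<times> 'g \<Rightarrow> 'a) \<Rightarrow> ('a, 'g) traj set
     \<Rightarrow> ('a \<times> 'g) set \<Rightarrow> ('a \<times> 'g \<Rightarrow> real) \<Rightarrow> ('a \<times> 'g \<Rightarrow> real) \<Rightarrow> bool" where
  "weak_Lyapunov_pair \<Gamma> domf f T domV V W \<longleftrightarrow>
     class_V \<Gamma> domf domV V \<and> 0 \<in> V_proj domV \<and> positive_definite_decrescent \<Gamma> domf domV V \<and>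
     Lyapunov_decrease \<Gamma> domf f domV V W \<and>
     (\<forall>(I, x, \<sigma>)\<in>T. \<forall>a b. 0 \<le> a \<and> a \<le> b \<and> (\<forall>t\<in>{a..b}. x t \<in> V_proj domV) \<longrightarrow>
        antimono_on {a..b} (\<lambda>t. V (x t, \<sigma> t)))"

definition F_weak_Lyapunov_pair ::
  "'g set \<Rightarrow> ('a::euclidean_space \<times> 'g) set \<Rightarrow> ('a \<times> 'g \<Rightarrow> 'a) \<Rightarrow> ('a, 'g) traj set
     \<Rightarrow> ('a \<times> 'g) set \<Rightarrow> ('a \<times> 'g \<Rightarrow> real) \<Rightarrow> ('a \<times> 'g \<Rightarrow> real) \<Rightarrow> bool" where
  "F_weak_Lyapunov_pair \<Gamma> domf f T domV V W \<longleftrightarrow>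
     class_V \<Gamma> domf domV V \<and> 0 \<in> V_proj domV \<and> positive_definite_decrescent \<Gamma> domf domV V \<and>
     Lyapunov_decrease \<Gamma> domf f domV V W \<and>
     (\<forall>(I, x, \<sigma>)\<in>T. \<forall>a b. 0 \<le> a \<and> a \<le> b \<and> (\<forall>t\<in>{a..b}. x t \<in> V_proj domV) \<longrightarrow>
        (\<forall>\<gamma>\<in>\<Gamma>. antimono_on ({a..b} \<inter> \<sigma> -` {\<gamma>}) (\<lambda>t. V (x t, \<gamma>))))"

definition condition_i ::
  "'g set \<Rightarrow> ('a::euclidean_space \<times> 'g) set \<Rightarrow> ('a \<times> 'g \<Rightarrow> 'a) \<Rightarrow> ('a \<times> 'g) set
     \<Rightarrow> ('a \<times> 'g \<Rightarrow> real) \<Rightarrow> bool" where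
  "condition_i \<Gamma> domf f domV W \<longleftrightarrow>
     (\<forall>\<gamma>\<in>\<Gamma>.
        obs_f_inf (V_section domf domV \<gamma>) (\<lambda>\<xi>. f (\<xi>, \<gamma>)) (\<lambda>\<xi>. W (\<xi>, \<gamma>)) \<inter>
        obs_b_inf (V_section domf domV \<gamma>) (\<lambda>\<xi>. f (\<xi>, \<gamma>)) (\<lambda>\<xi>. W (\<xi>, \<gamma>)) \<subseteq> {0})"

definition condition_ii ::
  "'g set \<Rightarrow> ('a::euclidean_space \<times> 'g) set \<Rightarrow> ('a \<times> 'g \<Rightarrow> 'a) \<Rightarrow> ('a \<times> 'g) set
     \<Rightarrow> ('a \<times> 'g \<Rightarrow> real) \<Rightarrow> bool" where
  "condition_ii \<Gamma> domf f domV W \<longleftrightarrow>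
     (\<forall>\<gamma>\<in>\<Gamma>. \<forall>\<gamma>'\<in>\<Gamma>. \<gamma> \<noteq> \<gamma>' \<longrightarrow>
        obs_b (V_section domf domV \<gamma>) (\<lambda>\<xi>. f (\<xi>, \<gamma>)) (\<lambda>\<xi>. W (\<xi>, \<gamma>)) \<inter>
        obs_f (V_section domf domV \<gamma>') (\<lambda>\<xi>. f (\<xi>, \<gamma>')) (\<lambda>\<xi>. W (\<xi>, \<gamma>')) \<subseteq> {0})"

definition level_set :: "('a \<times> 'g) set \<Rightarrow> ('a \<times> 'g \<Rightarrow> real) \<Rightarrow> 'g \<Rightarrow> real \<Rightarrow> 'a set" where
  "level_set domV V \<gamma> c = {\<xi> \<in> section_at domV \<gamma>. V (\<xi>, \<gamma>) = c}"

definition condition_ii' ::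
  "'g set \<Rightarrow> ('a::euclidean_space \<times> 'g) set \<Rightarrow> ('a \<times> 'g \<Rightarrow> 'a) \<Rightarrow> ('a \<times> 'g) set
     \<Rightarrow> ('a \<times> 'g \<Rightarrow> real) \<Rightarrow> ('a \<times> 'g \<Rightarrow> real) \<Rightarrow> bool" where
  "condition_ii' \<Gamma> domf f domV V W \<longleftrightarrow>
     (\<forall>\<gamma>\<in>\<Gamma>. \<forall>\<gamma>'\<in>\<Gamma>. \<forall>c. \<gamma> \<noteq> \<gamma>' \<longrightarrow>
        obs_b (V_section domf domV \<gamma>) (\<lambda>\<xi>. f (\<xi>, \<gamma>)) (\<lambda>\<xi>. W (\<xi>, \<gamma>)) \<inter>
        obs_f (V_section domf domV \<gamma>') (\<lambda>\<xi>. f (\<xi>, \<gamma>')) (\<lambda>\<xi>. W (\<xi>, \<gamma>')) \<inter>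
        level_set domV V \<gamma> c \<inter> level_set domV V \<gamma>' c \<subseteq> {0})"

end

(* The one idea beyond LaSalle's principle is to use stability first: it confines a trajectory that
   does not converge to 0 to a compact set K that avoids 0.  Since the jumps of an average
   dwell-time signal are locally finite with a uniform bound, the shifts of the trajectory by
   1, 2, 3, ... then have a limit (y, s) on the whole real line, where s is constant on each side of
   every time and y stays in K.  Monotonicity of V forces W = 0 along y: in cases 1 and 3 because V
   is constant along y on each interval where s is constant, in case 2 because a positive value of W
   would cost V a fixed amount infinitely often.  Condition (ii) or (ii') then excludes every switch
   of s away from y = 0, so y solves a single mode on the whole line and (i) gives y(0) = 0,
   which contradicts y(0) in K. *)

theory Submission
  imports Defs
begin

section \<open>Absolutely continuous functions\<close>

text \<open>Only pointwise convergence of the shifted signals is available, and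
  \<open>\<Gamma>\<close> may be infinite: jumps of the shifts can shrink, merge or vanish in the
  limit. The predicate \<open>B\<close> therefore records, next to the limits of state and signal,
  whether the shifts eventually have a jump in a given window. Tychonoff's theorem gives a filter
  that need not have a countable base, so dominated convergence is not at hand for the integral
  equation. Instead the equation passes to the limit as an inequality: on a window without jumps,
  \<open>x\<close> departs from the motion with the velocity frozen at \<open>real k + r\<close> by
  at most a small multiple of the time step, uniformly in \<open>k\<close>. This rests on a mean
  value inequality for absolutely continuous functions whose derivative is controlled almost
  everywhere, proved with Henstock gauges. At its own switching times the limit signal has an
  arbitrary value, so statements about modes concern open intervals and reach the end points by
  continuity.\<close>

text \<open>Absolute continuity speaks of pairs of end points, a gauge division of pairs (tag,
  interval); this lemma translates. It will be applied to the tags where the derivative is not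
  controlled, whose total contribution is thereby small.\<close>

lemma abs_continuous_on_Icc_tagged:
  fixes x :: "real \<Rightarrow> 'a::real_normed_vector"
  assumes d: "\<forall>P :: (real \<times> real) set. finite P \<and> (\<forall>(s, t)\<in>P. a \<le> s \<and> s \<le> t \<and> t \<le> b) \<and>
        pairwise (\<lambda>(s, t) (s', t'). {s<..<t} \<inter> {s'<..<t'} = {}) P \<and>
        (\<Sum>(s, t)\<in>P. t - s) < \<delta> \<longrightarrow> (\<Sum>(s, t)\<in>P. norm (x t - x s)) < e"
    and q: "q tagged_partial_division_of {a..b}"
    and U: "\<Union>(snd ` q) \<subseteq> U" "U \<in> lmeasurable" "measure lebesgue U < \<delta>"
  shows "(\<Sum>(t, K)\<in>q. norm (x (Sup K) - x (Inf K))) < e"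
    "(\<Sum>(t, K)\<in>q. Sup K - Inf K) \<le> measure lebesgue U"
proof -
  let ?D = "snd ` q" and ?S = "\<Union>(snd ` q)"
  have td: "q tagged_division_of ?S" by (rule tagged_partial_division_of_Union_self[OF q])
  have div: "?D division_of ?S" by (rule division_of_tagged_division[OF td])
  note qD = tagged_partial_division_ofD[OF q]
  have K: "\<exists>u v. K = {u..v} \<and> u \<le> v \<and> a \<le> u \<and> v \<le> b \<and> Inf K = u \<and> Sup K = v" if KD: "K \<in> ?D" for K
  proof -
    obtain u v where uv: "K = {u..v}" using division_ofD(4)[OF div KD] by auto
    have "u \<le> v" using division_ofD(3)[OF div KD] uv by auto
    moreover have "K \<subseteq> {a..b}" using qD(3) KD by fastforce
    ultimately show ?thesis using uv by auto
  qed
  have z: "sum (\<lambda>(t, K). h K) q = sum h ?D" if "\<And>K. K \<noteq> {} \<Longrightarrow> Sup K = Inf K \<Longrightarrow> h K = 0" for h :: "real set \<Rightarrow> real"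
  proof -
    \<comment> \<open>\<open>Sup\<close> and \<open>Inf\<close> of the empty set are unspecified,
      whereas \<open>sum.over_tagged_division_lemma\<close> wants the summand to vanish on empty
      boxes too; the conditional arranges this.\<close>
    have "sum (\<lambda>(t, K). if K = {} then 0 else h K) q = sum (\<lambda>K. if K = {} then 0 else h K) ?D"
    proof (rule sum.over_tagged_division_lemma[OF td])
      fix u v :: real assume "box u v = {}"
      then have "v \<le> u" by (simp add: box_eq_empty)
      show "(if cbox u v = {} then 0 else h (cbox u v)) = 0"
      proof (cases "cbox u v = {}")
        case False
        then have "cbox u v = {u}" using \<open>v \<le> u\<close> by auto
        moreover have "h {u} = 0" by (rule that) auto
        ultimately show ?thesis by metis
      qed simp
    qed
    also have "\<dots> = sum h ?D" using division_ofD(3)[OF div] by (intro sum.cong) auto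
    also have "sum (\<lambda>(t, K). if K = {} then 0 else h K) q = sum (\<lambda>(t, K). h K) q"
      using qD(2) by (intro sum.cong) fastforce+
    finally show ?thesis .
  qed
  have len: "sum (\<lambda>K. Sup K - Inf K) ?D = measure lebesgue ?S"
  proof -
    have "sum (\<lambda>K. Sup K - Inf K) ?D = sum (measure lebesgue) ?D"
    proof (rule sum.cong[OF refl])
      fix K assume "K \<in> ?D"
      from K[OF this] obtain u v where "K = {u..v}" "u \<le> v" "Inf K = u" "Sup K = v" by blast
      then show "Sup K - Inf K = measure lebesgue K" by simp
    qed
    then show ?thesis using content_division[OF div] by simp
  qed
  have "?S \<in> lmeasurable" using lmeasurable_division[OF div] .
  then have SU: "measure lebesgue ?S \<le> measure lebesgue U"
    using U(1,2) by (intro measure_mono_fmeasurable) auto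
  show "(\<Sum>(t, K)\<in>q. Sup K - Inf K) \<le> measure lebesgue U"
    using z[of "\<lambda>K. Sup K - Inf K"] len SU by simp
  let ?P = "(\<lambda>K. (Inf K, Sup K)) ` ?D"
  have inj: "inj_on (\<lambda>K. (Inf K, Sup K)) ?D"
  proof (rule inj_onI)
    fix k k' assume k: "k \<in> ?D" "k' \<in> ?D" and eq: "(Inf k, Sup k) = (Inf k', Sup k')"
    obtain u v where "k = {u..v}" "Inf k = u" "Sup k = v" using K[OF k(1)] by blast
    moreover obtain u' v' where "k' = {u'..v'}" "Inf k' = u'" "Sup k' = v'" using K[OF k(2)] by blast
    ultimately show "k = k'" using eq by simp
  qed
  have "(\<Sum>(s, t)\<in>?P. norm (x t - x s)) < e"
  proof (rule d[THEN spec, THEN mp], intro conjI)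
    show "finite ?P" using qD(1) by auto
    show "\<forall>(s, t)\<in>?P. a \<le> s \<and> s \<le> t \<and> t \<le> b"
    proof -
      have "a \<le> Inf k \<and> Inf k \<le> Sup k \<and> Sup k \<le> b" if kD: "k \<in> ?D" for k
      proof -
        from K[OF kD] obtain u v where "u \<le> v" "a \<le> u" "v \<le> b" "Inf k = u" "Sup k = v" by blast
        then show ?thesis by simp
      qed
      then show ?thesis by simp
    qed
    show "pairwise (\<lambda>(s, t) (s', t'). {s<..<t} \<inter> {s'<..<t'} = {}) ?P"
    proof (rule pairwiseI)
      fix p p' assume p: "p \<in> ?P" "p' \<in> ?P" "p \<noteq> p'"
      then obtain k k' where k: "k \<in> ?D" "k' \<in> ?D" "p = (Inf k, Sup k)" "p' = (Inf k', Sup k')" by blast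
      then have "k \<noteq> k'" using p by auto
      then have "interior k \<inter> interior k' = {}" using division_ofD(5)[OF div] k by auto
      moreover have "interior k = {Inf k<..<Sup k}" "interior k' = {Inf k'<..<Sup k'}"
        using K[OF k(1)] K[OF k(2)] by (elim exE conjE; simp)+
      ultimately show "(case p of (s, t) \<Rightarrow> \<lambda>(s', t'). {s<..<t} \<inter> {s'<..<t'} = {}) p'"
        using k by auto
    qed
    show "(\<Sum>(s, t)\<in>?P. t - s) < \<delta>"
      using len SU U(3) by (subst sum.reindex[OF inj]) (simp add: o_def)
  qed
  then have "sum (\<lambda>K. norm (x (Sup K) - x (Inf K))) ?D < e"
    by (subst (asm) sum.reindex[OF inj]) (simp add: o_def)
  then show "(\<Sum>(t, K)\<in>q. norm (x (Sup K) - x (Inf K))) < e"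
    using z[of "\<lambda>K. norm (x (Sup K) - x (Inf K))"] by simp
qed

text \<open>On a fine tagged division, the intervals whose tag is a point of bad behaviour lie in an open
  set of small measure, where absolute continuity controls the increment; on the others the
  derivative does.\<close>

lemma abs_continuous_mean_value:
  fixes x :: "real \<Rightarrow> 'a::euclidean_space"
  assumes ac: "abs_continuous_on_Icc a b x" and "a \<le> b" and "0 \<le> B"
    and der: "AE t in lebesgue. t \<in> {a..b} \<longrightarrow>
        (\<exists>D. (x has_vector_derivative D) (at t within {a..b}) \<and> norm (D - z) \<le> B)"
  shows "norm (x b - x a - (b - a) *\<^sub>R z) \<le> B * (b - a)"
proof (rule field_le_epsilon)
  fix e0 :: real assume "0 < e0"
  \<comment> \<open>The error has three sources: \<open>e * (b - a)\<close> from the derivative at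
    good tags, \<open>e\<close> from the increments of \<open>x\<close> over bad intervals, and
    \<open>e\<close> from \<open>z\<close> on these intervals.\<close>
  define e where "e = e0 / (b - a + 2)"
  have "b - a + 2 > 0" using \<open>a \<le> b\<close> by simp
  then have e: "0 < e" and "e * (b - a + 2) = e0" using \<open>0 < e0\<close>
    by (auto simp: e_def)
  then have e0: "e * (b - a) + 2 * e = e0" by (simp add: distrib_left)
  define c where "c = norm z + 1"
  have c: "c > 0" "norm z \<le> c" unfolding c_def by (simp_all add: add_nonneg_pos)
  obtain \<delta> where \<delta>: "\<delta> > 0" and d: "\<forall>P :: (real \<times> real) set. finite P \<and> (\<forall>(s, t)\<in>P. a \<le> s \<and> s \<le> t \<and> t \<le> b) \<and>
        pairwise (\<lambda>(s, t) (s', t'). {s<..<t} \<inter> {s'<..<t'} = {}) P \<and>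
        (\<Sum>(s, t)\<in>P. t - s) < \<delta> \<longrightarrow> (\<Sum>(s, t)\<in>P. norm (x t - x s)) < e"
    using ac e unfolding abs_continuous_on_Icc_def by blast
  obtain N where N: "N \<in> null_sets lebesgue"
    and good: "\<And>t. t \<in> {a..b} \<Longrightarrow> t \<notin> N \<Longrightarrow>
        \<exists>D. (x has_vector_derivative D) (at t within {a..b}) \<and> norm (D - z) \<le> B"
    using der unfolding eventually_ae_filter by fastforce
  \<comment> \<open>Measure below \<open>\<delta>\<close> makes absolute continuity applicable;
    measure below \<open>e / c\<close> bounds the term with \<open>z\<close>, since
    \<open>norm z \<le> c\<close>.\<close>
  define \<eta> where "\<eta> = min \<delta> (e / c)"
  have \<eta>: "\<eta> > 0" "\<eta> \<le> \<delta>" "c * \<eta> \<le> e" using \<delta> e c by (auto simp: \<eta>_def min_def field_simps)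
  obtain U where U: "open U" "N \<subseteq> U" "U - N \<in> lmeasurable" "emeasure lebesgue (U - N) < ennreal \<eta>"
    using sets_lebesgue_outer_open[of N \<eta>] N \<eta> by blast
  have "emeasure lebesgue U = emeasure lebesgue (U - N)"
    using N U(1) by (simp add: emeasure_Diff_null_set)
  then have "emeasure lebesgue U < ennreal \<eta>" using U by simp
  moreover from this have "emeasure lebesgue U < \<infinity>" by (auto intro: less_trans)
  then have "U \<in> lmeasurable" using U(1) by (simp add: fmeasurable_def)
  ultimately have Um: "U \<in> lmeasurable" "measure lebesgue U < \<eta>"
    using \<eta> by (auto simp: emeasure_eq_measure2 ennreal_less_iff)
  have tri: "norm (p - q + s) \<le> norm p + norm q + norm s" for p q s :: 'a
    by (metis norm_triangle_ineq norm_triangle_ineq4 add_right_mono order_trans)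
  \<comment> \<open>The straddle estimate: a tag between \<open>u\<close> and \<open>v\<close>
    splits the increment into two pieces whose errors \<open>e * (v - t)\<close> and
    \<open>e * (t - u)\<close> add up to \<open>e * (v - u)\<close>.\<close>
  have "\<exists>r>0. \<forall>u\<in>{a..b}. \<forall>v\<in>{a..b}. u \<le> t \<and> t \<le> v \<and> dist u t < r \<and> dist v t < r \<longrightarrow>
      norm (x v - x u - (v - u) *\<^sub>R z) \<le> (B + e) * (v - u)" if t: "t \<in> {a..b}" "t \<notin> N" for t
  proof -
    obtain D where D: "(x has_vector_derivative D) (at t within {a..b})" "norm (D - z) \<le> B"
      using good t by blast
    then obtain r where r: "r > 0" "\<And>y. y \<in> {a..b} \<Longrightarrow> norm (y - t) < r \<Longrightarrow>
        norm (x y - x t - (y - t) *\<^sub>R D) \<le> e * norm (y - t)"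
      using e unfolding has_vector_derivative_def has_derivative_within_alt by blast
    have "norm (x v - x u - (v - u) *\<^sub>R z) \<le> (B + e) * (v - u)"
      if "u \<in> {a..b}" "v \<in> {a..b}" "u \<le> t" "t \<le> v" "dist u t < r" "dist v t < r" for u v
    proof -
      have eq: "x v - x u - (v - u) *\<^sub>R z = (x v - x t - (v - t) *\<^sub>R D) - (x u - x t - (u - t) *\<^sub>R D) + (v - u) *\<^sub>R (D - z)"
        by (simp add: algebra_simps)
      have "norm (x v - x t - (v - t) *\<^sub>R D) \<le> e * (v - t)" "norm (x u - x t - (u - t) *\<^sub>R D) \<le> e * (t - u)"
        using r(2)[of v] r(2)[of u] that by (auto simp: dist_norm)
      moreover have "norm ((v - u) *\<^sub>R (D - z)) \<le> (v - u) * B"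
        using D(2) that by (simp add: mult_left_mono)
      ultimately have "norm (x v - x u - (v - u) *\<^sub>R z) \<le> e * (v - t) + e * (t - u) + (v - u) * B"
        unfolding eq using tri[of "x v - x t - (v - t) *\<^sub>R D" "x u - x t - (u - t) *\<^sub>R D" "(v - u) *\<^sub>R (D - z)"]
        by linarith
      also have "\<dots> = (B + e) * (v - u)" by (simp add: algebra_simps)
      finally show ?thesis .
    qed
    then show ?thesis using r(1) by blast
  qed
  then obtain r where r: "\<And>t. t \<in> {a..b} \<Longrightarrow> t \<notin> N \<Longrightarrow> r t > 0"
    "\<And>t u v. t \<in> {a..b} \<Longrightarrow> t \<notin> N \<Longrightarrow> u \<in> {a..b} \<Longrightarrow> v \<in> {a..b} \<Longrightarrow> u \<le> t \<Longrightarrow> t \<le> v \<Longrightarrow>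
      dist u t < r t \<Longrightarrow> dist v t < r t \<Longrightarrow> norm (x v - x u - (v - u) *\<^sub>R z) \<le> (B + e) * (v - u)"
    by metis
  \<comment> \<open>A bad tag forces its interval into the small open set \<open>U\<close>, a good
    tag into the ball where the straddle estimate holds.\<close>
  define g where "g t = (if t \<in> N then U else if t \<in> {a..b} then ball t (r t) else UNIV)" for t
  have "gauge g" unfolding gauge_def using U r(1) by (auto simp: g_def)
  then obtain p where p: "p tagged_division_of {a..b}" "g fine p"
    using fine_division_exists_real by blast
  have pp: "p tagged_partial_division_of {a..b}" using p(1) tagged_division_of_def by blast
  note pD = tagged_partial_division_ofD[OF pp]
  have K: "\<exists>u v. K = {u..v} \<and> u \<le> t \<and> t \<le> v \<and> a \<le> u \<and> v \<le> b \<and> Inf K = u \<and> Sup K = v" if tK: "(t, K) \<in> p" for t K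
  proof -
    obtain u v where uv: "K = {u..v}" using pD(4)[OF tK] by auto
    have "t \<in> K" "K \<subseteq> {a..b}" using pD(2,3) tK by blast+
    then show ?thesis using uv by auto
  qed
  \<comment> \<open>With the linear part subtracted, the claim becomes a bound on a telescoping sum
    of increments of \<open>w\<close> over the division.\<close>
  define w where "w t = x t - t *\<^sub>R z" for t
  define q where "q = {(t, K) \<in> p. t \<in> N}"
  have qp: "q \<subseteq> p" by (auto simp: q_def)
  have fin: "finite p" "finite q" using pD(1) qp finite_subset by auto
  have q: "q tagged_partial_division_of {a..b}" using tagged_partial_division_subset[OF pp qp] .
  have "K \<subseteq> U" if "(t, K) \<in> q" for t K
    using fineD[OF p(2), of t K] that by (auto simp: q_def g_def)
  then have qU: "\<Union>(snd ` q) \<subseteq> U" by fastforce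
  have "measure lebesgue U < \<delta>" using Um \<eta> by simp
  note bad = abs_continuous_on_Icc_tagged[OF d q qU Um(1) this]
  have bad: "(\<Sum>(t, K)\<in>q. norm (x (Sup K) - x (Inf K))) < e"
      "(\<Sum>(t, K)\<in>q. Sup K - Inf K) \<le> \<eta>"
    using bad(1) bad(2)[THEN order_trans, OF less_imp_le[OF Um(2)]] by blast+
  have "x b - x a - (b - a) *\<^sub>R z = w b - w a" by (simp add: w_def algebra_simps)
  also have "\<dots> = (\<Sum>(t, K)\<in>p. w (Sup K) - w (Inf K))"
    using additive_tagged_division_1[OF \<open>a \<le> b\<close> p(1), of w] by simp
  finally have "norm (x b - x a - (b - a) *\<^sub>R z) \<le> (\<Sum>(t, K)\<in>p. norm (w (Sup K) - w (Inf K)))"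
    by (metis (no_types, lifting) norm_sum sum.cong case_prod_unfold)
  also have "\<dots> \<le> (\<Sum>(t, K)\<in>p. (B + e) * (Sup K - Inf K) +
      (if (t, K) \<in> q then norm (x (Sup K) - x (Inf K)) + c * (Sup K - Inf K) else 0))"
  proof (rule sum_mono, clarify)
    fix t K assume tK: "(t, K) \<in> p"
    obtain u v where uv: "K = {u..v}" "u \<le> t" "t \<le> v" "a \<le> u" "v \<le> b" "Inf K = u" "Sup K = v"
      using K[OF tK] by blast
    show "norm (w (Sup K) - w (Inf K)) \<le> (B + e) * (Sup K - Inf K) +
      (if (t, K) \<in> q then norm (x (Sup K) - x (Inf K)) + c * (Sup K - Inf K) else 0)"
    proof (cases "t \<in> N")
      case True
      have "w v - w u = (x v - x u) - (v - u) *\<^sub>R z" by (simp add: w_def algebra_simps)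
      also have "norm \<dots> \<le> norm (x v - x u) + (v - u) * norm z"
        using norm_triangle_ineq4[of "x v - x u" "(v - u) *\<^sub>R z"] uv by simp
      also have "\<dots> \<le> norm (x v - x u) + c * (v - u)"
        using c uv by (simp add: mult.commute mult_right_mono)
      finally have *: "norm (w v - w u) \<le> norm (x v - x u) + c * (v - u)" .
      have "0 \<le> (B + e) * (v - u)" using \<open>0 \<le> B\<close> e uv by auto
      then show ?thesis using * True tK uv by (simp add: q_def)
    next
      case False
      have t: "t \<in> {a..b}" using uv by auto
      have "{u..v} \<subseteq> ball t (r t)" using fineD[OF p(2) tK] uv(1) t False by (simp add: g_def)
      moreover have "u \<in> {u..v}" "v \<in> {u..v}" using uv by auto
      ultimately have "u \<in> ball t (r t)" "v \<in> ball t (r t)" by blast+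
      then have "norm (x v - x u - (v - u) *\<^sub>R z) \<le> (B + e) * (v - u)"
        using uv t False by (intro r(2)[of t]) (auto simp: dist_commute)
      then show ?thesis using False uv by (simp add: q_def w_def algebra_simps)
    qed
  qed
  also have "\<dots> = (\<Sum>(t, K)\<in>p. (B + e) * (Sup K - Inf K)) +
      (\<Sum>(t, K)\<in>p. if (t, K) \<in> q then norm (x (Sup K) - x (Inf K)) + c * (Sup K - Inf K) else 0)"
    by (simp add: sum.distrib case_prod_unfold)
  also have "(\<Sum>(t, K)\<in>p. (B + e) * (Sup K - Inf K)) = (B + e) * (b - a)"
    using additive_tagged_division_1[OF \<open>a \<le> b\<close> p(1), of "\<lambda>t. t"]
    by (simp add: case_prod_unfold flip: sum_distrib_left)
  also have "(\<Sum>(t, K)\<in>p. if (t, K) \<in> q then norm (x (Sup K) - x (Inf K)) + c * (Sup K - Inf K) else 0)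
      = (\<Sum>(t, K)\<in>q. norm (x (Sup K) - x (Inf K)) + c * (Sup K - Inf K))"
    using fin qp by (intro sum.mono_neutral_cong_right) auto
  also have "\<dots> = (\<Sum>(t, K)\<in>q. norm (x (Sup K) - x (Inf K))) + c * (\<Sum>(t, K)\<in>q. Sup K - Inf K)"
    by (simp add: sum.distrib sum_distrib_left case_prod_unfold)
  also have "\<dots> \<le> e + c * \<eta>"
    using bad c by (intro add_mono mult_left_mono) auto
  also have "(B + e) * (b - a) + (e + c * \<eta>) \<le> B * (b - a) + e0"
    using \<eta>(3) e0 by (simp add: algebra_simps)
  finally show "norm (x b - x a - (b - a) *\<^sub>R z) \<le> B * (b - a) + e0" by simp
qed

lemma abs_continuous_on_Icc_subset:
  assumes "abs_continuous_on_Icc a b x" "a \<le> c" "d \<le> b"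
  shows "abs_continuous_on_Icc c d x"
  unfolding abs_continuous_on_Icc_def
proof (intro allI impI)
  fix e :: real assume "e > 0"
  then obtain \<delta> where \<delta>: "\<delta> > 0" "\<forall>P :: (real \<times> real) set. finite P \<and> (\<forall>(s, t)\<in>P. a \<le> s \<and> s \<le> t \<and> t \<le> b) \<and>
        pairwise (\<lambda>(s, t) (s', t'). {s<..<t} \<inter> {s'<..<t'} = {}) P \<and>
        (\<Sum>(s, t)\<in>P. t - s) < \<delta> \<longrightarrow> (\<Sum>(s, t)\<in>P. norm (x t - x s)) < e"
    using assms(1) unfolding abs_continuous_on_Icc_def by blast
  show "\<exists>\<delta>>0. \<forall>P :: (real \<times> real) set. finite P \<and> (\<forall>(s, t)\<in>P. c \<le> s \<and> s \<le> t \<and> t \<le> d) \<and>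
        pairwise (\<lambda>(s, t) (s', t'). {s<..<t} \<inter> {s'<..<t'} = {}) P \<and>
        (\<Sum>(s, t)\<in>P. t - s) < \<delta> \<longrightarrow> (\<Sum>(s, t)\<in>P. norm (x t - x s)) < e"
  proof (intro exI conjI allI impI; (elim conjE)?)
    fix P :: "(real \<times> real) set"
    assume "\<forall>(s, t)\<in>P. c \<le> s \<and> s \<le> t \<and> t \<le> d"
    then have "\<forall>(s, t)\<in>P. a \<le> s \<and> s \<le> t \<and> t \<le> b" using assms(2,3) by fastforce
    moreover assume "finite P" "pairwise (\<lambda>(s, t) (s', t'). {s<..<t} \<inter> {s'<..<t'} = {}) P"
      "(\<Sum>(s, t)\<in>P. t - s) < \<delta>"
    ultimately show "(\<Sum>(s, t)\<in>P. norm (x t - x s)) < e" by (intro \<delta>(2)[THEN spec, THEN mp] conjI)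
  qed (rule \<delta>(1))
qed

lemma abs_continuous_on_Icc_if_lipschitz:
  assumes lip: "\<And>s t. s \<in> {a..b} \<Longrightarrow> t \<in> {a..b} \<Longrightarrow> norm (x t - x s) \<le> M * \<bar>t - s\<bar>"
  shows "abs_continuous_on_Icc a b x"
  unfolding abs_continuous_on_Icc_def
proof (intro allI impI)
  fix e :: real assume e: "e > 0"
  define c where "c = \<bar>M\<bar> + 1"
  have c: "c > 0" "M \<le> c" by (auto simp: c_def)
  have "(\<Sum>(s, t)\<in>P. norm (x t - x s)) < e"
    if P: "\<forall>(s, t)\<in>P. a \<le> s \<and> s \<le> t \<and> t \<le> b" "(\<Sum>(s, t)\<in>P. t - s) < e / c" for P
  proof -
    have "(\<Sum>(s, t)\<in>P. norm (x t - x s)) \<le> (\<Sum>(s, t)\<in>P. c * (t - s))"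
    proof (rule sum_mono, clarify)
      fix s t assume "(s, t) \<in> P"
      then have st: "a \<le> s" "s \<le> t" "t \<le> b" using P(1) by auto
      then have "norm (x t - x s) \<le> M * (t - s)" using lip[of s t] by auto
      also have "\<dots> \<le> c * (t - s)" using c st by (intro mult_right_mono) auto
      finally show "norm (x t - x s) \<le> c * (t - s)" .
    qed
    also have "\<dots> = c * (\<Sum>(s, t)\<in>P. t - s)" by (simp add: sum_distrib_left case_prod_unfold)
    also have "\<dots> < e" using P(2) c by (simp add: field_simps)
    finally show ?thesis .
  qed
  then show "\<exists>\<delta>>0. \<forall>P :: (real \<times> real) set. finite P \<and> (\<forall>(s, t)\<in>P. a \<le> s \<and> s \<le> t \<and> t \<le> b) \<and>
        pairwise (\<lambda>(s, t) (s', t'). {s<..<t} \<inter> {s'<..<t'} = {}) P \<and>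
        (\<Sum>(s, t)\<in>P. t - s) < \<delta> \<longrightarrow> (\<Sum>(s, t)\<in>P. norm (x t - x s)) < e"
    using e c by (intro exI[of _ "e / c"]) auto
qed

text \<open>Near \<open>t\<close> the derivative is almost everywhere close to \<open>g t\<close>,
  so the mean value inequality with \<open>z = g t\<close> estimates every difference quotient at
  \<open>t\<close>. Along a fixed mode the solutions are thus differentiable at every time, and the
  chain rule for \<open>V\<close> holds without exceptional sets.\<close>

lemma abs_continuous_has_vector_derivative:
  fixes x :: "real \<Rightarrow> 'a::euclidean_space"
  assumes ac: "abs_continuous_on_Icc a b x"
    and der: "AE t in lebesgue. t \<in> {a..b} \<longrightarrow> (x has_vector_derivative g t) (at t within {a..b})"
    and cont: "continuous_on {a..b} g" and t: "t \<in> {a..b}"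
  shows "(x has_vector_derivative g t) (at t within {a..b})"
  unfolding has_vector_derivative_def has_derivative_within_alt
proof (intro conjI allI impI)
  show "bounded_linear (\<lambda>h. h *\<^sub>R g t)" by (rule bounded_linear_scaleR_left)
  fix e :: real assume e: "e > 0"
  then obtain d where d: "d > 0" "\<And>s. s \<in> {a..b} \<Longrightarrow> dist s t < d \<Longrightarrow> dist (g s) (g t) < e"
    using cont t unfolding continuous_on_iff by meson
  have mv: "norm (x v - x u - (v - u) *\<^sub>R g t) \<le> e * (v - u)"
    if uv: "a \<le> u" "u \<le> v" "v \<le> b" "dist u t < d" "dist v t < d" for u v
  proof (rule abs_continuous_mean_value)
    show "abs_continuous_on_Icc u v x" using abs_continuous_on_Icc_subset[OF ac] uv by auto
    show "AE s in lebesgue. s \<in> {u..v} \<longrightarrow>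
        (\<exists>D. (x has_vector_derivative D) (at s within {u..v}) \<and> norm (D - g t) \<le> e)"
      using der
    proof eventually_elim
      case (elim s)
      show ?case
      proof
        assume s: "s \<in> {u..v}"
        then have "dist s t < d" using uv by (auto simp: dist_real_def)
        then have "dist (g s) (g t) < e" using s uv by (intro d(2)) auto
        then have "norm (g s - g t) \<le> e" by (simp add: dist_norm)
        moreover have "(x has_vector_derivative g s) (at s within {u..v})"
        proof (rule has_vector_derivative_within_subset)
          show "(x has_vector_derivative g s) (at s within {a..b})" using elim s uv by auto
          show "{u..v} \<subseteq> {a..b}" using uv by auto
        qed
        ultimately show "\<exists>D. (x has_vector_derivative D) (at s within {u..v}) \<and> norm (D - g t) \<le> e"
          by blast
      qed
    qed
  qed (use uv e in auto)
  have "norm (x y - x t - (y - t) *\<^sub>R g t) \<le> e * norm (y - t)" if y: "y \<in> {a..b}" "norm (y - t) < d" for y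
  proof (cases "t \<le> y")
    case True
    then show ?thesis using mv[of t y] y t d(1) by (auto simp: dist_norm)
  next
    case False
    have "x y - x t - (y - t) *\<^sub>R g t = - (x t - x y - (t - y) *\<^sub>R g t)" by (simp add: algebra_simps)
    then have "norm (x y - x t - (y - t) *\<^sub>R g t) = norm (x t - x y - (t - y) *\<^sub>R g t)"
      by (metis norm_minus_cancel)
    also have "\<dots> \<le> e * (t - y)" using mv[of y t] y t d(1) False by (auto simp: dist_norm)
    finally show ?thesis using False by (simp add: abs_if)
  qed
  then show "\<exists>d>0. \<forall>y\<in>{a..b}. norm (y - t) < d \<longrightarrow>
      norm (x y - x t - (y - t) *\<^sub>R g t) \<le> e * norm (y - t)"
    using d(1) by (intro exI[of _ d]) simp
qed

section \<open>Comparison functions\<close>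

text \<open>Class \<open>\<K>\<close> functions are extended to increasing homeomorphisms of the line, so that
  inverses, compositions and iterates need no bookkeeping of domains.\<close>

definition real_homeo :: "(real \<Rightarrow> real) \<Rightarrow> bool" where
  "real_homeo a \<longleftrightarrow> strict_mono a \<and> continuous_on UNIV a \<and> a 0 = 0 \<and> surj a"

lemma real_homeo_mono: "real_homeo a \<Longrightarrow> s \<le> u \<Longrightarrow> a s \<le> a u"
  by (auto simp: real_homeo_def dest: strict_mono_mono monoD)

lemma real_homeo_less_iff: "real_homeo a \<Longrightarrow> a s < a u \<longleftrightarrow> s < u"
  by (simp add: real_homeo_def strict_mono_less)

lemma real_homeo_zero: "real_homeo a \<Longrightarrow> a 0 = 0"
  by (simp add: real_homeo_def)

lemma surj_real_if_unbounded:
  fixes a :: "real \<Rightarrow> real"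
  assumes "continuous_on UNIV a" "\<And>y. \<exists>s. y \<le> a s" "\<And>y. \<exists>s. a s \<le> y"
  shows "surj a"
proof -
  have "y \<in> range a" for y
  proof -
    obtain s u where "a s \<le> y" "y \<le> a u" using assms by meson
    moreover have "connected (range a)" using assms(1) connected_continuous_image by blast
    ultimately show ?thesis using connectedD_interval by blast
  qed
  then show ?thesis by blast
qed

lemma real_homeo_comp: "real_homeo a \<Longrightarrow> real_homeo b \<Longrightarrow> real_homeo (a \<circ> b)"
  unfolding real_homeo_def
proof (elim conjE, intro conjI)
  assume "strict_mono a" "strict_mono b"
  then show "strict_mono (a \<circ> b)" by (simp add: strict_mono_def)
next
  assume "continuous_on UNIV a" "continuous_on UNIV b"
  then show "continuous_on UNIV (a \<circ> b)" by (meson continuous_on_compose continuous_on_subset subset_UNIV)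
next
  assume "surj a" "surj b"
  then show "surj (a \<circ> b)" by (rule comp_surj[rotated])
qed simp

lemma real_homeo_inv:
  assumes "real_homeo a"
  shows "real_homeo (inv a)"
proof -
  have a: "strict_mono a" "surj a" "inj a" "a 0 = 0" using assms by (auto simp: real_homeo_def strict_mono_imp_inj_on)
  have m: "strict_mono (inv a)"
    by (rule strict_monoI) (metis a(1,2) strict_mono_less surj_f_inv_f)
  have s: "surj (inv a)" using a(3) by (rule inj_imp_surj_inv)
  have "continuous_on UNIV (inv a)"
    by (rule continuous_onI_mono) (use m s in \<open>auto simp: strict_mono_less_eq\<close>)
  then show ?thesis using m s a by (auto simp: real_homeo_def intro: inv_f_eq)
qed

lemma real_homeo_funpow: "real_homeo a \<Longrightarrow> real_homeo (a ^^ n)"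
proof (induction n)
  case 0
  show ?case by (simp add: real_homeo_def strict_mono_def)
qed (simp add: real_homeo_comp)

lemma real_homeo_class_K: "real_homeo a \<Longrightarrow> 0 < r \<Longrightarrow> class_K r a"
  unfolding class_K_def real_homeo_def
  by (auto simp: strict_mono_on_def strict_mono_def intro: continuous_on_subset)

lemma real_homeo_class_K_infty:
  assumes "real_homeo a"
  shows "class_K_infty a"
  unfolding class_K_infty_def
proof (intro conjI allI)
  fix M
  obtain s where s: "a s = max M 0 + 1" using assms unfolding real_homeo_def by (metis surjD)
  then have "a 0 < a s" using real_homeo_zero[OF assms] by simp
  then have "0 < s" using real_homeo_less_iff[OF assms] by simp
  then show "\<exists>s\<ge>0. M < a s" using s by (intro exI[of _ s]) auto
qed (use assms real_homeo_class_K in auto)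

lemma class_K_mono:
  assumes "class_K r \<alpha>" "0 \<le> s" "s \<le> u" "ereal u \<le> r"
  shows "\<alpha> s \<le> \<alpha> u"
proof -
  have "s \<in> K_domain r" "u \<in> K_domain r" using assms by (auto simp: K_domain_def intro: order_trans[of "ereal s" "ereal u"])
  then show ?thesis using assms unfolding class_K_def strict_mono_on_def
    by (metis le_less)
qed

lemma class_K_nonneg: "class_K r \<alpha> \<Longrightarrow> s \<in> K_domain r \<Longrightarrow> 0 \<le> \<alpha> s"
  using class_K_mono[of r \<alpha> 0 s] by (auto simp: class_K_def K_domain_def)

text \<open>\<open>c\<close> clamps the line into the domain of \<open>\<alpha>\<close>, and
  \<open>s - c s\<close> continues the function with slope 1 where the clamping acts. Strict growth
  comes from \<open>\<alpha>\<close> if \<open>c\<close> grows and from \<open>s - c s\<close> if it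
  does not.\<close>

lemma class_K_extension:
  fixes c :: "real \<Rightarrow> real"
  assumes K: "class_K r \<alpha>" and c: "mono c" "mono (\<lambda>s. s - c s)" "continuous_on UNIV c" "c 0 = 0" "range c \<subseteq> K_domain r"
    and unb: "\<And>y. \<exists>s. y \<le> \<alpha> (c s) + (s - c s)" "\<And>y. \<exists>s. \<alpha> (c s) + (s - c s) \<le> y"
  shows "real_homeo (\<lambda>s. \<alpha> (c s) + (s - c s))"
proof -
  have cont: "continuous_on UNIV (\<lambda>s. \<alpha> (c s) + (s - c s))"
    using K c(3,5) unfolding class_K_def
    by (intro continuous_intros continuous_on_compose2[of "K_domain r" \<alpha> UNIV c]) auto
  have "strict_mono (\<lambda>s. \<alpha> (c s) + (s - c s))"
  proof (rule strict_monoI)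
    fix s u :: real assume su: "s < u"
    have cd: "c s \<in> K_domain r" "c u \<in> K_domain r" using c(5) by auto
    have cm: "c s \<le> c u" "s - c s \<le> u - c u" using su monoD[OF c(1), of s u] monoD[OF c(2), of s u] by auto
    show "\<alpha> (c s) + (s - c s) < \<alpha> (c u) + (u - c u)"
    proof (cases "c s = c u")
      case False
      then have "\<alpha> (c s) < \<alpha> (c u)" using K cd cm unfolding class_K_def strict_mono_on_def by simp
      then show ?thesis using cm by simp
    qed (use su in simp)
  qed
  then show ?thesis using cont surj_real_if_unbounded[OF cont unb] K c(4)
    by (simp add: real_homeo_def class_K_def)
qed

lemma class_K_extension_local:
  assumes K: "class_K r \<alpha>" and "0 < \<rho>" "ereal \<rho> \<le> r"
  obtains a where "real_homeo a" "\<And>s. 0 \<le> s \<Longrightarrow> s \<le> \<rho> \<Longrightarrow> a s = \<alpha> s"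
proof -
  define c :: "real \<Rightarrow> real" where "c s = min \<rho> (max 0 s)" for s
  have "real_homeo (\<lambda>s. \<alpha> (c s) + (s - c s))"
  proof (rule class_K_extension[OF K])
    show "mono c" "mono (\<lambda>s. s - c s)" "continuous_on UNIV c" "c 0 = 0"
      using \<open>0 < \<rho>\<close> by (auto simp: c_def mono_def intro!: continuous_intros)
    show "range c \<subseteq> K_domain r" using assms(2,3)
      by (auto simp: c_def K_domain_def min_def max_def intro: order_trans[of _ "ereal \<rho>"])
    \<comment> \<open>Beyond \<open>\<rho>\<close> the extension is
      \<open>\<alpha> \<rho> + s - \<rho>\<close>, and below 0 it is \<open>s\<close>; the two
      witnesses solve these for \<open>y\<close>.\<close>
    show "\<exists>s. y \<le> \<alpha> (c s) + (s - c s)" for y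
      using \<open>0 < \<rho>\<close> by (intro exI[of _ "max \<rho> (y - \<alpha> \<rho> + \<rho>)"]) (auto simp: c_def min_def max_def)
    show "\<exists>s. \<alpha> (c s) + (s - c s) \<le> y" for y
      using \<open>0 < \<rho>\<close> K by (intro exI[of _ "min 0 y"]) (auto simp: c_def min_def max_def class_K_def)
  qed
  then show thesis by (rule that) (auto simp: c_def)
qed

lemma class_K_infty_extension:
  assumes K: "class_K_infty \<alpha>"
  obtains a where "real_homeo a" "\<And>s. 0 \<le> s \<Longrightarrow> a s = \<alpha> s"
proof -
  define c :: "real \<Rightarrow> real" where "c s = max 0 s" for s
  have "real_homeo (\<lambda>s. \<alpha> (c s) + (s - c s))"
  proof (rule class_K_extension)
    show "class_K \<infinity> \<alpha>" using K by (simp add: class_K_infty_def)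
    show "mono c" "mono (\<lambda>s. s - c s)" "continuous_on UNIV c" "c 0 = 0"
      by (auto simp: c_def mono_def intro!: continuous_intros)
    show "range c \<subseteq> K_domain \<infinity>" by (auto simp: c_def K_domain_def)
    show "\<exists>s. y \<le> \<alpha> (c s) + (s - c s)" for y
    proof -
      obtain s where "s \<ge> 0" "y < \<alpha> s" using K unfolding class_K_infty_def by blast
      then show ?thesis by (intro exI[of _ s]) (auto simp: c_def)
    qed
    show "\<exists>s. \<alpha> (c s) + (s - c s) \<le> y" for y
      using K by (intro exI[of _ "min 0 y"]) (auto simp: c_def min_def max_def class_K_def class_K_infty_def)
  qed
  then show thesis by (rule that) (auto simp: c_def)
qed

section \<open>Bounds on \<open>V\<close> by homeomorphisms of the line\<close>

lemma V_proj_eq: "class_V \<Gamma> domf domV V \<Longrightarrow> V_proj domV = (\<Union>\<gamma>\<in>\<Gamma>. section_at domV \<gamma>)"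
  by (force simp: class_V_def V_proj_def section_at_def)

lemma open_V_proj: "class_V \<Gamma> domf domV V \<Longrightarrow> open (V_proj domV)"
  by (subst V_proj_eq, assumption) (auto simp: class_V_def)

lemma V_nonneg:
  assumes "positive_definite_decrescent \<Gamma> domf domV V" "\<gamma> \<in> \<Gamma>" "\<xi> \<in> V_section domf domV \<gamma>"
  shows "0 \<le> V (\<xi>, \<gamma>)"
proof -
  obtain r\<^sub>1 \<alpha>\<^sub>1 where K: "class_K r\<^sub>1 \<alpha>\<^sub>1" "norm \<xi> \<in> K_domain r\<^sub>1" and le: "\<alpha>\<^sub>1 (norm \<xi>) \<le> V (\<xi>, \<gamma>)"
    using assms unfolding positive_definite_decrescent_def V_bounds_def by blast
  show ?thesis using class_K_nonneg[OF K] le by simp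
qed

lemma V_bounds_local:
  fixes domV :: "('a::euclidean_space \<times> 'g) set"
  assumes V: "class_V \<Gamma> domf domV V" "0 \<in> V_proj domV" and pd: "positive_definite_decrescent \<Gamma> domf domV V"
  obtains \<rho> a\<^sub>1 a\<^sub>2 where "0 < \<rho>" "cball 0 \<rho> \<subseteq> V_proj domV" "real_homeo a\<^sub>1" "real_homeo a\<^sub>2"
    "\<And>\<gamma> \<xi>. \<gamma> \<in> \<Gamma> \<Longrightarrow> \<xi> \<in> V_section domf domV \<gamma> \<Longrightarrow> \<xi> \<in> cball 0 \<rho> \<Longrightarrow>
      a\<^sub>1 (norm \<xi>) \<le> V (\<xi>, \<gamma>) \<and> V (\<xi>, \<gamma>) \<le> a\<^sub>2 (norm \<xi>)"
proof -
  obtain r\<^sub>1 r\<^sub>2 \<alpha>\<^sub>1 \<alpha>\<^sub>2 where K: "class_K r\<^sub>1 \<alpha>\<^sub>1" "class_K r\<^sub>2 \<alpha>\<^sub>2" and b: "V_bounds \<Gamma> domf domV V \<alpha>\<^sub>1 \<alpha>\<^sub>2"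
    using pd unfolding positive_definite_decrescent_def by blast
  obtain \<rho>\<^sub>0 where \<rho>\<^sub>0: "\<rho>\<^sub>0 > 0" "cball 0 \<rho>\<^sub>0 \<subseteq> V_proj domV"
    using open_V_proj[OF V(1)] V(2) open_contains_cball by blast
  have "0 < min (ereal \<rho>\<^sub>0) (min r\<^sub>1 r\<^sub>2)" using K \<rho>\<^sub>0 by (simp add: class_K_def)
  \<comment> \<open>Both \<open>r\<^sub>1\<close> and \<open>r\<^sub>2\<close> may be infinite;
    strictly below the real \<open>\<rho>\<^sub>0\<close> a positive \<open>q\<close> is finite and
    gives a real radius.\<close>
  then obtain q where q: "0 < q" "q < min (ereal \<rho>\<^sub>0) (min r\<^sub>1 r\<^sub>2)" using dense by blast
  then have "\<bar>q\<bar> \<noteq> \<infinity>" by (metis abs_ereal_ge0 less_imp_le min_less_iff_conj not_less_iff_gr_or_eq ereal_infty_less(1))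
  then obtain \<rho> where "q = ereal \<rho>" by auto
  then have \<rho>: "0 < \<rho>" "\<rho> \<le> \<rho>\<^sub>0" "ereal \<rho> \<le> r\<^sub>1" "ereal \<rho> \<le> r\<^sub>2" using q by auto
  obtain a\<^sub>1 where a1: "real_homeo a\<^sub>1" "\<And>s. 0 \<le> s \<Longrightarrow> s \<le> \<rho> \<Longrightarrow> a\<^sub>1 s = \<alpha>\<^sub>1 s"
    using class_K_extension_local[OF K(1) \<rho>(1,3)] by blast
  obtain a\<^sub>2 where a2: "real_homeo a\<^sub>2" "\<And>s. 0 \<le> s \<Longrightarrow> s \<le> \<rho> \<Longrightarrow> a\<^sub>2 s = \<alpha>\<^sub>2 s"
    using class_K_extension_local[OF K(2) \<rho>(1,4)] by blast
  show thesis
  proof (rule that[OF \<rho>(1) _ a1(1) a2(1)])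
    show "cball 0 \<rho> \<subseteq> V_proj domV" using \<rho>\<^sub>0 \<rho> by auto
  qed (use b a1(2) a2(2) in \<open>auto simp: V_bounds_def\<close>)
qed

lemma V_bounds_global:
  assumes "radially_unbounded \<Gamma> domf domV V"
  obtains a\<^sub>1 a\<^sub>2 where "real_homeo a\<^sub>1" "real_homeo a\<^sub>2"
    "\<And>\<gamma> \<xi>. \<gamma> \<in> \<Gamma> \<Longrightarrow> \<xi> \<in> V_section domf domV \<gamma> \<Longrightarrow>
      a\<^sub>1 (norm \<xi>) \<le> V (\<xi>, \<gamma>) \<and> V (\<xi>, \<gamma>) \<le> a\<^sub>2 (norm \<xi>)"
proof -
  obtain \<alpha>\<^sub>1 \<alpha>\<^sub>2 where K: "class_K_infty \<alpha>\<^sub>1" "class_K_infty \<alpha>\<^sub>2" and b: "V_bounds \<Gamma> domf domV V \<alpha>\<^sub>1 \<alpha>\<^sub>2"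
    using assms unfolding radially_unbounded_def by blast
  obtain a\<^sub>1 where a1: "real_homeo a\<^sub>1" "\<And>s. 0 \<le> s \<Longrightarrow> a\<^sub>1 s = \<alpha>\<^sub>1 s"
    using class_K_infty_extension[OF K(1)] by blast
  obtain a\<^sub>2 where a2: "real_homeo a\<^sub>2" "\<And>s. 0 \<le> s \<Longrightarrow> a\<^sub>2 s = \<alpha>\<^sub>2 s"
    using class_K_infty_extension[OF K(2)] by blast
  show thesis
    by (rule that[OF a1(1) a2(1)]) (use b a1(2) a2(2) in \<open>auto simp: V_bounds_def\<close>)
qed

section \<open>Stability\<close>

lemma abs_continuous_on_Icc_imp_continuous_on:
  assumes "abs_continuous_on_Icc a b x"
  shows "continuous_on {a..b} x"
  unfolding continuous_on_iff
proof (intro ballI allI impI)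
  fix t e :: real assume t: "t \<in> {a..b}" and "0 < e"
  then obtain \<delta> where \<delta>: "\<delta> > 0" "\<forall>P :: (real \<times> real) set. finite P \<and> (\<forall>(s, t)\<in>P. a \<le> s \<and> s \<le> t \<and> t \<le> b) \<and>
        pairwise (\<lambda>(s, t) (s', t'). {s<..<t} \<inter> {s'<..<t'} = {}) P \<and>
        (\<Sum>(s, t)\<in>P. t - s) < \<delta> \<longrightarrow> (\<Sum>(s, t)\<in>P. norm (x t - x s)) < e"
    using assms unfolding abs_continuous_on_Icc_def by blast
  have *: "norm (x v - x u) < e" if "a \<le> u" "u \<le> v" "v \<le> b" "v - u < \<delta>" for u v
    using \<delta>(2)[THEN spec[of _ "{(u, v)}"]] that by simp
  have "dist (x s) (x t) < e" if "s \<in> {a..b}" "dist s t < \<delta>" for s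
    using *[of s t] *[of t s] that t by (cases "s \<le> t") (auto simp: dist_norm norm_minus_commute)
  then show "\<exists>d>0. \<forall>s\<in>{a..b}. dist s t < d \<longrightarrow> dist (x s) (x t) < e" using \<delta>(1) by blast
qed

lemma trajectoryD:
  assumes "trajectory \<Gamma> domf f (I, x, \<sigma>)" "forward_complete (I, x, \<sigma>)"
  shows "switching_signal \<Gamma> \<sigma>" "\<And>t. \<sigma> t \<in> \<Gamma>" "\<And>t. 0 \<le> t \<Longrightarrow> (x t, \<sigma> t) \<in> domf"
    "\<And>a b. 0 \<le> a \<Longrightarrow> abs_continuous_on_Icc a b x"
    "AE t in lebesgue. 0 \<le> t \<longrightarrow> (x has_vector_derivative f (x t, \<sigma> t)) (at t within {0..})"
proof -
  have I: "{0..} \<subseteq> I" using assms(2) by (simp add: forward_complete_def)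
  have ode: "ode_solution (\<lambda>t. section_at domf (\<sigma> t)) (\<lambda>t \<xi>. f (\<xi>, \<sigma> t)) I x" and s: "switching_signal \<Gamma> \<sigma>"
    using assms(1) by (auto simp: trajectory_def)
  show "switching_signal \<Gamma> \<sigma>" by (rule s)
  then show "\<sigma> t \<in> \<Gamma>" for t by (auto simp: switching_signal_def)
  show "(x t, \<sigma> t) \<in> domf" if "0 \<le> t" for t
    using ode I that by (auto simp: ode_solution_def section_at_def)
  show "abs_continuous_on_Icc a b x" if "0 \<le> a" for a b
  proof -
    have "{a..b} \<subseteq> I" using I that by auto
    then show ?thesis using ode by (simp add: ode_solution_def locally_abs_continuous_on_def)
  qed
  have "AE t in lebesgue. t \<in> I \<longrightarrow> (x has_vector_derivative f (x t, \<sigma> t)) (at t within I)"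
    using ode by (simp add: ode_solution_def)
  then show "AE t in lebesgue. 0 \<le> t \<longrightarrow> (x has_vector_derivative f (x t, \<sigma> t)) (at t within {0..})"
    by eventually_elim (use I in \<open>auto intro: has_vector_derivative_within_subset\<close>)
qed

lemma trajectory_continuous_on:
  assumes "trajectory \<Gamma> domf f (I, x, \<sigma>)" "forward_complete (I, x, \<sigma>)" "0 \<le> a"
  shows "continuous_on {a..b} x"
  using abs_continuous_on_Icc_imp_continuous_on trajectoryD(4)[OF assms] by blast

lemma trajectory_mem_V_section:
  assumes "trajectory \<Gamma> domf f (I, x, \<sigma>)" "forward_complete (I, x, \<sigma>)" "0 \<le> t" "x t \<in> V_proj domV"
  shows "x t \<in> V_section domf domV (\<sigma> t)"
  using trajectoryD(3)[OF assms(1-3)] assms(4) by (simp add: V_section_def section_at_def)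

section \<open>Gains and the first-exit argument\<close>

text \<open>The gain is conditional on staying in \<open>B\<close> because locally the comparison
  functions bound \<open>V\<close> only on a ball. Local stability uses a ball, global stability
  \<open>UNIV\<close>; a gain on a set is also one on each subset.\<close>

definition gain_on :: "'a::euclidean_space set \<Rightarrow> (real \<Rightarrow> real) \<Rightarrow> ('a, 'g) traj set \<Rightarrow> bool" where
  "gain_on B \<beta> T \<longleftrightarrow> (\<forall>(I, x, \<sigma>)\<in>T. \<forall>s t. 0 \<le> s \<and> s \<le> t \<and> (\<forall>u\<in>{s..t}. x u \<in> B) \<longrightarrow>
     norm (x t) \<le> \<beta> (norm (x s)))"

text \<open>Adding the identity makes a gain expansive on nonnegative arguments; its iterates then
  increase with the exponent, so different numbers of visited modes can be compared.\<close>

lemma real_homeo_add_id: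
  assumes "real_homeo a"
  shows "real_homeo (\<lambda>s. a s + s)"
proof -
  have a: "strict_mono a" "continuous_on UNIV a" "a 0 = 0" using assms by (auto simp: real_homeo_def)
  have cont: "continuous_on UNIV (\<lambda>s. a s + s)" using a(2) by (intro continuous_intros)
  have "y \<le> a (max 0 y) + max 0 y" for y using real_homeo_mono[OF assms, of 0 "max 0 y"] a(3) by auto
  moreover have "a (min 0 y) + min 0 y \<le> y" for y using real_homeo_mono[OF assms, of "min 0 y" 0] a(3) by auto
  ultimately have "surj (\<lambda>s. a s + s)" by (intro surj_real_if_unbounded cont) blast+
  moreover have "strict_mono (\<lambda>s. a s + s)" using a(1) by (auto simp: strict_mono_def add_strict_mono)
  ultimately show ?thesis using cont a(3) by (simp add: real_homeo_def)
qed

lemma funpow_expansive_mono: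
  fixes \<beta> :: "real \<Rightarrow> real"
  assumes "\<And>s. 0 \<le> s \<Longrightarrow> s \<le> \<beta> s" "0 \<le> s" "j \<le> k"
  shows "0 \<le> (\<beta> ^^ j) s \<and> (\<beta> ^^ j) s \<le> (\<beta> ^^ k) s"
proof -
  have nn: "0 \<le> (\<beta> ^^ k) s" for k
    by (induction k) (use assms in \<open>auto intro: order_trans\<close>)
  have "(\<beta> ^^ j) s \<le> (\<beta> ^^ k) s" using \<open>j \<le> k\<close>
    by (induction k rule: dec_induct) (use assms(1)[OF nn] in \<open>auto intro: order_trans\<close>)
  then show ?thesis using nn by blast
qed

text \<open>In a finite \<open>\<Gamma>\<close> the value \<open>\<sigma> s\<close> is isolated, so
  continuity from the right is constancy just after \<open>s\<close>.\<close>

lemma eventually_at_right_finite_range: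
  fixes \<sigma> :: "real \<Rightarrow> 'g::metric_space"
  assumes "finite \<Gamma>" "range \<sigma> \<subseteq> \<Gamma>" "continuous (at_right s) \<sigma>"
  shows "\<exists>b>s. \<forall>u\<in>{s<..<b}. \<sigma> u = \<sigma> s"
proof -
  have "open (- (\<Gamma> - {\<sigma> s}))" using assms(1) by (intro open_Compl finite_imp_closed) auto
  moreover have "(\<sigma> \<longlongrightarrow> \<sigma> s) (at_right s)" using assms(3) by (simp add: continuous_within)
  ultimately have "\<forall>\<^sub>F u in at_right s. \<sigma> u \<in> - (\<Gamma> - {\<sigma> s})" by (intro topological_tendstoD) auto
  then show ?thesis using assms(2) unfolding eventually_at_right_field by fastforce
qed

text \<open>Induction on the number of modes visited: at the first activation of the current mode, one mode
  fewer has been visited.\<close>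

lemma finite_modes_bound:
  fixes \<sigma> :: "real \<Rightarrow> 'g::metric_space"
  assumes fin: "finite \<Gamma>" and rng: "range \<sigma> \<subseteq> \<Gamma>" and rc: "\<And>t. continuous (at_right t) \<sigma>"
    and cont: "continuous_on {t\<^sub>0..t\<^sub>1} x"
    and \<beta>: "mono \<beta>" "\<And>s. 0 \<le> s \<Longrightarrow> s \<le> \<beta> s"
    and mode: "\<And>s t. t\<^sub>0 \<le> s \<Longrightarrow> s \<le> t \<Longrightarrow> t \<le> t\<^sub>1 \<Longrightarrow> \<sigma> s = \<sigma> t \<Longrightarrow> norm (x t) \<le> \<beta> (norm (x s))"
    and t: "t\<^sub>0 \<le> t" "t \<le> t\<^sub>1"
  shows "norm (x t) \<le> (\<beta> ^^ card (\<sigma> ` {t\<^sub>0..t})) (norm (x t\<^sub>0))"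
  using t
proof (induction "card (\<sigma> ` {t\<^sub>0..t})" arbitrary: t rule: less_induct)
  case less
  have finI: "finite (\<sigma> ` {t\<^sub>0..u})" for u using fin rng by (meson finite_subset image_mono order_trans subset_UNIV)
  define k where "k = card (\<sigma> ` {t\<^sub>0..t})"
  have "\<sigma> t \<in> \<sigma> ` {t\<^sub>0..t}" using less.prems by auto
  then have k: "1 \<le> k" unfolding k_def using finI by (metis One_nat_def Suc_leI card_gt_0_iff empty_iff)
  define A where "A = {s \<in> {t\<^sub>0..t}. \<sigma> s = \<sigma> t}"
  define s where "s = Inf A"
  have A: "t \<in> A" "bdd_below A" using less.prems by (auto simp: A_def intro: bdd_belowI[of _ t\<^sub>0])
  have s: "t\<^sub>0 \<le> s" "s \<le> t" using A by (auto simp: s_def A_def intro: cInf_greatest cInf_lower)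
  \<comment> \<open>The infimum is attained: otherwise the mode just after \<open>s\<close> would be
    \<open>\<sigma> s\<close> and would also be \<open>\<sigma> t\<close> at points of
    \<open>A\<close> arbitrarily close to \<open>s\<close>.\<close>
  have "\<sigma> s = \<sigma> t"
  proof (rule ccontr)
    assume neq: "\<sigma> s \<noteq> \<sigma> t"
    obtain b where b: "b > s" "\<And>u. u \<in> {s<..<b} \<Longrightarrow> \<sigma> u = \<sigma> s"
      using eventually_at_right_finite_range[OF fin rng rc] by blast
    obtain a where a: "a \<in> A" "a < b" using cInf_lessD[of A b] A b(1) by (auto simp: s_def)
    have "s \<le> a" using a A by (auto simp: s_def intro: cInf_lower)
    moreover have "a \<noteq> s" using a neq by (auto simp: A_def)
    ultimately have "\<sigma> a = \<sigma> s" using b(2) a by simp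
    then show False using a neq by (simp add: A_def)
  qed
  then have xt: "norm (x t) \<le> \<beta> (norm (x s))" using mode s less.prems by simp
  show ?case
  proof (cases "s = t\<^sub>0")
    case True
    have "\<beta> (norm (x t\<^sub>0)) \<le> (\<beta> ^^ k) (norm (x t\<^sub>0))"
      using funpow_expansive_mono[OF \<beta>(2) norm_ge_zero k] by auto
    then show ?thesis using xt True by (simp add: k_def)
  next
    case False
    then have ts: "t\<^sub>0 < s" using s by simp
    have IH: "norm (x u) \<le> (\<beta> ^^ (k - 1)) (norm (x t\<^sub>0))" if u: "u \<in> {t\<^sub>0..<s}" for u
    proof -
      have "\<sigma> t \<notin> \<sigma> ` {t\<^sub>0..u}"
      proof
        assume "\<sigma> t \<in> \<sigma> ` {t\<^sub>0..u}"
        then obtain v where "v \<in> A" "v \<le> u" using u s by (auto simp: A_def)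
        then show False using cInf_lower[of v A] A u by (simp add: s_def)
      qed
      moreover have "\<sigma> ` {t\<^sub>0..u} \<subseteq> \<sigma> ` {t\<^sub>0..t}" using u s by (intro image_mono) auto
      ultimately have "\<sigma> ` {t\<^sub>0..u} \<subset> \<sigma> ` {t\<^sub>0..t}" using \<open>\<sigma> t \<in> \<sigma> ` {t\<^sub>0..t}\<close> by blast
      then have lt: "card (\<sigma> ` {t\<^sub>0..u}) < k" unfolding k_def by (rule psubset_card_mono[OF finI])
      then have "norm (x u) \<le> (\<beta> ^^ card (\<sigma> ` {t\<^sub>0..u})) (norm (x t\<^sub>0))"
        using less.hyps[of u] u s less.prems by (simp add: k_def)
      also have "\<dots> \<le> (\<beta> ^^ (k - 1)) (norm (x t\<^sub>0))"
        using funpow_expansive_mono[OF \<beta>(2) norm_ge_zero[of "x t\<^sub>0"], of "card (\<sigma> ` {t\<^sub>0..u})" "k - 1"] lt by auto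
      finally show ?thesis .
    qed
    \<comment> \<open>The induction hypothesis covers only times before \<open>s\<close>, since at
      \<open>s\<close> the current mode is already active; continuity of \<open>x\<close> carries
      the bound over.\<close>
    have "norm (x s) \<le> (\<beta> ^^ (k - 1)) (norm (x t\<^sub>0))"
    proof (rule continuous_le_on_closure[of "{t\<^sub>0..<s}" "\<lambda>u. norm (x u)"])
      have "closure {t\<^sub>0..<s} = {t\<^sub>0..s}" using ts by simp
      then show "continuous_on (closure {t\<^sub>0..<s}) (\<lambda>u. norm (x u))" "s \<in> closure {t\<^sub>0..<s}"
        using cont s ts less.prems by (auto intro!: continuous_intros elim: continuous_on_subset)
    qed (rule IH)
    then have "\<beta> (norm (x s)) \<le> \<beta> ((\<beta> ^^ (k - 1)) (norm (x t\<^sub>0)))" by (rule monoD[OF \<beta>(1)])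
    also have "\<dots> = (\<beta> ^^ k) (norm (x t\<^sub>0))" using k by (cases k) auto
    finally show ?thesis using xt by (simp add: k_def)
  qed
qed

lemma real_homeo_gain:
  assumes "real_homeo a\<^sub>1" "a\<^sub>1 s \<le> v" "v \<le> a\<^sub>2 u"
  shows "s \<le> (inv a\<^sub>1 \<circ> a\<^sub>2) u"
proof -
  have "inv a\<^sub>1 (a\<^sub>1 s) \<le> inv a\<^sub>1 (a\<^sub>2 u)"
    using assms by (intro real_homeo_mono[OF real_homeo_inv]) auto
  moreover have "inv a\<^sub>1 (a\<^sub>1 s) = s"
    using assms(1) by (intro inv_f_f) (auto simp: real_homeo_def strict_mono_imp_inj_on)
  ultimately show ?thesis by simp
qed

text \<open>The chain \<open>a\<^sub>1 (norm (x t)) \<le> V (x t, \<sigma> t) \<le> V (x s, \<sigma>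
  s) \<le> a\<^sub>2 (norm (x s))\<close>, solved for \<open>norm (x t)\<close>.\<close>

lemma weak_Lyapunov_gain:
  assumes T: "\<forall>tr\<in>T. trajectory \<Gamma> domf f tr \<and> forward_complete tr"
    and wl: "weak_Lyapunov_pair \<Gamma> domf f T domV V W"
    and B: "B \<subseteq> V_proj domV" and a: "real_homeo a\<^sub>1" "real_homeo a\<^sub>2"
    and bd: "\<And>\<gamma> \<xi>. \<gamma> \<in> \<Gamma> \<Longrightarrow> \<xi> \<in> V_section domf domV \<gamma> \<Longrightarrow> \<xi> \<in> B \<Longrightarrow>
      a\<^sub>1 (norm \<xi>) \<le> V (\<xi>, \<gamma>) \<and> V (\<xi>, \<gamma>) \<le> a\<^sub>2 (norm \<xi>)"
  shows "\<exists>\<beta>. real_homeo \<beta> \<and> gain_on B \<beta> T"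
proof (intro exI conjI)
  show "real_homeo (inv a\<^sub>1 \<circ> a\<^sub>2)" using a by (intro real_homeo_comp real_homeo_inv)
  show "gain_on B (inv a\<^sub>1 \<circ> a\<^sub>2) T" unfolding gain_on_def
  proof (clarify)
    fix I x \<sigma> and s t :: real
    assume mem: "(I, x, \<sigma>) \<in> T" and st: "0 \<le> s" "s \<le> t" and xB: "\<forall>u\<in>{s..t}. x u \<in> B"
    have tr: "trajectory \<Gamma> domf f (I, x, \<sigma>)" "forward_complete (I, x, \<sigma>)" using T mem by auto
    have "\<forall>u\<in>{s..t}. x u \<in> V_proj domV" using xB B by blast
    then have "antimono_on {s..t} (\<lambda>t. V (x t, \<sigma> t))"
      using wl mem st unfolding weak_Lyapunov_pair_def by blast
    then have "V (x t, \<sigma> t) \<le> V (x s, \<sigma> s)" using st by (auto simp: monotone_on_def)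
    moreover have "a\<^sub>1 (norm (x u)) \<le> V (x u, \<sigma> u) \<and> V (x u, \<sigma> u) \<le> a\<^sub>2 (norm (x u))" if "u \<in> {s..t}" for u
      using that st xB B by (intro bd trajectoryD(2)[OF tr] trajectory_mem_V_section[OF tr]) auto
    ultimately show "norm (x t) \<le> (inv a\<^sub>1 \<circ> a\<^sub>2) (norm (x s))"
      using st by (intro real_homeo_gain[OF a(1), where v = "V (x t, \<sigma> t)"]) (auto intro: order_trans)
  qed
qed

text \<open>\<open>V\<close> may jump upwards at a switch, so the chain of inequalities is available
  only between two times with the same mode. \<open>finite_modes_bound\<close> composes such gains,
  and \<open>card \<Gamma>\<close> bounds the number of factors.\<close>

lemma F_weak_Lyapunov_gain:
  assumes T: "\<forall>tr\<in>T. trajectory \<Gamma> domf f tr \<and> forward_complete tr"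
    and "finite \<Gamma>" and wl: "F_weak_Lyapunov_pair \<Gamma> domf f T domV V W"
    and B: "B \<subseteq> V_proj domV" and a: "real_homeo a\<^sub>1" "real_homeo a\<^sub>2"
    and bd: "\<And>\<gamma> \<xi>. \<gamma> \<in> \<Gamma> \<Longrightarrow> \<xi> \<in> V_section domf domV \<gamma> \<Longrightarrow> \<xi> \<in> B \<Longrightarrow>
      a\<^sub>1 (norm \<xi>) \<le> V (\<xi>, \<gamma>) \<and> V (\<xi>, \<gamma>) \<le> a\<^sub>2 (norm \<xi>)"
  shows "\<exists>\<beta>. real_homeo \<beta> \<and> gain_on B \<beta> T"
proof -
  define b where "b = inv a\<^sub>1 \<circ> a\<^sub>2"
  define \<beta> where "\<beta> s = b s + s" for s
  have b: "real_homeo b" unfolding b_def using a by (intro real_homeo_comp real_homeo_inv)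
  have \<beta>: "real_homeo \<beta>" unfolding \<beta>_def by (rule real_homeo_add_id[OF b])
  have exp: "s \<le> \<beta> s" if "0 \<le> s" for s
    using real_homeo_mono[OF b that] real_homeo_zero[OF b] by (simp add: \<beta>_def)
  have "gain_on B (\<beta> ^^ card \<Gamma>) T" unfolding gain_on_def
  proof (clarify)
    fix I x \<sigma> and s t :: real
    assume mem: "(I, x, \<sigma>) \<in> T" and st: "0 \<le> s" "s \<le> t" and xB: "\<forall>u\<in>{s..t}. x u \<in> B"
    have tr: "trajectory \<Gamma> domf f (I, x, \<sigma>)" "forward_complete (I, x, \<sigma>)" using T mem by auto
    have sw: "range \<sigma> \<subseteq> \<Gamma>" "\<And>t. continuous (at_right t) \<sigma>"
      using trajectoryD(1)[OF tr] by (auto simp: switching_signal_def)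
    have mode: "norm (x v) \<le> \<beta> (norm (x u))" if uv: "s \<le> u" "u \<le> v" "v \<le> t" "\<sigma> u = \<sigma> v" for u v
    proof -
      have "\<forall>w\<in>{s..t}. x w \<in> V_proj domV" using xB B by blast
      then have "antimono_on ({s..t} \<inter> \<sigma> -` {\<sigma> u}) (\<lambda>t. V (x t, \<sigma> u))"
        using wl mem st trajectoryD(2)[OF tr, of u] unfolding F_weak_Lyapunov_pair_def by blast
      then have "V (x v, \<sigma> u) \<le> V (x u, \<sigma> u)" using uv by (auto simp: monotone_on_def)
      moreover have "a\<^sub>1 (norm (x w)) \<le> V (x w, \<sigma> w) \<and> V (x w, \<sigma> w) \<le> a\<^sub>2 (norm (x w))" if "w \<in> {s..t}" for w
        using that st xB B by (intro bd trajectoryD(2)[OF tr] trajectory_mem_V_section[OF tr]) auto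
      then have "a\<^sub>1 (norm (x v)) \<le> V (x v, \<sigma> u)" "V (x u, \<sigma> u) \<le> a\<^sub>2 (norm (x u))"
        using uv by (metis atLeastAtMost_iff order_trans)+
      ultimately have "norm (x v) \<le> b (norm (x u))"
        unfolding b_def by (intro real_homeo_gain[OF a(1), where v = "V (x v, \<sigma> u)"]) auto
      then show ?thesis unfolding \<beta>_def using norm_ge_zero[of "x u"] by linarith
    qed
    have "norm (x t) \<le> (\<beta> ^^ card (\<sigma> ` {s..t})) (norm (x s))"
      by (rule finite_modes_bound[OF \<open>finite \<Gamma>\<close> sw trajectory_continuous_on[OF tr st(1)] _ exp mode, where t\<^sub>1 = t])
        (use \<beta> st in \<open>auto simp: real_homeo_def strict_mono_mono\<close>)
    also have "\<dots> \<le> (\<beta> ^^ card \<Gamma>) (norm (x s))"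
    proof -
      have "card (\<sigma> ` {s..t}) \<le> card \<Gamma>" using sw(1) by (intro card_mono \<open>finite \<Gamma>\<close>) auto
      then show ?thesis using funpow_expansive_mono[OF exp norm_ge_zero] by blast
    qed
    finally show "norm (x t) \<le> (\<beta> ^^ card \<Gamma>) (norm (x s))" .
  qed
  then show ?thesis using real_homeo_funpow[OF \<beta>] by blast
qed

text \<open>If the norm reached \<open>\<rho>\<close>, the conditional gain would hold up to the
  first such time and keep the norm at that time below \<open>\<rho>\<close>. So a small start makes
  the gain unconditional.\<close>

lemma gain_on_confined:
  assumes T: "\<forall>tr\<in>T. trajectory \<Gamma> domf f tr \<and> forward_complete tr"
    and g: "real_homeo \<beta>" "gain_on (cball 0 \<rho>) \<beta> T" and "0 < \<rho>"
  obtains r where "0 < r"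
    "\<And>I x \<sigma> s t. (I, x, \<sigma>) \<in> T \<Longrightarrow> 0 \<le> s \<Longrightarrow> s \<le> t \<Longrightarrow> norm (x s) \<le> r \<Longrightarrow>
      norm (x t) < \<rho> \<and> norm (x t) \<le> \<beta> (norm (x s))"
proof -
  \<comment> \<open>The first entry starts the motion inside the ball, the second gives
    \<open>\<beta> r \<le> \<rho> / 2\<close>.\<close>
  define r where "r = min (\<rho> / 2) (inv \<beta> (\<rho> / 2))"
  have inv: "\<beta> (inv \<beta> (\<rho> / 2)) = \<rho> / 2" using g(1) by (simp add: real_homeo_def surj_f_inv_f)
  then have "0 < inv \<beta> (\<rho> / 2)" using real_homeo_less_iff[OF g(1), of 0 "inv \<beta> (\<rho> / 2)"] real_homeo_zero[OF g(1)] \<open>0 < \<rho>\<close> by simp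
  then have r: "0 < r" "r < \<rho>" using \<open>0 < \<rho>\<close> by (auto simp: r_def)
  have "\<beta> r \<le> \<beta> (inv \<beta> (\<rho> / 2))" by (rule real_homeo_mono[OF g(1)]) (simp add: r_def)
  then have \<beta>r: "\<beta> r < \<rho>" using inv \<open>0 < \<rho>\<close> by simp
  have "norm (x t) < \<rho> \<and> norm (x t) \<le> \<beta> (norm (x s))"
    if mem: "(I, x, \<sigma>) \<in> T" and st: "0 \<le> s" "s \<le> t" and xs: "norm (x s) \<le> r" for I x \<sigma> s t
  proof -
    have tr: "trajectory \<Gamma> domf f (I, x, \<sigma>)" "forward_complete (I, x, \<sigma>)" using T mem by auto
    have le: "norm (x v) \<le> \<beta> (norm (x s))" if "s \<le> v" "\<forall>u\<in>{s..v}. norm (x u) \<le> \<rho>" for v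
      using g(2) mem st that unfolding gain_on_def by fastforce
    have small: "\<beta> (norm (x s)) < \<rho>" using real_homeo_mono[OF g(1) xs] \<beta>r by simp
    have conf: "norm (x v) < \<rho>" if v: "v \<in> {s..t}" for v
    proof (rule ccontr)
      assume "\<not> norm (x v) < \<rho>"
      define A where "A = {u \<in> {s..t}. \<rho> \<le> norm (x u)}"
      have cont: "continuous_on {s..t} (\<lambda>u. norm (x u))"
        using trajectory_continuous_on[OF tr st(1)] by (intro continuous_intros)
      have cl: "closed A" unfolding A_def
        by (rule continuous_on_closed_Collect_le[OF _ cont]) (auto intro: continuous_intros)
      have A: "v \<in> A" "bdd_below A" using v \<open>\<not> norm (x v) < \<rho>\<close> by (auto simp: A_def intro: bdd_belowI[of _ s])
      define m where "m = Inf A"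
      have m: "m \<in> A" unfolding m_def using closed_contains_Inf[OF _ A(2) cl] A(1) by blast
      have below: "norm (x u) \<le> \<rho>" if "u \<in> {s..<m}" for u
      proof (rule ccontr)
        assume "\<not> norm (x u) \<le> \<rho>"
        then have "u \<in> A" using that m by (auto simp: A_def)
        then show False using cInf_lower[OF _ A(2), of u] that by (simp add: m_def[symmetric])
      qed
      have "s < m" using m xs r by (force simp: A_def le_less)
      have "norm (x m) \<le> \<rho>"
      proof (rule continuous_le_on_closure[of "{s..<m}" "\<lambda>u. norm (x u)"])
        have "closure {s..<m} = {s..m}" using \<open>s < m\<close> by simp
        then show "continuous_on (closure {s..<m}) (\<lambda>u. norm (x u))" "m \<in> closure {s..<m}"
          using cont m \<open>s < m\<close> by (auto simp: A_def elim: continuous_on_subset)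
      qed (rule below)
      then have "norm (x u) \<le> \<rho>" if "u \<in> {s..m}" for u
        using below[of u] that by (cases "u = m") auto
      then have "norm (x m) \<le> \<beta> (norm (x s))" using \<open>s < m\<close> by (intro le) auto
      then show False using small m by (simp add: A_def)
    qed
    then show ?thesis using le[of t] st by (auto simp: less_imp_le)
  qed
  then show thesis using r(1) that by blast
qed

section \<open>Limits of shifted trajectories\<close>

text \<open>Tychonoff's theorem yields a filter rather than a subsequence, so one limit serves all times at
  once, although there are uncountably many.\<close>

lemma compact_family_cluster_filter:
  fixes g :: "'k \<Rightarrow> 'i \<Rightarrow> 'b::topological_space"
  assumes "F\<^sub>0 \<noteq> bot" and C: "\<And>i. compact (C i)" and g: "\<And>k i. g k i \<in> C i"
  obtains F p where "F \<noteq> bot" "F \<le> F\<^sub>0" "\<And>i. p i \<in> C i" "\<And>i. ((\<lambda>k. g k i) \<longlongrightarrow> p i) F"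
proof -
  have "compactin (product_topology (\<lambda>_. euclidean) UNIV) (Pi\<^sub>E UNIV C)"
    unfolding compactin_PiE using C by simp
  then have "compact (Pi\<^sub>E UNIV C)" by (simp add: euclidean_product_topology)
  moreover have "filtermap g F\<^sub>0 \<noteq> bot" using \<open>F\<^sub>0 \<noteq> bot\<close> by (simp add: filtermap_bot_iff)
  moreover have "eventually (\<lambda>h. h \<in> Pi\<^sub>E UNIV C) (filtermap g F\<^sub>0)"
    using g by (simp add: eventually_filtermap PiE_UNIV_domain)
  ultimately obtain p where p: "p \<in> Pi\<^sub>E UNIV C" "inf (nhds p) (filtermap g F\<^sub>0) \<noteq> bot"
    unfolding compact_filter by meson
  \<comment> \<open>Refining \<open>F\<^sub>0\<close> by the preimages of the neighbourhoods of
    \<open>p\<close> turns clustering into convergence; that \<open>p\<close> is a cluster point is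
    what makes the refinement proper.\<close>
  define F where "F = inf F\<^sub>0 (filtercomap g (nhds p))"
  have "F \<noteq> bot"
  proof
    assume "F = bot"
    then have "eventually (\<lambda>_. False) F" by simp
    then obtain P Q where PQ: "eventually P F\<^sub>0" "eventually Q (filtercomap g (nhds p))" "\<And>k. P k \<Longrightarrow> Q k \<Longrightarrow> False"
      unfolding F_def eventually_inf by blast
    then obtain R where R: "eventually R (nhds p)" "\<And>k. R (g k) \<Longrightarrow> Q k"
      unfolding eventually_filtercomap by blast
    have "eventually (\<lambda>h. \<not> R h) (filtermap g F\<^sub>0)"
      unfolding eventually_filtermap using PQ(1) by eventually_elim (use PQ(3) R(2) in blast)
    then have "eventually (\<lambda>_. False) (inf (nhds p) (filtermap g F\<^sub>0))"
      unfolding eventually_inf using R(1) by blast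
    then show False using p(2) by (simp add: trivial_limit_def)
  qed
  moreover have lim: "(g \<longlongrightarrow> p) F"
    unfolding F_def by (rule filterlim_mono[OF filterlim_filtercomap order_refl]) simp
  have "((\<lambda>k. g k i) \<longlongrightarrow> p i) F" for i
  proof (rule topological_tendstoI)
    fix S :: "'b set" assume S: "open S" "p i \<in> S"
    have "open {h. \<forall>j\<in>{i}. h j \<in> S}" using S(1) by (intro product_topology_basis') auto
    then have "\<forall>\<^sub>F k in F. g k \<in> {h. \<forall>j\<in>{i}. h j \<in> S}"
      by (rule topological_tendstoD[OF lim]) (use S in simp)
    then show "\<forall>\<^sub>F k in F. g k i \<in> S" by simp
  qed
  moreover have "F \<le> F\<^sub>0" by (simp add: F_def)
  ultimately show thesis using p(1) by (intro that) (auto simp: PiE_UNIV_domain)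
qed

text \<open>One forward orbit in a compact set. All that is kept of the average dwell time is
  \<open>dwell\<close>: a bound, uniform in \<open>t\<close>, on the jumps in a window of length
  2.\<close>

locale confined_orbit =
  fixes \<Gamma> :: "'g::metric_space set" and domf :: "('a::euclidean_space \<times> 'g) set" and f :: "'a \<times> 'g \<Rightarrow> 'a"
    and K :: "'a set" and x :: "real \<Rightarrow> 'a" and \<sigma> :: "real \<Rightarrow> 'g" and N :: nat
  assumes \<Gamma>: "compact \<Gamma>" and domf: "domf \<subseteq> UNIV \<times> \<Gamma>" "closed domf" and f: "continuous_on domf f"
    and K: "compact K" and xK: "\<And>t. 0 \<le> t \<Longrightarrow> x t \<in> K"
    and xdom: "\<And>t. 0 \<le> t \<Longrightarrow> (x t, \<sigma> t) \<in> domf"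
    and ac: "\<And>a b. 0 \<le> a \<Longrightarrow> abs_continuous_on_Icc a b x"
    and der: "AE t in lebesgue. 0 \<le> t \<longrightarrow> (x has_vector_derivative f (x t, \<sigma> t)) (at t within {0..})"
    and sw: "switching_signal \<Gamma> \<sigma>"
    and dwell: "\<And>t. card (jump_times \<sigma> \<inter> {t - 1<..<t + 1}) \<le> N"
begin

abbreviation C where "C \<equiv> domf \<inter> (K \<times> \<Gamma>)"

lemma compact_C: "compact C"
  using K \<Gamma> domf(2) by (simp add: closed_Int_compact compact_Times)

lemma \<sigma>\<Gamma>: "\<sigma> t \<in> \<Gamma>"
  using sw by (auto simp: switching_signal_def)

lemma xC: "0 \<le> t \<Longrightarrow> (x t, \<sigma> t) \<in> C"
  using xdom xK \<sigma>\<Gamma> by simp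

lemma AE_der_Icc:
  assumes "0 \<le> a"
  shows "AE t in lebesgue. t \<in> {a..b} \<longrightarrow> (x has_vector_derivative f (x t, \<sigma> t)) (at t within {a..b})"
  using der by eventually_elim (use assms in \<open>auto intro: has_vector_derivative_within_subset\<close>)

lemma mean_value:
  assumes "0 \<le> a" "a \<le> b" "0 \<le> B" "\<And>t. t \<in> {a..b} \<Longrightarrow> norm (f (x t, \<sigma> t) - z) \<le> B"
  shows "norm (x b - x a - (b - a) *\<^sub>R z) \<le> B * (b - a)"
proof (rule abs_continuous_mean_value[OF ac])
  show "AE t in lebesgue. t \<in> {a..b} \<longrightarrow>
      (\<exists>D. (x has_vector_derivative D) (at t within {a..b}) \<and> norm (D - z) \<le> B)"
    using AE_der_Icc[OF assms(1), of b] by eventually_elim (use assms(4) in blast)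
qed (use assms in auto)

text \<open>\<open>f\<close> is bounded on the compact set \<open>C\<close>, hence so is the speed.
  The constant is the same for all shifts, which makes their limit Lipschitz.\<close>

lemma lipschitz: obtains M where "0 \<le> M" "\<And>s t. 0 \<le> s \<Longrightarrow> 0 \<le> t \<Longrightarrow> norm (x t - x s) \<le> M * \<bar>t - s\<bar>"
proof -
  have "compact (f ` C)" by (rule compact_continuous_image[OF _ compact_C]) (use f continuous_on_subset in blast)
  then obtain M where M: "0 < M" "\<And>p. p \<in> C \<Longrightarrow> norm (f p) \<le> M"
    using compact_imp_bounded bounded_pos by (metis imageI)
  have le: "norm (x t - x s) \<le> M * (t - s)" if "0 \<le> s" "s \<le> t" for s t
    using mean_value[of s t M 0] that M xC by auto
  have "norm (x t - x s) \<le> M * \<bar>t - s\<bar>" if "0 \<le> s" "0 \<le> t" for s t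
    using le[of s t] le[of t s] that by (cases "s \<le> t") (auto simp: norm_minus_commute)
  then show thesis using that M by (meson less_imp_le)
qed

lemma const_between:
  assumes "jump_times \<sigma> \<inter> {a<..<b} = {}" "u \<in> {a<..<b}" "v \<in> {a<..<b}"
  shows "\<sigma> u = \<sigma> v"
proof -
  have "jump_times \<sigma> \<inter> {min u v..max u v} = {}" using assms by (auto simp: min_def max_def split: if_splits)
  then have "\<sigma> constant_on {min u v..max u v}" using sw by (simp add: switching_signal_def)
  then show ?thesis unfolding constant_on_def by (metis atLeastAtMost_iff min.cobounded1 min.cobounded2 max.cobounded1 max.cobounded2)
qed

text \<open>Compactness is used for the states, for the signal values and for the truth values of
  "no jump in this window"; the last makes \<open>F\<close> decide this for every window. The clamp
  \<open>max 0\<close> puts \<open>x\<close> in \<open>K\<close> for all \<open>k\<close>, including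
  those with \<open>real k + t\<close> negative.\<close>

lemma limit_exists:
  obtains F y s B where "F \<noteq> bot" "F \<le> sequentially" "\<And>t. y t \<in> K" "\<And>t. s t \<in> \<Gamma>"
    "\<And>t. ((\<lambda>k. x (max 0 (real k + t))) \<longlongrightarrow> y t) F"
    "\<And>t. ((\<lambda>k. \<sigma> (real k + t)) \<longlongrightarrow> s t) F"
    "\<And>p q. \<forall>\<^sub>F k in F. (jump_times \<sigma> \<inter> {real k + p<..<real k + q} = {}) = B p q"
proof -
  obtain F1 y where F1: "F1 \<noteq> bot" "F1 \<le> sequentially" "\<And>t. y t \<in> K"
      "\<And>t. ((\<lambda>k. x (max 0 (real k + t))) \<longlongrightarrow> y t) F1"
    using compact_family_cluster_filter[of sequentially "\<lambda>_. K" "\<lambda>k t. x (max 0 (real k + t))"] K xK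
    by (metis max.cobounded1 sequentially_bot)
  obtain F2 s where F2: "F2 \<noteq> bot" "F2 \<le> F1" "\<And>t. s t \<in> \<Gamma>"
      "\<And>t. ((\<lambda>k. \<sigma> (real k + t)) \<longlongrightarrow> s t) F2"
    using compact_family_cluster_filter[OF F1(1), of "\<lambda>_. \<Gamma>" "\<lambda>k t. \<sigma> (real k + t)"] \<Gamma> \<sigma>\<Gamma> by metis
  obtain F3 B where F3: "F3 \<noteq> bot" "F3 \<le> F2"
      "\<And>p. ((\<lambda>k. jump_times \<sigma> \<inter> {real k + fst p<..<real k + snd p} = {}) \<longlongrightarrow> B p) F3"
    by (rule compact_family_cluster_filter[OF F2(1), of "\<lambda>_. UNIV" "\<lambda>k p. jump_times \<sigma> \<inter> {real k + fst p<..<real k + snd p} = {}"])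
      (auto intro: finite_imp_compact)
  have F31: "F3 \<le> F1" using F3(2) F2(2) by (rule order_trans)
  show thesis
  proof (rule that[of F3 y s "\<lambda>p q. B (p, q)"])
    show "F3 \<noteq> bot" by (rule F3(1))
    show "F3 \<le> sequentially" using F31 F1(2) by (rule order_trans)
    show "y t \<in> K" "s t \<in> \<Gamma>" for t by (rule F1(3), rule F2(3))
    show "((\<lambda>k. x (max 0 (real k + t))) \<longlongrightarrow> y t) F3" for t by (rule tendsto_mono[OF F31 F1(4)])
    show "((\<lambda>k. \<sigma> (real k + t)) \<longlongrightarrow> s t) F3" for t by (rule tendsto_mono[OF F3(2) F2(4)])
    show "\<forall>\<^sub>F k in F3. (jump_times \<sigma> \<inter> {real k + p<..<real k + q} = {}) = B (p, q)" for p q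
      using F3(3)[of "(p, q)"] by (simp add: tendsto_discrete)
  qed
qed

end

section \<open>The limit on the whole line: regular times and the limit equation\<close>

locale orbit_limit = confined_orbit \<Gamma> domf f K x \<sigma> N
  for \<Gamma> :: "'g::metric_space set" and domf :: "('a::euclidean_space \<times> 'g) set" and f :: "'a \<times> 'g \<Rightarrow> 'a"
    and K :: "'a set" and x :: "real \<Rightarrow> 'a" and \<sigma> :: "real \<Rightarrow> 'g" and N :: nat +
  fixes F :: "nat filter" and y :: "real \<Rightarrow> 'a" and s :: "real \<Rightarrow> 'g" and B :: "real \<Rightarrow> real \<Rightarrow> bool"
  assumes F: "F \<noteq> bot" "F \<le> sequentially"
    and yK: "\<And>t. y t \<in> K" and s\<Gamma>: "\<And>t. s t \<in> \<Gamma>"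
    and xlim: "\<And>t. ((\<lambda>k. x (max 0 (real k + t))) \<longlongrightarrow> y t) F"
    and \<sigma>lim: "\<And>t. ((\<lambda>k. \<sigma> (real k + t)) \<longlongrightarrow> s t) F"
    and Blim: "\<And>p q. \<forall>\<^sub>F k in F. (jump_times \<sigma> \<inter> {real k + p<..<real k + q} = {}) = B p q"
begin

lemma late: "\<forall>\<^sub>F k in F. c \<le> real k + t"
proof -
  have "\<forall>\<^sub>F k in sequentially. c - t \<le> real k"
    using filterlim_real_sequentially by (simp add: filterlim_at_top)
  then show ?thesis by (rule filter_leD[OF F(2), THEN eventually_mono]) simp
qed

lemma xlim': "((\<lambda>k. x (real k + t)) \<longlongrightarrow> y t) F"
  by (rule tendsto_cong[THEN iffD1, OF _ xlim[of t]]) (use late[of 0 t] in \<open>auto elim: eventually_mono\<close>)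

lemma x\<sigma>lim: "((\<lambda>k. (x (real k + t), \<sigma> (real k + t))) \<longlongrightarrow> (y t, s t)) F"
  by (intro tendsto_Pair xlim' \<sigma>lim)

lemma late_C: "\<forall>\<^sub>F k in F. (x (real k + t), \<sigma> (real k + t)) \<in> C"
  using late[of 0 t] by (rule eventually_mono) (rule xC)

lemma yC: "(y t, s t) \<in> C"
  by (rule Lim_in_closed_set[OF compact_imp_closed[OF compact_C] late_C F(1) x\<sigma>lim])

lemma y_lipschitz: obtains M where "0 \<le> M" "\<And>t u. norm (y u - y t) \<le> M * \<bar>u - t\<bar>"
proof -
  obtain M where M: "0 \<le> M" "\<And>s t. 0 \<le> s \<Longrightarrow> 0 \<le> t \<Longrightarrow> norm (x t - x s) \<le> M * \<bar>t - s\<bar>"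
    using lipschitz by blast
  have "norm (y u - y t) \<le> M * \<bar>u - t\<bar>" for t u
  proof (rule tendsto_upperbound[OF tendsto_norm[OF tendsto_diff[OF xlim' xlim']] _ F(1)])
    show "\<forall>\<^sub>F k in F. norm (x (real k + u) - x (real k + t)) \<le> M * \<bar>u - t\<bar>"
      using late[of 0 u] late[of 0 t] by eventually_elim (use M(2) in fastforce)
  qed
  then show thesis using that M(1) by blast
qed

lemma y_ac: "abs_continuous_on_Icc a b y"
  using y_lipschitz abs_continuous_on_Icc_if_lipschitz by metis

lemma y_continuous: "continuous_on A y"
proof -
  obtain M where "0 \<le> M" "\<And>t u. norm (y u - y t) \<le> M * \<bar>u - t\<bar>" using y_lipschitz by blast
  then have "M-lipschitz_on A y" by (auto simp: lipschitz_on_def dist_norm)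
  then show ?thesis by (rule lipschitz_on_continuous_on)
qed

text \<open>\<open>B p q\<close> says that the shifted signals eventually do not jump in \<open>]p, q[\<close>.\<close>

definition regular :: "real \<Rightarrow> bool" where
  "regular r \<longleftrightarrow> (\<exists>p q. p < r \<and> r < q \<and> B p q)"

text \<open>One \<open>k\<close> serves all \<open>u\<close> and \<open>v\<close> of the window.
  Pointwise convergence of the shifted signals would not give this uniformity; it is the benefit of
  \<open>B\<close>.\<close>

lemma late_const:
  assumes "B p q"
  shows "\<forall>\<^sub>F k in F. \<forall>u\<in>{p<..<q}. \<forall>v\<in>{p<..<q}. \<sigma> (real k + u) = \<sigma> (real k + v)"
  using Blim[of p q]
proof eventually_elim
  case (elim k)
  then have "jump_times \<sigma> \<inter> {real k + p<..<real k + q} = {}" using assms by simp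
  then show ?case using const_between by simp
qed

lemma s_const:
  assumes "B p q" "u \<in> {p<..<q}" "v \<in> {p<..<q}"
  shows "s u = s v"
proof (rule tendsto_unique[OF F(1) \<sigma>lim])
  show "((\<lambda>k. \<sigma> (real k + u)) \<longlongrightarrow> s v) F"
  proof (rule tendsto_cong[THEN iffD1, OF _ \<sigma>lim[of v]])
    show "\<forall>\<^sub>F k in F. \<sigma> (real k + v) = \<sigma> (real k + u)"
      using late_const[OF assms(1)] by (rule eventually_mono) (use assms(2,3) in blast)
  qed
qed

text \<open>Around an irregular time every window eventually contains a jump of the shifted signal.
  \<open>N + 1\<close> such times would have disjoint windows, and one late \<open>k\<close> would
  yield \<open>N + 1\<close> distinct jumps, against \<open>dwell\<close>.\<close>

lemma finite_irregular: "finite {r \<in> {t - 1<..<t + 1}. \<not> regular r}"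
proof (rule ccontr)
  assume "infinite {r \<in> {t - 1<..<t + 1}. \<not> regular r}"
  then obtain S where S: "S \<subseteq> {r \<in> {t - 1<..<t + 1}. \<not> regular r}" "card S = Suc N" "finite S"
    using infinite_arbitrarily_large by blast
  \<comment> \<open>All upper bounds on the radius: the windows must lie in
    \<open>{t - 1<..<t + 1}\<close> and be pairwise disjoint. The entry 1 makes it plain that the
    minimum exists.\<close>
  define D where "D = insert 1 ((\<lambda>r. r - (t - 1)) ` S \<union> (\<lambda>r. t + 1 - r) ` S \<union>
      (\<lambda>(r, r'). \<bar>r - r'\<bar> / 2) ` {(r, r') \<in> S \<times> S. r \<noteq> r'})"
  define d where "d = Min D"
  have "finite {(r, r') \<in> S \<times> S. r \<noteq> r'}"
    by (rule finite_subset[of _ "S \<times> S"]) (use S(3) in auto)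
  then have D: "finite D" "D \<noteq> {}" using S(3) by (auto simp: D_def)
  have "\<forall>e\<in>D. 0 < e" using S(1) by (auto simp: D_def)
  then have d: "d > 0" using D by (simp add: d_def)
  have dD: "d \<le> e" if "e \<in> D" for e using that D by (simp add: d_def)
  have dS: "t - 1 \<le> r - d" "r + d \<le> t + 1" if "r \<in> S" for r
    using dD[of "r - (t - 1)"] dD[of "t + 1 - r"] that by (auto simp: D_def)
  have dd: "2 * d \<le> \<bar>r - r'\<bar>" if "r \<in> S" "r' \<in> S" "r \<noteq> r'" for r r'
  proof -
    have "\<bar>r - r'\<bar> / 2 \<in> D" unfolding D_def using that by (auto intro!: image_eqI[of _ _ "(r, r')"])
    then show ?thesis using dD by fastforce
  qed
  have "\<forall>r\<in>S. \<forall>\<^sub>F k in F. jump_times \<sigma> \<inter> {real k + (r - d)<..<real k + (r + d)} \<noteq> {}"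
  proof
    fix r assume "r \<in> S"
    then have "\<not> regular r" using S by auto
    then have nB: "\<not> B (r - d) (r + d)" using d unfolding regular_def by (metis diff_less_eq less_add_same_cancel1)
    show "\<forall>\<^sub>F k in F. jump_times \<sigma> \<inter> {real k + (r - d)<..<real k + (r + d)} \<noteq> {}"
      using Blim[of "r - d" "r + d"] by (rule eventually_mono) (use nB in blast)
  qed
  then have "\<forall>\<^sub>F k in F. \<forall>r\<in>S. jump_times \<sigma> \<inter> {real k + (r - d)<..<real k + (r + d)} \<noteq> {}"
    using S(3) by (simp add: eventually_ball_finite)
  then obtain k where k: "\<forall>r\<in>S. jump_times \<sigma> \<inter> {real k + (r - d)<..<real k + (r + d)} \<noteq> {}"
    using F(1) eventually_happens by blast
  have "\<forall>r\<in>S. \<exists>j. j \<in> jump_times \<sigma> \<and> real k + (r - d) < j \<and> j < real k + (r + d)"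
  proof
    fix r assume "r \<in> S"
    then have "jump_times \<sigma> \<inter> {real k + (r - d)<..<real k + (r + d)} \<noteq> {}" using k by (rule bspec[rotated])
    then obtain j where "j \<in> jump_times \<sigma>" "j \<in> {real k + (r - d)<..<real k + (r + d)}" by blast
    then show "\<exists>j. j \<in> jump_times \<sigma> \<and> real k + (r - d) < j \<and> j < real k + (r + d)"
      by (intro exI[of _ j]) simp
  qed
  then obtain j where j: "\<And>r. r \<in> S \<Longrightarrow> j r \<in> jump_times \<sigma> \<and> real k + (r - d) < j r \<and> j r < real k + (r + d)"
    by metis
  have "inj_on j S"
  proof (rule inj_onI, rule ccontr)
    fix r r' assume "r \<in> S" "r' \<in> S" "j r = j r'" "r \<noteq> r'"
    then show False using j[of r] j[of r'] dd[of r r'] by auto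
  qed
  then have "card (j ` S) = Suc N" using S(2) by (simp add: card_image)
  moreover have "j ` S \<subseteq> jump_times \<sigma> \<inter> {real k + t - 1<..<real k + t + 1}"
    using j dS by fastforce
  moreover have "finite (jump_times \<sigma> \<inter> {real k + t - 1<..<real k + t + 1})"
    by (rule finite_subset[of _ "jump_times \<sigma> \<inter> {real k + t - 1..real k + t + 1}"])
      (use sw in \<open>auto simp: switching_signal_def\<close>)
  ultimately have "Suc N \<le> card (jump_times \<sigma> \<inter> {real k + t - 1<..<real k + t + 1})"
    by (metis card_mono)
  then show False using dwell[of "real k + t"] by simp
qed

lemma regular_punctured:
  obtains \<epsilon> where "0 < \<epsilon>" "\<And>r. r \<noteq> t \<Longrightarrow> \<bar>r - t\<bar> < \<epsilon> \<Longrightarrow> regular r"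
proof -
  obtain d where d: "d > 0" "\<forall>r\<in>{r \<in> {t - 1<..<t + 1}. \<not> regular r}. r \<noteq> t \<longrightarrow> d \<le> dist t r"
    using finite_set_avoid[OF finite_irregular] by blast
  show thesis
  proof (rule that[of "min d 1"])
    show "0 < min d 1" using d by simp
    show "regular r" if "r \<noteq> t" "\<bar>r - t\<bar> < min d 1" for r
      using d(2) that by (force simp: dist_real_def abs_minus_commute)
  qed
qed

lemma s_const_on_regular:
  assumes reg: "\<And>r. r \<in> {a<..<b} \<Longrightarrow> regular r"
  obtains \<gamma> where "\<gamma> \<in> \<Gamma>" "\<And>r. r \<in> {a<..<b} \<Longrightarrow> s r = \<gamma>"
proof -
  have "s constant_on {a<..<b}"
  proof (rule locally_constant_imp_constant)
    fix r assume r: "r \<in> {a<..<b}"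
    obtain p q where pq: "p < r" "r < q" "B p q" using reg[OF r] unfolding regular_def by blast
    show "\<exists>T. openin (top_of_set {a<..<b}) T \<and> r \<in> T \<and> (\<forall>u\<in>T. s u = s r)"
    proof (intro exI conjI ballI)
      show "openin (top_of_set {a<..<b}) ({a<..<b} \<inter> {p<..<q})" by (intro openin_open_Int open_greaterThanLessThan)
      show "r \<in> {a<..<b} \<inter> {p<..<q}" using pq r by simp
      show "s u = s r" if "u \<in> {a<..<b} \<inter> {p<..<q}" for u
        using that pq by (intro s_const[OF pq(3)]) auto
    qed
  qed (rule connected_Ioo)
  then obtain c where c: "\<And>r. r \<in> {a<..<b} \<Longrightarrow> s r = c" unfolding constant_on_def by blast
  show thesis
  proof (cases "a < b")
    case True
    then have "s ((a + b) / 2) = c" by (intro c) auto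
    then have "c \<in> \<Gamma>" using s\<Gamma> by metis
    then show thesis using c by (rule that)
  next
    case False
    \<comment> \<open>The interval is empty, so any element of \<open>\<Gamma>\<close> will
      do.\<close>
    then show thesis using that[OF s\<Gamma>[of a]] by simp
  qed
qed

text \<open>On the window the late shifts have constant signal, so by the Lipschitz bound and
  uniform continuity of \<open>f\<close> on \<open>C\<close> the velocity stays within
  \<open>e\<close> of its value at \<open>real k + r\<close>. The resulting linear estimate is
  uniform in \<open>k\<close>, and each of its terms converges along \<open>F\<close>.\<close>

lemma regular_derivative:
  assumes "regular r"
  shows "(y has_vector_derivative f (y r, s r)) (at r)"
  unfolding has_vector_derivative_def has_derivative_within_alt
proof (intro conjI allI impI)
  show "bounded_linear (\<lambda>h. h *\<^sub>R f (y r, s r))" by (rule bounded_linear_scaleR_left)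
  fix e :: real assume e: "e > 0"
  obtain p q where pq: "p < r" "r < q" "B p q" using assms unfolding regular_def by blast
  obtain M where M: "0 \<le> M" "\<And>s t. 0 \<le> s \<Longrightarrow> 0 \<le> t \<Longrightarrow> norm (x t - x s) \<le> M * \<bar>t - s\<bar>"
    using lipschitz by blast
  have "uniformly_continuous_on C f"
    using compact_uniformly_continuous[OF _ compact_C] f continuous_on_subset by blast
  then obtain \<delta> where \<delta>: "\<delta> > 0" "\<And>c c'. c \<in> C \<Longrightarrow> c' \<in> C \<Longrightarrow> dist c' c < \<delta> \<Longrightarrow> dist (f c') (f c) < e"
    using e unfolding uniformly_continuous_on_def by metis
  \<comment> \<open>Within \<open>\<delta> / (M + 1)\<close> the state moves less than
    \<open>\<delta>\<close>; the other entries stay inside the window where the signal is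
    constant.\<close>
  define \<eta> where "\<eta> = min (\<delta> / (M + 1)) (min (r - p) (q - r))"
  have \<eta>: "\<eta> > 0" "\<eta> \<le> r - p" "\<eta> \<le> q - r" using \<delta>(1) M(1) pq by (auto simp: \<eta>_def)
  have M\<eta>: "M * h < \<delta>" if "0 \<le> h" "h < \<eta>" for h
  proof -
    have "M * h \<le> (M + 1) * h" using that by (intro mult_right_mono) auto
    also have "\<dots> < \<delta>" using that M(1) by (simp add: \<eta>_def field_simps)
    finally show ?thesis .
  qed
  have est: "norm (y u - y r - (u - r) *\<^sub>R f (y r, s r)) \<le> e * norm (u - r)" if u: "norm (u - r) < \<eta>" for u
  proof (rule tendsto_upperbound[OF _ _ F(1)])
    have "((\<lambda>k. f (x (real k + r), \<sigma> (real k + r))) \<longlongrightarrow> f (y r, s r)) F"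
      by (rule continuous_on_tendsto_compose[OF continuous_on_subset[OF f, of C] x\<sigma>lim yC late_C]) simp
    then show "((\<lambda>k. norm (x (real k + u) - x (real k + r) - (u - r) *\<^sub>R f (x (real k + r), \<sigma> (real k + r))))
        \<longlongrightarrow> norm (y u - y r - (u - r) *\<^sub>R f (y r, s r))) F"
      by (intro tendsto_intros xlim')
    show "\<forall>\<^sub>F k in F. norm (x (real k + u) - x (real k + r) - (u - r) *\<^sub>R f (x (real k + r), \<sigma> (real k + r)))
        \<le> e * norm (u - r)"
      using late[of 0 u] late[of 0 r] late_const[OF pq(3)]
    proof eventually_elim
      case (elim k)
      let ?z = "f (x (real k + r), \<sigma> (real k + r))"
      have fz: "norm (f (x v, \<sigma> v) - ?z) \<le> e" if v: "v \<in> {real k + min u r..real k + max u r}" for v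
      proof -
        have vr: "\<bar>v - (real k + r)\<bar> \<le> \<bar>u - r\<bar>" "0 \<le> v" using v elim by (auto simp: min_def max_def split: if_splits)
        have "norm (x v - x (real k + r)) \<le> M * \<bar>v - (real k + r)\<bar>" using M(2) vr elim by simp
        also have "\<dots> < \<delta>" using vr u by (intro M\<eta>) auto
        finally have d: "dist (x v) (x (real k + r)) < \<delta>" by (simp add: dist_norm)
        have "v - real k \<in> {p<..<q}" using vr u \<eta> by auto
        moreover have "r \<in> {p<..<q}" using pq by simp
        ultimately have "\<sigma> (real k + (v - real k)) = \<sigma> (real k + r)" using elim(3) by blast
        then have "\<sigma> v = \<sigma> (real k + r)" by simp
        then have "dist (x v, \<sigma> v) (x (real k + r), \<sigma> (real k + r)) < \<delta>" using d by (simp add: dist_Pair_Pair)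
        then have "dist (f (x v, \<sigma> v)) ?z < e" using vr elim by (intro \<delta>(2) xC) auto
        then show ?thesis by (simp add: dist_norm)
      qed
      show ?case
      proof (cases "r \<le> u")
        case True
        then show ?thesis using mean_value[of "real k + r" "real k + u" e ?z] fz e elim by simp
      next
        case False
        have eq: "x (real k + u) - x (real k + r) - (u - r) *\<^sub>R ?z = - (x (real k + r) - x (real k + u) - (r - u) *\<^sub>R ?z)"
          by (simp add: algebra_simps)
        show ?thesis unfolding eq norm_minus_cancel
          using mean_value[of "real k + u" "real k + r" e ?z] fz e elim False by simp
      qed
    qed
  qed
  then show "\<exists>d>0. \<forall>u\<in>UNIV. norm (u - r) < d \<longrightarrow> norm (y u - y r - (u - r) *\<^sub>R f (y r, s r)) \<le> e * norm (u - r)"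
    using \<eta>(1) by (intro exI[of _ \<eta>]) simp
qed

text \<open>At the end points \<open>s\<close> may differ from \<open>\<gamma>\<close>. Closedness
  of \<open>domf\<close> and continuity of \<open>y\<close> keep \<open>(y r, \<gamma>)\<close> in
  the domain there, and the continuous velocity extends the equation one-sidedly.\<close>

lemma closed_mode:
  assumes "a < b" and reg: "\<And>r. r \<in> {a<..<b} \<Longrightarrow> regular r \<and> s r = \<gamma>" and r: "r \<in> {a..b}"
  shows "(y r, \<gamma>) \<in> domf" "(y has_vector_derivative f (y r, \<gamma>)) (at r within {a..b})"
proof -
  have dom: "(y u, \<gamma>) \<in> domf" if u: "u \<in> {a..b}" for u
  proof -
    have "isCont y v" for v using y_continuous[of UNIV] by (simp add: continuous_on_eq_continuous_at)
    then have "closed ((\<lambda>u. (y u, \<gamma>)) -` domf)"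
      by (intro continuous_closed_vimage[OF domf(2)] continuous_Pair) auto
    moreover have "{a<..<b} \<subseteq> (\<lambda>u. (y u, \<gamma>)) -` domf" using yC reg by force
    ultimately have "closure {a<..<b} \<subseteq> (\<lambda>u. (y u, \<gamma>)) -` domf" by (rule closure_minimal[rotated])
    then show ?thesis using u \<open>a < b\<close> by auto
  qed
  then show "(y r, \<gamma>) \<in> domf" using r .
  show "(y has_vector_derivative f (y r, \<gamma>)) (at r within {a..b})"
  proof (rule abs_continuous_has_vector_derivative[OF y_ac _ _ r])
    have "{a, b} \<in> null_sets lebesgue" by (simp add: negligible_iff_null_sets[symmetric])
    then have "AE u in lebesgue. u \<notin> {a, b}" by (rule AE_not_in)
    then show "AE u in lebesgue. u \<in> {a..b} \<longrightarrow> (y has_vector_derivative f (y u, \<gamma>)) (at u within {a..b})"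
    proof eventually_elim
      case (elim u)
      show ?case
      proof
        assume "u \<in> {a..b}"
        then have "regular u" "s u = \<gamma>" using reg elim by auto
        then show "(y has_vector_derivative f (y u, \<gamma>)) (at u within {a..b})"
          using regular_derivative by (metis has_vector_derivative_at_within)
      qed
    qed
    show "continuous_on {a..b} (\<lambda>u. f (y u, \<gamma>))"
      by (rule continuous_on_compose2[OF f]) (use dom in \<open>auto intro!: continuous_intros y_continuous\<close>)
  qed
qed

end

section \<open>Invariance\<close>

text \<open>The observability sets require solutions that pass through the point at time 0, so the
  curve is translated by \<open>t\<close>.\<close>

lemma shifted_output_zeroing:
  fixes y :: "real \<Rightarrow> 'a::euclidean_space"
  assumes I: "is_interval I" "0 \<in> I" and lip: "\<And>u v. norm (y v - y u) \<le> M * \<bar>v - u\<bar>"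
    and sol: "\<And>u. u \<in> I \<Longrightarrow> y (t + u) \<in> X \<and> h (y (t + u)) = 0 \<and>
      (y has_vector_derivative g (y (t + u))) (at (t + u) within (+) t ` I)"
  shows "y t \<in> output_zeroing X g h I"
proof -
  let ?\<phi> = "\<lambda>u. y (t + u)"
  have "abs_continuous_on_Icc a b ?\<phi>" for a b
    using lip[of "t + _" "t + _"] by (intro abs_continuous_on_Icc_if_lipschitz[of a b ?\<phi> M]) simp
  moreover have "(?\<phi> has_vector_derivative g (?\<phi> u)) (at u within I)" if u: "u \<in> I" for u
  proof -
    have "((+) t has_vector_derivative 1) (at u within I)"
      by (auto intro!: derivative_eq_intros)
    from vector_diff_chain_within[OF this, of y "g (?\<phi> u)"] sol[OF u]
    show ?thesis by (simp add: o_def)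
  qed
  ultimately have "autonomous_solution X g I ?\<phi>"
    using I sol by (auto simp: ode_solution_def locally_abs_continuous_on_def)
  moreover have "y t \<in> X" using sol[OF I(2)] by simp
  ultimately show ?thesis unfolding output_zeroing_def
    using sol by (intro CollectI conjI exI[of _ ?\<phi>]) auto
qed

text \<open>The value of \<open>s\<close> at \<open>t\<close> itself is left free, as it may be
  exceptional; the values \<open>G t\<close> on the punctured neighbourhoods agree where these
  overlap, and connectedness of the line makes \<open>G\<close> constant.\<close>

lemma locally_eventually_constant:
  fixes s :: "real \<Rightarrow> 'c"
  assumes "\<And>t. \<exists>\<epsilon>>0. \<exists>\<gamma>. P t \<gamma> \<and> (\<forall>r. r \<noteq> t \<longrightarrow> \<bar>r - t\<bar> < \<epsilon> \<longrightarrow> s r = \<gamma>)"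
  shows "\<exists>\<gamma>. \<forall>t. P t \<gamma>"
proof -
  obtain \<epsilon> G where G: "\<And>t. \<epsilon> t > 0" "\<And>t. P t (G t)" "\<And>t r. r \<noteq> t \<Longrightarrow> \<bar>r - t\<bar> < \<epsilon> t \<Longrightarrow> s r = G t"
    using assms by metis
  have eq: "G u = G t" if "\<bar>u - t\<bar> < \<epsilon> t" for t u
  proof -
    \<comment> \<open>A common point of both punctured neighbourhoods must avoid both centres; one
      of \<open>u + h\<close> and \<open>u - h\<close> differs from \<open>t\<close>.\<close>
    define h where "h = min (\<epsilon> u) (\<epsilon> t - \<bar>u - t\<bar>) / 2"
    have h: "h > 0" "h < \<epsilon> u" "h < \<epsilon> t - \<bar>u - t\<bar>" using G(1)[of u] that by (auto simp: h_def min_def)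
    have "\<exists>r. r \<noteq> u \<and> r \<noteq> t \<and> \<bar>r - u\<bar> < \<epsilon> u \<and> \<bar>r - t\<bar> < \<epsilon> t"
    proof (cases "u + h = t")
      case True
      then show ?thesis using h by (intro exI[of _ "u - h"]) auto
    next
      case False
      then show ?thesis using h by (intro exI[of _ "u + h"]) auto
    qed
    then show ?thesis using G(3) by metis
  qed
  have "G constant_on UNIV"
  proof (rule locally_constant_imp_constant)
    fix t :: real
    show "\<exists>S. openin (top_of_set UNIV) S \<and> t \<in> S \<and> (\<forall>u\<in>S. G u = G t)"
      using G(1)[of t] by (intro exI[of _ "ball t (\<epsilon> t)"] conjI ballI eq) (auto simp: dist_real_def)
  qed simp
  then obtain c where c: "\<And>t. G t = c" unfolding constant_on_def by blast
  have "P t c" for t using G(2)[of t] c[of t] by simp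
  then show ?thesis by blast
qed

text \<open>\<open>A\<close> will be the half-line or the set of times in one mode. The latter may
  be bounded or empty, so convergence is stated through tails of \<open>A\<close>; if
  \<open>A\<close> is empty, every \<open>c\<close> works.\<close>

lemma antimono_bounded_tail:
  fixes v :: "real \<Rightarrow> real"
  assumes "antimono_on A v" "\<And>t. t \<in> A \<Longrightarrow> 0 \<le> v t"
  shows "\<exists>c. \<forall>e>0. \<exists>t\<^sub>1. \<forall>t\<in>A. t\<^sub>1 \<le> t \<longrightarrow> \<bar>v t - c\<bar> < e"
proof (cases "A = {}")
  case False
  define c where "c = Inf (v ` A)"
  have bdd: "bdd_below (v ` A)" using assms(2) by (auto intro: bdd_belowI[of _ 0])
  have "\<exists>t\<^sub>1. \<forall>t\<in>A. t\<^sub>1 \<le> t \<longrightarrow> \<bar>v t - c\<bar> < e" if "e > 0" for e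
  proof -
    have "Inf (v ` A) < c + e" using that by (simp add: c_def)
    then obtain t\<^sub>1 where t1: "t\<^sub>1 \<in> A" "v t\<^sub>1 < c + e"
      using cInf_lessD[of "v ` A" "c + e"] False by auto
    have "\<bar>v t - c\<bar> < e" if "t \<in> A" "t\<^sub>1 \<le> t" for t
    proof -
      have "v t \<le> v t\<^sub>1" using assms(1) that t1(1) by (simp add: monotone_on_def)
      moreover have "c \<le> v t" unfolding c_def using bdd that by (intro cInf_lower) auto
      ultimately show ?thesis using t1(2) that \<open>e > 0\<close> by auto
    qed
    then show ?thesis by blast
  qed
  then show ?thesis by blast
qed simp

lemma has_vector_derivative_chain_V:
  fixes y :: "real \<Rightarrow> 'a::euclidean_space" and V :: "'a \<Rightarrow> real"
  assumes "V differentiable (at (y r))" "(y has_vector_derivative d) (at r within S)"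
  shows "((\<lambda>u. V (y u)) has_vector_derivative frechet_derivative V (at (y r)) d) (at r within S)"
proof -
  have "(V has_derivative frechet_derivative V (at (y r))) (at (y r) within y ` S)"
    using assms(1) by (simp add: frechet_derivative_works has_derivative_at_withinI)
  from vector_derivative_diff_chain_within[OF assms(2) this] show ?thesis by (simp add: o_def)
qed

context confined_orbit
begin

text \<open>While the mode is constant the velocity is continuous in time, so \<open>x\<close> is
  differentiable everywhere there and the classical mean value theorem applies to \<open>V\<close>
  along \<open>x\<close>.\<close>

lemma V_decrease:
  assumes V: "class_V \<Gamma> domf domV V" and dec: "Lyapunov_decrease \<Gamma> domf f domV V W" and KO: "K \<subseteq> V_proj domV"
    and ab: "0 \<le> a" "a < b" and const: "\<And>t. t \<in> {a..b} \<Longrightarrow> \<sigma> t = \<gamma>" and W: "\<And>t. t \<in> {a..b} \<Longrightarrow> w \<le> W (x t, \<gamma>)"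
  shows "V (x b, \<gamma>) \<le> V (x a, \<gamma>) - w * (b - a)"
proof -
  have \<gamma>: "\<gamma> \<in> \<Gamma>" using \<sigma>\<Gamma>[of a] const[of a] ab by auto
  have mem: "x t \<in> V_section domf domV \<gamma>" if "t \<in> {a..b}" for t
    using xdom[of t] xK[of t] const[OF that] KO that ab by (auto simp: V_section_def section_at_def)
  have dx: "(x has_vector_derivative f (x t, \<gamma>)) (at t within {a..b})" if "t \<in> {a..b}" for t
  proof (rule abs_continuous_has_vector_derivative[OF ac[OF ab(1)] _ _ that])
    show "AE t in lebesgue. t \<in> {a..b} \<longrightarrow> (x has_vector_derivative f (x t, \<gamma>)) (at t within {a..b})"
      using AE_der_Icc[OF ab(1), of b] by (rule eventually_mono) (use const in auto)
    show "continuous_on {a..b} (\<lambda>t. f (x t, \<gamma>))"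
      by (rule continuous_on_compose2[OF f])
        (use mem abs_continuous_on_Icc_imp_continuous_on[OF ac[OF ab(1)]] in
          \<open>auto intro!: continuous_intros simp: V_section_def section_at_def\<close>)
  qed
  let ?V = "\<lambda>\<zeta>. V (\<zeta>, \<gamma>)"
  let ?D = "\<lambda>t. frechet_derivative ?V (at (x t)) (f (x t, \<gamma>))"
  have "((\<lambda>t. ?V (x t)) has_derivative (\<lambda>h. h *\<^sub>R ?D t)) (at t within {a..b})" if "t \<in> {a..b}" for t
    using has_vector_derivative_chain_V[OF _ dx[OF that], of ?V] V \<gamma> mem[OF that]
    by (simp add: class_V_def has_vector_derivative_def)
  from mvt_simple[OF ab(2) this] obtain t where t: "t \<in> {a<..<b}" "V (x b, \<gamma>) - V (x a, \<gamma>) = (b - a) * ?D t"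
    by auto
  then have t': "t \<in> {a..b}" by simp
  have "- ?D t \<ge> W (x t, \<gamma>)" using dec \<gamma> mem[OF t'] unfolding Lyapunov_decrease_def by blast
  then have "?D t \<le> - w" using W[OF t'] by simp
  then have "(b - a) * ?D t \<le> (b - a) * - w" using ab by (intro mult_left_mono) auto
  then show ?thesis using t(2) by (simp add: algebra_simps)
qed

end

section \<open>Modes of the limit, with \<open>V\<close> and \<open>W\<close> along it\<close>

context orbit_limit
begin

text \<open>The interval is open because its end points may be switching times of the limit.\<close>

definition mode_on :: "'g \<Rightarrow> real \<Rightarrow> real \<Rightarrow> bool" where
  "mode_on \<gamma> a b \<longleftrightarrow> (\<forall>r\<in>{a<..<b}. regular r \<and> s r = \<gamma>)"

lemma mode_on_mem:
  assumes "K \<subseteq> V_proj domV" "a < b" "mode_on \<gamma> a b" "r \<in> {a..b}"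
  shows "y r \<in> V_section domf domV \<gamma>" "(y has_vector_derivative f (y r, \<gamma>)) (at r within {a..b})"
  using closed_mode[OF assms(2) _ assms(4), of \<gamma>] assms(1,3) yK[of r]
  by (auto simp: mode_on_def V_section_def section_at_def)

lemma modes_around:
  obtains \<epsilon> \<gamma>\<^sub>1 \<gamma>\<^sub>2 where "0 < \<epsilon>" "\<gamma>\<^sub>1 \<in> \<Gamma>" "\<gamma>\<^sub>2 \<in> \<Gamma>" "mode_on \<gamma>\<^sub>1 (t - \<epsilon>) t" "mode_on \<gamma>\<^sub>2 t (t + \<epsilon>)"
proof -
  obtain \<epsilon> where \<epsilon>: "0 < \<epsilon>" "\<And>r. r \<noteq> t \<Longrightarrow> \<bar>r - t\<bar> < \<epsilon> \<Longrightarrow> regular r"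
    using regular_punctured by blast
  have reg: "regular r" if "r \<in> {t - \<epsilon><..<t} \<or> r \<in> {t<..<t + \<epsilon>}" for r using \<epsilon>(2)[of r] that by auto
  obtain \<gamma>\<^sub>1 where "\<gamma>\<^sub>1 \<in> \<Gamma>" "\<And>r. r \<in> {t - \<epsilon><..<t} \<Longrightarrow> s r = \<gamma>\<^sub>1" using s_const_on_regular reg by metis
  moreover obtain \<gamma>\<^sub>2 where "\<gamma>\<^sub>2 \<in> \<Gamma>" "\<And>r. r \<in> {t<..<t + \<epsilon>} \<Longrightarrow> s r = \<gamma>\<^sub>2" using s_const_on_regular reg by metis
  ultimately show thesis using \<epsilon>(1) reg by (intro that[of \<epsilon> \<gamma>\<^sub>1 \<gamma>\<^sub>2]) (auto simp: mode_on_def)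
qed

lemma output_zeroing_limit:
  assumes "is_interval I" "0 \<in> I"
    and "\<And>u. u \<in> I \<Longrightarrow> y (t + u) \<in> X \<and> h (y (t + u)) = 0 \<and>
      (y has_vector_derivative g (y (t + u))) (at (t + u) within (+) t ` I)"
  shows "y t \<in> output_zeroing X g h I"
proof -
  obtain M where "\<And>t u. norm (y u - y t) \<le> M * \<bar>u - t\<bar>" using y_lipschitz by blast
  from shifted_output_zeroing[OF assms(1,2) this assms(3)] show ?thesis .
qed

text \<open>The common end of the three cases, which differ only in how they prove \<open>W0\<close>
  and in the condition behind \<open>switch\<close>. At each time the mode on the left puts
  \<open>y t\<close> into the backward set and the mode on the right into the forward set, so
  \<open>switch\<close> makes the two modes equal where \<open>y t\<close> is not 0.\<close>

lemma limit_reaches_zero: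
  assumes KO: "K \<subseteq> V_proj domV" and ci: "condition_i \<Gamma> domf f domV W"
    and W0: "\<And>a b \<gamma> r. a < b \<Longrightarrow> \<gamma> \<in> \<Gamma> \<Longrightarrow> mode_on \<gamma> a b \<Longrightarrow> r \<in> {a..b} \<Longrightarrow> W (y r, \<gamma>) = 0"
    and switch: "\<And>a t b \<gamma> \<gamma>'. a < t \<Longrightarrow> t < b \<Longrightarrow> \<gamma> \<in> \<Gamma> \<Longrightarrow> \<gamma>' \<in> \<Gamma> \<Longrightarrow> \<gamma> \<noteq> \<gamma>' \<Longrightarrow>
      mode_on \<gamma> a t \<Longrightarrow> mode_on \<gamma>' t b \<Longrightarrow>
      y t \<in> obs_b (V_section domf domV \<gamma>) (\<lambda>\<xi>. f (\<xi>, \<gamma>)) (\<lambda>\<xi>. W (\<xi>, \<gamma>)) \<Longrightarrow>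
      y t \<in> obs_f (V_section domf domV \<gamma>') (\<lambda>\<xi>. f (\<xi>, \<gamma>')) (\<lambda>\<xi>. W (\<xi>, \<gamma>')) \<Longrightarrow> y t = 0"
  shows "0 \<in> K"
proof (rule ccontr)
  assume "0 \<notin> K"
  then have y0: "y t \<noteq> 0" for t using yK[of t] by auto
  let ?P = "\<lambda>t \<gamma>. \<gamma> \<in> \<Gamma> \<and> y t \<in> V_section domf domV \<gamma> \<and> W (y t, \<gamma>) = 0 \<and> (y has_vector_derivative f (y t, \<gamma>)) (at t)"
  have "\<exists>\<epsilon>>0. \<exists>\<gamma>. ?P t \<gamma> \<and> (\<forall>r. r \<noteq> t \<longrightarrow> \<bar>r - t\<bar> < \<epsilon> \<longrightarrow> s r = \<gamma>)" for t
  proof -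
    obtain \<epsilon> \<gamma>\<^sub>1 \<gamma>\<^sub>2 where \<epsilon>: "0 < \<epsilon>" and \<gamma>: "\<gamma>\<^sub>1 \<in> \<Gamma>" "\<gamma>\<^sub>2 \<in> \<Gamma>"
      and m: "mode_on \<gamma>\<^sub>1 (t - \<epsilon>) t" "mode_on \<gamma>\<^sub>2 t (t + \<epsilon>)"
      using modes_around[of t] by blast
    have lt: "t - \<epsilon> < t" "t < t + \<epsilon>" using \<epsilon> by auto
    have "y t \<in> output_zeroing (V_section domf domV \<gamma>\<^sub>1) (\<lambda>\<xi>. f (\<xi>, \<gamma>\<^sub>1)) (\<lambda>\<xi>. W (\<xi>, \<gamma>\<^sub>1)) {-\<epsilon>..0}"
    proof (rule output_zeroing_limit)
      fix u assume "u \<in> {-\<epsilon>..0}"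
      then have "t + u \<in> {t - \<epsilon>..t}" by auto
      then show "y (t + u) \<in> V_section domf domV \<gamma>\<^sub>1 \<and> W (y (t + u), \<gamma>\<^sub>1) = 0 \<and>
          (y has_vector_derivative f (y (t + u), \<gamma>\<^sub>1)) (at (t + u) within (+) t ` {-\<epsilon>..0})"
        using mode_on_mem[OF KO lt(1) m(1)] W0[OF lt(1) \<gamma>(1) m(1)] by (simp add: image_add_atLeastAtMost)
    qed (use \<epsilon> in \<open>auto simp: is_interval_cc\<close>)
    then have b: "y t \<in> obs_b (V_section domf domV \<gamma>\<^sub>1) (\<lambda>\<xi>. f (\<xi>, \<gamma>\<^sub>1)) (\<lambda>\<xi>. W (\<xi>, \<gamma>\<^sub>1))"
      unfolding obs_b_def using \<epsilon> by blast
    have "y t \<in> output_zeroing (V_section domf domV \<gamma>\<^sub>2) (\<lambda>\<xi>. f (\<xi>, \<gamma>\<^sub>2)) (\<lambda>\<xi>. W (\<xi>, \<gamma>\<^sub>2)) {0..\<epsilon>}"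
    proof (rule output_zeroing_limit)
      fix u assume "u \<in> {0..\<epsilon>}"
      then have "t + u \<in> {t..t + \<epsilon>}" by auto
      then show "y (t + u) \<in> V_section domf domV \<gamma>\<^sub>2 \<and> W (y (t + u), \<gamma>\<^sub>2) = 0 \<and>
          (y has_vector_derivative f (y (t + u), \<gamma>\<^sub>2)) (at (t + u) within (+) t ` {0..\<epsilon>})"
        using mode_on_mem[OF KO lt(2) m(2)] W0[OF lt(2) \<gamma>(2) m(2)] by (simp add: image_add_atLeastAtMost add.commute[of \<epsilon>])
    qed (use \<epsilon> in \<open>auto simp: is_interval_cc\<close>)
    then have fw: "y t \<in> obs_f (V_section domf domV \<gamma>\<^sub>2) (\<lambda>\<xi>. f (\<xi>, \<gamma>\<^sub>2)) (\<lambda>\<xi>. W (\<xi>, \<gamma>\<^sub>2))"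
      unfolding obs_f_def using \<epsilon> by blast
    have eq: "\<gamma>\<^sub>1 = \<gamma>\<^sub>2" using switch[OF lt \<gamma> _ m b fw] y0 by blast
    have tt: "t \<in> {t - \<epsilon>..t}" "t \<in> {t..t + \<epsilon>}" using \<epsilon> by auto
    \<comment> \<open>Equal modes give equal one-sided derivatives, which glue to a two-sided
      one.\<close>
    have "(y has_vector_derivative f (y t, \<gamma>\<^sub>1)) (at t within {t - \<epsilon>..t} \<union> {t..t + \<epsilon>})"
      using mode_on_mem(2)[OF KO lt(1) m(1) tt(1)] mode_on_mem(2)[OF KO lt(2) m(2) tt(2)] eq
      unfolding has_vector_derivative_def has_derivative_within by (auto intro: Lim_Un)
    moreover have "{t - \<epsilon>..t} \<union> {t..t + \<epsilon>} = {t - \<epsilon>..t + \<epsilon>}" using \<epsilon> by auto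
    ultimately have "(y has_vector_derivative f (y t, \<gamma>\<^sub>1)) (at t)"
      using \<epsilon> by (simp add: at_within_Icc_at)
    then have "?P t \<gamma>\<^sub>1"
      using \<gamma> mode_on_mem(1)[OF KO lt(1) m(1) tt(1)] W0[OF lt(1) \<gamma>(1) m(1) tt(1)] by blast
    moreover have "s r = \<gamma>\<^sub>1" if "r \<noteq> t" "\<bar>r - t\<bar> < \<epsilon>" for r
    proof -
      have "r \<in> {t - \<epsilon><..<t} \<or> r \<in> {t<..<t + \<epsilon>}" using that by auto
      then show ?thesis using m eq by (auto simp: mode_on_def)
    qed
    ultimately show ?thesis using \<epsilon> by blast
  qed
  from locally_eventually_constant[of ?P s, OF this]
  obtain \<gamma> where \<gamma>: "\<And>t. ?P t \<gamma>" by blast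
  have oz: "y 0 \<in> output_zeroing (V_section domf domV \<gamma>) (\<lambda>\<xi>. f (\<xi>, \<gamma>)) (\<lambda>\<xi>. W (\<xi>, \<gamma>)) I"
    if "is_interval I" "0 \<in> I" for I
    by (rule output_zeroing_limit[OF that]) (use \<gamma> in \<open>auto intro: has_vector_derivative_at_within\<close>)
  have "y 0 \<in> obs_f_inf (V_section domf domV \<gamma>) (\<lambda>\<xi>. f (\<xi>, \<gamma>)) (\<lambda>\<xi>. W (\<xi>, \<gamma>))"
    "y 0 \<in> obs_b_inf (V_section domf domV \<gamma>) (\<lambda>\<xi>. f (\<xi>, \<gamma>)) (\<lambda>\<xi>. W (\<xi>, \<gamma>))"
    unfolding obs_f_inf_def obs_b_inf_def by (rule oz; simp add: is_interval_ci is_interval_ic)+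
  then have "y 0 = 0" using ci \<gamma> unfolding condition_i_def by blast
  then show False using y0 by blast
qed

text \<open>The level is known where \<open>s r = \<gamma>\<close>. With \<open>\<gamma>\<close>
  fixed, \<open>V\<close> is differentiable and thus continuous along \<open>y\<close>, so the end
  points inherit it.\<close>

lemma V_level_on_mode:
  assumes V: "class_V \<Gamma> domf domV V" and KO: "K \<subseteq> V_proj domV" and \<gamma>: "\<gamma> \<in> \<Gamma>"
    and m: "a < b" "mode_on \<gamma> a b" and lev: "\<And>r. regular r \<Longrightarrow> s r = \<gamma> \<Longrightarrow> V (y r, \<gamma>) = c" and r: "r \<in> {a..b}"
  shows "V (y r, \<gamma>) = c"
proof -
  have cl: "closure {a<..<b} = {a..b}" using m(1) by simp
  have "continuous_on {a..b} (\<lambda>r. V (y r, \<gamma>))"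
  proof (rule continuous_at_imp_continuous_on, rule ballI)
    fix u assume "u \<in> {a..b}"
    then have "(\<lambda>\<zeta>. V (\<zeta>, \<gamma>)) differentiable (at (y u))"
      using V \<gamma> mode_on_mem(1)[OF KO m] by (simp add: class_V_def)
    then have "isCont (\<lambda>\<zeta>. V (\<zeta>, \<gamma>)) (y u)" by (rule differentiable_imp_continuous_within)
    moreover have "isCont y u" using y_continuous[of UNIV] by (simp add: continuous_on_eq_continuous_at)
    ultimately show "isCont (\<lambda>r. V (y r, \<gamma>)) u" by (rule isCont_o2[rotated])
  qed
  then show ?thesis
    using continuous_constant_on_closure[of "{a<..<b}" "\<lambda>r. V (y r, \<gamma>)" c r] lev m(2) r
    unfolding cl by (auto simp: mode_on_def)
qed

text \<open>A constant has derivative 0, which squeezes \<open>W\<close> between 0 and 0 in the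
  decrease condition.\<close>

lemma W_zero_if_V_level:
  assumes V: "class_V \<Gamma> domf domV V" and dec: "Lyapunov_decrease \<Gamma> domf f domV V W" and KO: "K \<subseteq> V_proj domV" and \<gamma>: "\<gamma> \<in> \<Gamma>"
    and m: "a < b" "mode_on \<gamma> a b" and lev: "\<And>r. r \<in> {a..b} \<Longrightarrow> V (y r, \<gamma>) = c" and r: "r \<in> {a..b}"
  shows "W (y r, \<gamma>) = 0"
proof -
  let ?V = "\<lambda>\<zeta>. V (\<zeta>, \<gamma>)"
  let ?D = "frechet_derivative ?V (at (y r)) (f (y r, \<gamma>))"
  have mem: "y r \<in> V_section domf domV \<gamma>" by (rule mode_on_mem(1)[OF KO m r])
  have "((\<lambda>u. ?V (y u)) has_vector_derivative ?D) (at r within {a..b})"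
    using V \<gamma> mem by (intro has_vector_derivative_chain_V mode_on_mem(2)[OF KO m r]) (simp add: class_V_def)
  then have "((\<lambda>_. c) has_vector_derivative ?D) (at r within {a..b})"
    by (rule has_vector_derivative_transform[OF r, rotated]) (use lev in simp)
  then have "?D = 0"
    using vector_derivative_unique_within_closed_interval[OF m(1)] r has_vector_derivative_const[of c] by (metis box_real(2))
  moreover have "- ?D \<ge> W (y r, \<gamma>)" "W (y r, \<gamma>) \<ge> 0" using dec \<gamma> mem unfolding Lyapunov_decrease_def by blast+
  ultimately show ?thesis by simp
qed

lemma V_converges:
  assumes V: "continuous_on (domf \<inter> (V_proj domV \<times> \<Gamma>)) V" and KO: "K \<subseteq> V_proj domV"
  shows "((\<lambda>k. V (x (real k + t), \<sigma> (real k + t))) \<longlongrightarrow> V (y t, s t)) F"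
proof (rule continuous_on_tendsto_compose[OF continuous_on_subset[OF V, of C] x\<sigma>lim yC late_C])
qed (use KO in auto)

text \<open>Joint continuity passes the limit \<open>c\<close> of \<open>V\<close> along
  \<open>x\<close> to \<open>V (y r, s r)\<close> at every \<open>r\<close>. Both modes at a switch
  then have the same level \<open>c\<close>, as (ii') requires.\<close>

lemma dead_case_V_continuous:
  assumes V: "class_V \<Gamma> domf domV V" and dec: "Lyapunov_decrease \<Gamma> domf f domV V W" and KO: "K \<subseteq> V_proj domV"
    and mono: "antimono_on {0..} (\<lambda>t. V (x t, \<sigma> t))" and nn: "\<And>t. 0 \<le> t \<Longrightarrow> 0 \<le> V (x t, \<sigma> t)"
    and cont: "continuous_on (domf \<inter> (V_proj domV \<times> \<Gamma>)) V"
    and ci: "condition_i \<Gamma> domf f domV W" and cii: "condition_ii' \<Gamma> domf f domV V W"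
  shows "0 \<in> K"
proof -
  obtain c where c: "\<And>e. e > 0 \<Longrightarrow> \<exists>t\<^sub>1. \<forall>t\<in>{0..}. t\<^sub>1 \<le> t \<longrightarrow> \<bar>V (x t, \<sigma> t) - c\<bar> < e"
    using antimono_bounded_tail[OF mono] nn by auto
  have lev: "V (y r, s r) = c" for r
  proof (rule tendsto_unique[OF F(1) V_converges[OF cont KO]])
    show "((\<lambda>k. V (x (real k + r), \<sigma> (real k + r))) \<longlongrightarrow> c) F"
    proof (rule tendstoI)
      fix e :: real assume "e > 0"
      then obtain t\<^sub>1 where t1: "\<forall>t\<in>{0..}. t\<^sub>1 \<le> t \<longrightarrow> \<bar>V (x t, \<sigma> t) - c\<bar> < e" using c by blast
      show "\<forall>\<^sub>F k in F. dist (V (x (real k + r), \<sigma> (real k + r))) c < e"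
        using late[of 0 r] late[of t\<^sub>1 r] by eventually_elim (use t1 in \<open>simp add: dist_real_def\<close>)
    qed
  qed
  have lev': "V (y r, \<gamma>) = c" if "a < b" "\<gamma> \<in> \<Gamma>" "mode_on \<gamma> a b" "r \<in> {a..b}" for a b \<gamma> r
    by (rule V_level_on_mode[OF V KO that(2,1,3) _ that(4)]) (use lev in blast)
  show ?thesis
  proof (rule limit_reaches_zero[OF KO ci])
    fix a b \<gamma> r assume "a < b" "\<gamma> \<in> \<Gamma>" "mode_on \<gamma> a b" "r \<in> {a..b}"
    then show "W (y r, \<gamma>) = 0" using W_zero_if_V_level[OF V dec KO] lev' by blast
  next
    fix a t b \<gamma> \<gamma>'
    assume ab: "a < t" "t < b" and \<gamma>: "\<gamma> \<in> \<Gamma>" "\<gamma>' \<in> \<Gamma>" "\<gamma> \<noteq> \<gamma>'" and m: "mode_on \<gamma> a t" "mode_on \<gamma>' t b"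
      and obs: "y t \<in> obs_b (V_section domf domV \<gamma>) (\<lambda>\<xi>. f (\<xi>, \<gamma>)) (\<lambda>\<xi>. W (\<xi>, \<gamma>))"
      "y t \<in> obs_f (V_section domf domV \<gamma>') (\<lambda>\<xi>. f (\<xi>, \<gamma>')) (\<lambda>\<xi>. W (\<xi>, \<gamma>'))"
    have "y t \<in> section_at domV \<gamma>" "y t \<in> section_at domV \<gamma>'"
      using mode_on_mem(1)[OF KO ab(1) m(1), of t] mode_on_mem(1)[OF KO ab(2) m(2), of t] V \<gamma> ab
      unfolding class_V_def by auto
    moreover have "V (y t, \<gamma>) = c" "V (y t, \<gamma>') = c"
      using lev'[OF ab(1) \<gamma>(1) m(1), of t] lev'[OF ab(2) \<gamma>(2) m(2), of t] ab by auto
    ultimately have "y t \<in> level_set domV V \<gamma> c" "y t \<in> level_set domV V \<gamma>' c" by (auto simp: level_set_def)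
    then show "y t = 0" using cii obs \<gamma> unfolding condition_ii'_def by blast
  qed
qed

text \<open>Monotonicity within each mode gives that mode its own limit \<open>c \<gamma>\<close>.
  The levels on the two sides of a switch may differ, hence (ii) rather than (ii').\<close>

lemma dead_case_finite:
  assumes V: "class_V \<Gamma> domf domV V" and dec: "Lyapunov_decrease \<Gamma> domf f domV V W" and KO: "K \<subseteq> V_proj domV"
    and fin: "finite \<Gamma>"
    and mono: "\<And>\<gamma>. \<gamma> \<in> \<Gamma> \<Longrightarrow> antimono_on ({0..} \<inter> \<sigma> -` {\<gamma>}) (\<lambda>t. V (x t, \<gamma>))"
    and nn: "\<And>t. 0 \<le> t \<Longrightarrow> 0 \<le> V (x t, \<sigma> t)"
    and ci: "condition_i \<Gamma> domf f domV W" and cii: "condition_ii \<Gamma> domf f domV W"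
  shows "0 \<in> K"
proof -
  have "\<exists>c. \<forall>e>0. \<exists>t\<^sub>1. \<forall>t\<in>{0..} \<inter> \<sigma> -` {\<gamma>}. t\<^sub>1 \<le> t \<longrightarrow> \<bar>V (x t, \<gamma>) - c\<bar> < e" if "\<gamma> \<in> \<Gamma>" for \<gamma>
    by (rule antimono_bounded_tail[OF mono[OF that]]) (use nn in auto)
  then obtain c where c: "\<And>\<gamma> e. \<gamma> \<in> \<Gamma> \<Longrightarrow> e > 0 \<Longrightarrow>
      \<exists>t\<^sub>1. \<forall>t\<in>{0..} \<inter> \<sigma> -` {\<gamma>}. t\<^sub>1 \<le> t \<longrightarrow> \<bar>V (x t, \<gamma>) - c \<gamma>\<bar> < e"
    by metis
  have lev: "V (y r, s r) = c (s r)" for r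
  proof (rule tendsto_unique[OF F(1)])
    \<comment> \<open>Convergence in a finite set means that the limit is eventually attained; so
      only continuity of \<open>V\<close> in the state is called for.\<close>
    have "open (- (\<Gamma> - {s r}))" using fin by (intro open_Compl finite_imp_closed) auto
    then have "\<forall>\<^sub>F k in F. \<sigma> (real k + r) \<in> - (\<Gamma> - {s r})" by (intro topological_tendstoD[OF \<sigma>lim]) auto
    then have ev: "\<forall>\<^sub>F k in F. \<sigma> (real k + r) = s r" by (rule eventually_mono) (use \<sigma>\<Gamma> in auto)
    have "y r \<in> V_section domf domV (s r)" using yC[of r] KO by (auto simp: V_section_def section_at_def)
    then have "(\<lambda>\<zeta>. V (\<zeta>, s r)) differentiable (at (y r))" using V s\<Gamma> by (simp add: class_V_def)
    then have "isCont (\<lambda>\<zeta>. V (\<zeta>, s r)) (y r)" by (rule differentiable_imp_continuous_within)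
    then show "((\<lambda>k. V (x (real k + r), s r)) \<longlongrightarrow> V (y r, s r)) F" by (rule isCont_tendsto_compose[OF _ xlim'])
    show "((\<lambda>k. V (x (real k + r), s r)) \<longlongrightarrow> c (s r)) F"
    proof (rule tendstoI)
      fix e :: real assume "e > 0"
      then obtain t\<^sub>1 where t1: "\<forall>t\<in>{0..} \<inter> \<sigma> -` {s r}. t\<^sub>1 \<le> t \<longrightarrow> \<bar>V (x t, s r) - c (s r)\<bar> < e"
        using c[OF s\<Gamma>] by blast
      show "\<forall>\<^sub>F k in F. dist (V (x (real k + r), s r)) (c (s r)) < e"
        using late[of 0 r] late[of t\<^sub>1 r] ev by eventually_elim (use t1 in \<open>simp add: dist_real_def\<close>)
    qed
  qed
  have lev': "V (y r, \<gamma>) = c \<gamma>" if "a < b" "\<gamma> \<in> \<Gamma>" "mode_on \<gamma> a b" "r \<in> {a..b}" for a b \<gamma> r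
    by (rule V_level_on_mode[OF V KO that(2,1,3) _ that(4)]) (use lev in blast)
  show ?thesis
  proof (rule limit_reaches_zero[OF KO ci])
    fix a b \<gamma> r assume "a < b" "\<gamma> \<in> \<Gamma>" "mode_on \<gamma> a b" "r \<in> {a..b}"
    then show "W (y r, \<gamma>) = 0" using W_zero_if_V_level[OF V dec KO] lev' by blast
  qed (use cii in \<open>unfold condition_ii_def, blast\<close>)
qed

text \<open>Without continuity of \<open>V\<close> in the mode its limit says nothing about
  \<open>V\<close> along \<open>y\<close>. Instead, if \<open>W\<close> is positive at a regular
  time, \<open>V\<close> drops by \<open>2 * w * h\<close> over a window of fixed length around
  \<open>real k + r\<close>, although it has almost settled at \<open>c\<close>.\<close>

lemma dead_case_W_continuous:
  assumes V: "class_V \<Gamma> domf domV V" and dec: "Lyapunov_decrease \<Gamma> domf f domV V W" and KO: "K \<subseteq> V_proj domV"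
    and mono: "antimono_on {0..} (\<lambda>t. V (x t, \<sigma> t))" and nn: "\<And>t. 0 \<le> t \<Longrightarrow> 0 \<le> V (x t, \<sigma> t)"
    and cont: "continuous_on (domf \<inter> (V_proj domV \<times> \<Gamma>)) W"
    and ci: "condition_i \<Gamma> domf f domV W" and cii: "condition_ii \<Gamma> domf f domV W"
  shows "0 \<in> K"
proof -
  obtain c where c: "\<And>e. e > 0 \<Longrightarrow> \<exists>t\<^sub>1. \<forall>t\<in>{0..}. t\<^sub>1 \<le> t \<longrightarrow> \<bar>V (x t, \<sigma> t) - c\<bar> < e"
    using antimono_bounded_tail[OF mono] nn by auto
  have zero: "W (y r, s r) = 0" if reg: "regular r" for r
  proof (rule ccontr)
    \<comment> \<open>Half the value: closeness within \<open>w\<close> to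
      \<open>W (y r, s r)\<close> still leaves \<open>W\<close> above \<open>w\<close>.\<close>
    define w where "w = W (y r, s r) / 2"
    assume "W (y r, s r) \<noteq> 0"
    moreover have "y r \<in> V_section domf domV (s r)" using yC[of r] KO by (auto simp: V_section_def section_at_def)
    then have "0 \<le> W (y r, s r)" using dec s\<Gamma> unfolding Lyapunov_decrease_def by blast
    ultimately have w: "w > 0" by (simp add: w_def)
    obtain p q where pq: "p < r" "r < q" "B p q" using reg unfolding regular_def by blast
    obtain M where M: "0 \<le> M" "\<And>s t. 0 \<le> s \<Longrightarrow> 0 \<le> t \<Longrightarrow> norm (x t - x s) \<le> M * \<bar>t - s\<bar>"
      using lipschitz by blast
    have contC: "continuous_on C W" by (rule continuous_on_subset[OF cont]) (use KO in auto)
    then obtain \<delta> where \<delta>: "\<delta> > 0" "\<And>z. z \<in> C \<Longrightarrow> dist z (y r, s r) < \<delta> \<Longrightarrow> dist (W z) (W (y r, s r)) < w"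
      using yC[of r] w unfolding continuous_on_iff by meson
    \<comment> \<open>The motion of \<open>x\<close> may use up half of \<open>\<delta>\<close>, the
      other half being left for the distance to the limit. Halving the second entry fits the closed
      window strictly inside \<open>{p<..<q}\<close>.\<close>
    define h where "h = min (\<delta> / (2 * (M + 1))) (min (r - p) (q - r) / 2)"
    have "h > 0" using \<delta>(1) M(1) pq by (simp add: h_def)
    moreover have "h \<le> min (r - p) (q - r) / 2" unfolding h_def by (rule min.cobounded2)
    ultimately have h: "h > 0" "h < r - p" "h < q - r" using pq by auto
    have "M * h \<le> (M + 1) * h" using h by (intro mult_right_mono) auto
    also have "\<dots> \<le> \<delta> / 2"
    proof -
      have "h \<le> \<delta> / (2 * (M + 1))" unfolding h_def by (rule min.cobounded1)
      then have "h * (2 * (M + 1)) \<le> \<delta>" using M(1) by (subst (asm) pos_le_divide_eq) auto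
      then show ?thesis by (simp add: algebra_simps)
    qed
    finally have Mh: "M * h \<le> \<delta> / 2" .
    obtain t\<^sub>1 where t1: "\<And>t. 0 \<le> t \<Longrightarrow> t\<^sub>1 \<le> t \<Longrightarrow> \<bar>V (x t, \<sigma> t) - c\<bar> < w * h"
    proof -
      \<comment> \<open>Two values strictly within \<open>w * h\<close> of \<open>c\<close> differ
        by less than \<open>2 * w * h\<close>, the drop of \<open>V\<close> over the window.\<close>
      have "0 < w * h" using w h by simp
      from c[OF this] show thesis using that by auto
    qed
    have "\<forall>\<^sub>F k in F. dist (x (real k + r), \<sigma> (real k + r)) (y r, s r) < \<delta> / 2"
      using x\<sigma>lim \<delta>(1) by (intro tendstoD) auto
    with late[of 0 "r - h"] late[of t\<^sub>1 "r - h"] late_const[OF pq(3)]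
    have "\<forall>\<^sub>F k in F. False"
    proof eventually_elim
      case (elim k)
      let ?a = "real k + (r - h)" and ?b = "real k + (r + h)" and ?\<gamma> = "\<sigma> (real k + r)"
      have const: "\<sigma> t = ?\<gamma>" if t: "t \<in> {?a..?b}" for t
      proof -
        have "t - real k \<in> {p<..<q}" "r \<in> {p<..<q}" using t h pq by auto
        then have "\<sigma> (real k + (t - real k)) = ?\<gamma>" using elim(3) by blast
        then show ?thesis by simp
      qed
      have W: "w \<le> W (x t, ?\<gamma>)" if t: "t \<in> {?a..?b}" for t
      proof -
        have t0: "0 \<le> t" "0 \<le> real k + r" using t elim h by auto
        have "norm (x t - x (real k + r)) \<le> M * \<bar>t - (real k + r)\<bar>" using M(2) t0 by blast
        also have "\<dots> \<le> M * h" using t M(1) by (intro mult_left_mono) auto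
        finally have "dist (x t, \<sigma> t) (x (real k + r), ?\<gamma>) \<le> \<delta> / 2"
          using Mh const[OF t] by (simp add: dist_Pair_Pair dist_norm)
        then have "dist (x t, \<sigma> t) (y r, s r) < \<delta>"
          using elim(4) dist_triangle[of "(x t, \<sigma> t)" "(y r, s r)" "(x (real k + r), ?\<gamma>)"] by simp
        then have "dist (W (x t, \<sigma> t)) (W (y r, s r)) < w" by (intro \<delta>(2) xC t0)
        then show ?thesis using const[OF t] by (simp add: dist_real_def w_def abs_if split: if_splits)
      qed
      have "V (x ?b, ?\<gamma>) \<le> V (x ?a, ?\<gamma>) - w * (?b - ?a)"
        by (rule V_decrease[OF V dec KO elim(1) _ const W]) (use h(1) in simp)
      moreover have "\<sigma> ?a = ?\<gamma>" "\<sigma> ?b = ?\<gamma>" by (rule const; use h(1) in simp)+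
      ultimately have "V (x ?b, \<sigma> ?b) \<le> V (x ?a, \<sigma> ?a) - 2 * (w * h)" by (simp add: algebra_simps)
      moreover have "\<bar>V (x ?a, \<sigma> ?a) - c\<bar> < w * h" "\<bar>V (x ?b, \<sigma> ?b) - c\<bar> < w * h"
        by (rule t1; use elim(1,2) h(1) in linarith)+
      ultimately show False by linarith
    qed
    then show False using F(1) by (simp add: trivial_limit_def)
  qed
  show ?thesis
  proof (rule limit_reaches_zero[OF KO ci])
    fix a b \<gamma> r assume ab: "a < b" and \<gamma>: "\<gamma> \<in> \<Gamma>" and m: "mode_on \<gamma> a b" and r: "r \<in> {a..b}"
    have cl: "closure {a<..<b} = {a..b}" using ab by simp
    \<comment> \<open>\<open>zero\<close> covers regular times only; continuity of \<open>W\<close>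
      along \<open>y\<close> with \<open>\<gamma>\<close> fixed adds the end points.\<close>
    have "continuous_on {a..b} (\<lambda>r. W (y r, \<gamma>))"
      by (rule continuous_on_compose2[OF cont])
        (use mode_on_mem(1)[OF KO ab m] \<gamma> in \<open>auto intro!: continuous_intros y_continuous simp: V_section_def section_at_def\<close>)
    moreover have "W (y u, \<gamma>) = 0" if "u \<in> {a<..<b}" for u
      using zero[of u] m that by (auto simp: mode_on_def)
    ultimately show "W (y r, \<gamma>) = 0"
      using continuous_constant_on_closure[of "{a<..<b}" "\<lambda>r. W (y r, \<gamma>)" 0 r] r
      unfolding cl by blast
  qed (use cii in \<open>unfold condition_ii_def, blast\<close>)
qed

end

section \<open>Asymptotic stability\<close>

lemma signals_a_jump_bound:
  assumes "\<sigma> \<in> signals_a \<Gamma>"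
  shows "\<exists>N. \<forall>t. card (jump_times \<sigma> \<inter> {t - 1<..<t + 1}) \<le> N"
proof -
  obtain \<tau> N\<^sub>0 where \<tau>: "0 < \<tau>"
    "\<And>a b. a < b \<Longrightarrow> real (card (jump_times \<sigma> \<inter> {a<..<b})) \<le> real N\<^sub>0 + (b - a) / \<tau>"
    using assms unfolding signals_a_def signals_avg_dwell_def by auto
  have "card (jump_times \<sigma> \<inter> {t - 1<..<t + 1}) \<le> nat \<lceil>real N\<^sub>0 + 2 / \<tau>\<rceil>" for t
  proof -
    have "real (card (jump_times \<sigma> \<inter> {t - 1<..<t + 1})) \<le> real N\<^sub>0 + 2 / \<tau>"
      using \<tau>(2)[of "t - 1" "t + 1"] by simp
    then show ?thesis by linarith
  qed
  then show ?thesis by blast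
qed

text \<open>The alternatives are joined so that the stability and convergence arguments are carried
  out once.\<close>

definition admissible_pair ::
  "'g::metric_space set \<Rightarrow> ('a::euclidean_space \<times> 'g) set \<Rightarrow> ('a \<times> 'g \<Rightarrow> 'a) \<Rightarrow> ('a, 'g) traj set
     \<Rightarrow> ('a \<times> 'g) set \<Rightarrow> ('a \<times> 'g \<Rightarrow> real) \<Rightarrow> ('a \<times> 'g \<Rightarrow> real) \<Rightarrow> bool" where
  "admissible_pair \<Gamma> domf f T domV V W \<longleftrightarrow>
     condition_i \<Gamma> domf f domV W \<and>
     (weak_Lyapunov_pair \<Gamma> domf f T domV V W \<and>
        (continuous_on (domf \<inter> (V_proj domV \<times> \<Gamma>)) V \<and> condition_ii' \<Gamma> domf f domV V W \<or>
         continuous_on (domf \<inter> (V_proj domV \<times> \<Gamma>)) W \<and> condition_ii \<Gamma> domf f domV W) \<or>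
      finite \<Gamma> \<and> F_weak_Lyapunov_pair \<Gamma> domf f T domV V W \<and> condition_ii \<Gamma> domf f domV W)"

lemma admissible_pairD:
  assumes "admissible_pair \<Gamma> domf f T domV V W"
  shows "class_V \<Gamma> domf domV V" "0 \<in> V_proj domV" "positive_definite_decrescent \<Gamma> domf domV V"
    "Lyapunov_decrease \<Gamma> domf f domV V W"
  using assms by (auto simp: admissible_pair_def weak_Lyapunov_pair_def F_weak_Lyapunov_pair_def)

lemma admissible_pair_gain:
  assumes "admissible_pair \<Gamma> domf f T domV V W" "\<forall>tr\<in>T. trajectory \<Gamma> domf f tr \<and> forward_complete tr"
    "B \<subseteq> V_proj domV" "real_homeo a\<^sub>1" "real_homeo a\<^sub>2"
    "\<And>\<gamma> \<xi>. \<gamma> \<in> \<Gamma> \<Longrightarrow> \<xi> \<in> V_section domf domV \<gamma> \<Longrightarrow> \<xi> \<in> B \<Longrightarrow>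
      a\<^sub>1 (norm \<xi>) \<le> V (\<xi>, \<gamma>) \<and> V (\<xi>, \<gamma>) \<le> a\<^sub>2 (norm \<xi>)"
  obtains \<beta> where "real_homeo \<beta>" "gain_on B \<beta> T"
  using weak_Lyapunov_gain[OF assms(2) _ assms(3-6)] F_weak_Lyapunov_gain[OF assms(2) _ _ assms(3-6)] assms(1)
  unfolding admissible_pair_def by blast

text \<open>\<open>K\<^sub>0\<close> is a ball, which in the global case depends on the trajectory.
  \<open>stable\<close> is the epsilon-delta form of stability along this trajectory, common to the
  local and the global case.\<close>

lemma confined_trajectory_tendsto_zero:
  fixes domf :: "('a::euclidean_space \<times> 'g::metric_space) set"
  assumes sys: "compact \<Gamma>" "domf \<subseteq> UNIV \<times> \<Gamma>" "closed domf" "continuous_on domf f"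
    and T: "\<forall>tr\<in>T. trajectory \<Gamma> domf f tr \<and> forward_complete tr"
    and mem: "(I, x, \<sigma>) \<in> T" and \<sigma>: "\<sigma> \<in> signals_a \<Gamma>"
    and ad: "admissible_pair \<Gamma> domf f T domV V W"
    and K\<^sub>0: "compact K\<^sub>0" "K\<^sub>0 \<subseteq> V_proj domV" "\<And>t. 0 \<le> t \<Longrightarrow> x t \<in> K\<^sub>0"
    and stable: "\<And>e. e > 0 \<Longrightarrow> \<exists>d>0. \<forall>s t. 0 \<le> s \<longrightarrow> s \<le> t \<longrightarrow> norm (x s) < d \<longrightarrow> norm (x t) < e"
  shows "(x \<longlongrightarrow> 0) at_top"
proof (rule ccontr)
  assume "\<not> (x \<longlongrightarrow> 0) at_top"
  then obtain e where e: "e > 0" "\<not> (\<forall>\<^sub>F t in at_top. norm (x t) < e)"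
    unfolding tendsto_iff by auto
  obtain d where d: "d > 0" "\<And>s t. 0 \<le> s \<Longrightarrow> s \<le> t \<Longrightarrow> norm (x s) < d \<Longrightarrow> norm (x t) < e"
    using stable[OF e(1)] by blast
  \<comment> \<open>A single value of norm below \<open>d\<close> would keep the norm below
    \<open>e\<close> ever after, against the choice of \<open>e\<close>.\<close>
  have away: "d \<le> norm (x t)" if "0 \<le> t" for t
  proof (rule ccontr)
    assume "\<not> d \<le> norm (x t)"
    then have "\<forall>u\<ge>t. norm (x u) < e" using d(2) that by simp
    then show False using e(2) unfolding eventually_at_top_linorder by blast
  qed
  define K where "K = K\<^sub>0 \<inter> {\<xi>. d \<le> norm \<xi>}"
  have tr: "trajectory \<Gamma> domf f (I, x, \<sigma>)" "forward_complete (I, x, \<sigma>)" using T mem by auto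
  have KO: "K \<subseteq> V_proj domV" using K\<^sub>0(2) by (auto simp: K_def)
  obtain N where N: "\<And>t. card (jump_times \<sigma> \<inter> {t - 1<..<t + 1}) \<le> N"
    using signals_a_jump_bound[OF \<sigma>] by blast
  interpret confined_orbit \<Gamma> domf f K x \<sigma> N
  proof
    have "closed {\<xi>::'a. d \<le> norm \<xi>}" by (intro closed_Collect_le continuous_intros)
    then show "compact K" unfolding K_def by (rule compact_Int_closed[OF K\<^sub>0(1)])
    show "x t \<in> K" if "0 \<le> t" for t using K\<^sub>0(3) away that by (simp add: K_def)
  qed (fact sys trajectoryD(1,3-5)[OF tr] N)+
  obtain F y s B where lim: "F \<noteq> bot" "F \<le> sequentially" "\<And>t. y t \<in> K" "\<And>t. s t \<in> \<Gamma>"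
    "\<And>t. ((\<lambda>k. x (max 0 (real k + t))) \<longlongrightarrow> y t) F"
    "\<And>t. ((\<lambda>k. \<sigma> (real k + t)) \<longlongrightarrow> s t) F"
    "\<And>p q. \<forall>\<^sub>F k in F. (jump_times \<sigma> \<inter> {real k + p<..<real k + q} = {}) = B p q"
    using limit_exists by blast
  interpret orbit_limit \<Gamma> domf f K x \<sigma> N F y s B
    by unfold_locales (rule lim(1), rule lim(2), rule lim(3), rule lim(4), rule lim(5), rule lim(6), rule lim(7))
  note V = admissible_pairD(1)[OF ad] and dec = admissible_pairD(4)[OF ad]
  have xO: "x t \<in> V_proj domV" if "0 \<le> t" for t using xK[OF that] KO by blast
  have nn: "0 \<le> V (x t, \<sigma> t)" if "0 \<le> t" for t
    using V_nonneg[OF admissible_pairD(3)[OF ad] \<sigma>\<Gamma>] trajectory_mem_V_section[OF tr that xO[OF that]] by blast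
  have ci: "condition_i \<Gamma> domf f domV W" using ad by (simp add: admissible_pair_def)
  have mono: "antimono_on {0..} (\<lambda>t. V (x t, \<sigma> t))" if wl: "weak_Lyapunov_pair \<Gamma> domf f T domV V W"
  proof (rule monotone_onI)
    fix t u :: real assume tu: "t \<in> {0..}" "u \<in> {0..}" "t \<le> u"
    then have "antimono_on {t..u} (\<lambda>t. V (x t, \<sigma> t))"
      using wl mem xO unfolding weak_Lyapunov_pair_def by fastforce
    then show "V (x u, \<sigma> u) \<le> V (x t, \<sigma> t)" using tu by (simp add: monotone_on_def)
  qed
  have Fmono: "antimono_on ({0..} \<inter> \<sigma> -` {\<gamma>}) (\<lambda>t. V (x t, \<gamma>))"
    if wl: "F_weak_Lyapunov_pair \<Gamma> domf f T domV V W" and \<gamma>: "\<gamma> \<in> \<Gamma>" for \<gamma>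
  proof (rule monotone_onI)
    fix t u :: real assume tu: "t \<in> {0..} \<inter> \<sigma> -` {\<gamma>}" "u \<in> {0..} \<inter> \<sigma> -` {\<gamma>}" "t \<le> u"
    then have "antimono_on ({t..u} \<inter> \<sigma> -` {\<gamma>}) (\<lambda>t. V (x t, \<gamma>))"
      using wl mem xO \<gamma> unfolding F_weak_Lyapunov_pair_def by fastforce
    then show "V (x u, \<gamma>) \<le> V (x t, \<gamma>)" using tu by (simp add: monotone_on_def)
  qed
  have "0 \<in> K"
    using ad dead_case_V_continuous[OF V dec KO mono nn _ ci] dead_case_W_continuous[OF V dec KO mono nn _ ci]
      dead_case_finite[OF V dec KO _ Fmono nn ci]
    unfolding admissible_pair_def by blast
  then show False using d(1) by (simp add: K_def)
qed

lemma admissible_pair_LAS: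
  fixes domf :: "('a::euclidean_space \<times> 'g::metric_space) set"
  assumes sys: "compact \<Gamma>" "domf \<subseteq> UNIV \<times> \<Gamma>" "closed domf" "continuous_on domf f"
    and T: "\<forall>tr\<in>T. trajectory \<Gamma> domf f tr \<and> forward_complete tr"
    and \<sigma>: "\<forall>(I, x, \<sigma>)\<in>T. \<sigma> \<in> signals_a \<Gamma>"
    and ad: "admissible_pair \<Gamma> domf f T domV V W"
  shows "LAS T"
proof -
  obtain \<rho> a\<^sub>1 a\<^sub>2 where \<rho>: "0 < \<rho>" "cball 0 \<rho> \<subseteq> V_proj domV" and a: "real_homeo a\<^sub>1" "real_homeo a\<^sub>2"
    and bd: "\<And>\<gamma> \<xi>. \<gamma> \<in> \<Gamma> \<Longrightarrow> \<xi> \<in> V_section domf domV \<gamma> \<Longrightarrow> \<xi> \<in> cball 0 \<rho> \<Longrightarrow>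
      a\<^sub>1 (norm \<xi>) \<le> V (\<xi>, \<gamma>) \<and> V (\<xi>, \<gamma>) \<le> a\<^sub>2 (norm \<xi>)"
    using V_bounds_local[OF admissible_pairD(1-3)[OF ad]] by blast
  obtain \<beta> where \<beta>: "real_homeo \<beta>" "gain_on (cball 0 \<rho>) \<beta> T"
    using admissible_pair_gain[OF ad T \<rho>(2) a bd] by blast
  obtain r where r: "0 < r" "\<And>I x \<sigma> s t. (I, x, \<sigma>) \<in> T \<Longrightarrow> 0 \<le> s \<Longrightarrow> s \<le> t \<Longrightarrow> norm (x s) \<le> r \<Longrightarrow>
      norm (x t) < \<rho> \<and> norm (x t) \<le> \<beta> (norm (x s))"
    using gain_on_confined[OF T \<beta> \<rho>(1)] by blast
  have "LUS T" unfolding LUS_def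
  proof (intro exI conjI)
    show "0 < r" by (rule r(1))
    show "class_K (ereal r) \<beta>" using r(1) by (intro real_homeo_class_K[OF \<beta>(1)]) simp
    show "\<forall>(I, x, \<sigma>)\<in>T. \<forall>t\<^sub>0\<ge>0. norm (x t\<^sub>0) \<le> r \<longrightarrow> (\<forall>t\<ge>t\<^sub>0. norm (x t) \<le> \<beta> (norm (x t\<^sub>0)))"
      using r(2) by blast
  qed
  moreover have "(x \<longlongrightarrow> 0) at_top" if mem: "(I, x, \<sigma>) \<in> T" and x0: "norm (x 0) < r" for I x \<sigma>
  proof (rule confined_trajectory_tendsto_zero[OF sys T mem _ ad compact_cball \<rho>(2)])
    show "\<sigma> \<in> signals_a \<Gamma>" using \<sigma> mem by blast
    show "x t \<in> cball 0 \<rho>" if "0 \<le> t" for t using r(2)[OF mem, of 0 t] that x0 by simp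
    show "\<exists>d>0. \<forall>s t. 0 \<le> s \<longrightarrow> s \<le> t \<longrightarrow> norm (x s) < d \<longrightarrow> norm (x t) < e" if e: "e > 0" for e
    proof -
      \<comment> \<open>The gain on the larger ball restricts to this one, so the first-exit
        argument with radius \<open>min e \<rho>\<close> yields the \<open>d\<close> for a given
        \<open>e\<close>.\<close>
      have g: "gain_on (cball 0 (min e \<rho>)) \<beta> T" using \<beta>(2) unfolding gain_on_def by fastforce
      have "0 < min e \<rho>" using e \<rho>(1) by simp
      from gain_on_confined[OF T \<beta>(1) g this]
      obtain r' where r': "0 < r'" "\<And>I x \<sigma> s t. (I, x, \<sigma>) \<in> T \<Longrightarrow> 0 \<le> s \<Longrightarrow> s \<le> t \<Longrightarrow> norm (x s) \<le> r' \<Longrightarrow>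
          norm (x t) < min e \<rho> \<and> norm (x t) \<le> \<beta> (norm (x s))"
        by blast
      have "norm (x t) < e" if "0 \<le> s" "s \<le> t" "norm (x s) < r'" for s t
      proof -
        have "norm (x s) \<le> r'" using that(3) by simp
        from r'(2)[OF mem that(1,2) this] show ?thesis by simp
      qed
      then show ?thesis using r'(1) by blast
    qed
  qed
  ultimately show ?thesis unfolding LAS_def using r(1) by blast
qed

lemma admissible_pair_GAS:
  fixes domf :: "('a::euclidean_space \<times> 'g::metric_space) set"
  assumes sys: "compact \<Gamma>" "domf \<subseteq> UNIV \<times> \<Gamma>" "closed domf" "continuous_on domf f"
    and T: "\<forall>tr\<in>T. trajectory \<Gamma> domf f tr \<and> forward_complete tr"
    and \<sigma>: "\<forall>(I, x, \<sigma>)\<in>T. \<sigma> \<in> signals_a \<Gamma>"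
    and ad: "admissible_pair \<Gamma> domf f T domV V W"
    and glob: "V_proj domV = UNIV" "radially_unbounded \<Gamma> domf domV V"
  shows "GAS T"
proof -
  obtain a\<^sub>1 a\<^sub>2 where a: "real_homeo a\<^sub>1" "real_homeo a\<^sub>2"
    and bd: "\<And>\<gamma> \<xi>. \<gamma> \<in> \<Gamma> \<Longrightarrow> \<xi> \<in> V_section domf domV \<gamma> \<Longrightarrow>
      a\<^sub>1 (norm \<xi>) \<le> V (\<xi>, \<gamma>) \<and> V (\<xi>, \<gamma>) \<le> a\<^sub>2 (norm \<xi>)"
    using V_bounds_global[OF glob(2)] by blast
  obtain \<beta> where \<beta>: "real_homeo \<beta>" "gain_on UNIV \<beta> T"
    using admissible_pair_gain[OF ad T _ a bd, of UNIV] glob(1) by blast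
  have gain: "norm (x t) \<le> \<beta> (norm (x s))" if "(I, x, \<sigma>) \<in> T" "0 \<le> s" "s \<le> t" for I x \<sigma> s t
    using \<beta>(2) that unfolding gain_on_def by fastforce
  have "GUS T" unfolding GUS_def using real_homeo_class_K_infty[OF \<beta>(1)] gain by blast
  moreover have "(x \<longlongrightarrow> 0) at_top" if mem: "(I, x, \<sigma>) \<in> T" for I x \<sigma>
  proof (rule confined_trajectory_tendsto_zero[OF sys T mem _ ad compact_cball])
    show "\<sigma> \<in> signals_a \<Gamma>" using \<sigma> mem by blast
    \<comment> \<open>The unconditional gain confines the trajectory to a ball determined by its
      initial value; as the projection is the whole space, any radius is allowed.\<close>
    show "cball 0 (\<beta> (norm (x 0))) \<subseteq> V_proj domV" using glob(1) by simp
    show "x t \<in> cball 0 (\<beta> (norm (x 0)))" if "0 \<le> t" for t using gain[OF mem _ that] by simp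
    show "\<exists>d>0. \<forall>s t. 0 \<le> s \<longrightarrow> s \<le> t \<longrightarrow> norm (x s) < d \<longrightarrow> norm (x t) < e" if "e > 0" for e
    proof -
      have inv: "\<beta> (inv \<beta> e) = e" using \<beta>(1) by (simp add: real_homeo_def surj_f_inv_f)
      then have "0 < inv \<beta> e" using that real_homeo_less_iff[OF \<beta>(1), of 0 "inv \<beta> e"] real_homeo_zero[OF \<beta>(1)] by simp
      moreover have "norm (x t) < e" if "0 \<le> s" "s \<le> t" "norm (x s) < inv \<beta> e" for s t
        using gain[OF mem that(1,2)] that(3) real_homeo_less_iff[OF \<beta>(1), of "norm (x s)" "inv \<beta> e"] inv by simp
      ultimately show ?thesis by blast
    qed
  qed
  ultimately show ?thesis unfolding GAS_def by blast
qed

theorem theorem4p5: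
  fixes \<Gamma> :: "'g::metric_space set"
    and domf :: "((real ^ 'n) \<times> 'g) set"
    and f :: "(real ^ 'n) \<times> 'g \<Rightarrow> real ^ 'n"
    and T :: "(real ^ 'n, 'g) traj set"
  assumes "compact \<Gamma>"
    and "domf \<subseteq> UNIV \<times> \<Gamma>" and "closed domf" and "continuous_on domf f"
    and "\<forall>\<gamma>\<in>\<Gamma>. 0 \<in> section_at domf \<gamma> \<longrightarrow> f (0, \<gamma>) = 0"
    and "\<forall>tr\<in>T. trajectory \<Gamma> domf f tr \<and> forward_complete tr"
    and "\<forall>(I, x, \<sigma>)\<in>T. \<sigma> \<in> signals_a \<Gamma>"
  shows
    "\<forall>domV V W.
       (weak_Lyapunov_pair \<Gamma> domf f T domV V W \<and>
        continuous_on (domf \<inter> (V_proj domV \<times> \<Gamma>)) V \<and>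
        condition_i \<Gamma> domf f domV W \<and> condition_ii' \<Gamma> domf f domV V W)
       \<or>
       ((\<forall>\<gamma>\<in>\<Gamma>. 0 \<in> section_at domf \<gamma> \<longrightarrow>
            unique_zero_solution (section_at domf \<gamma>) (\<lambda>\<xi>. f (\<xi>, \<gamma>))) \<and>
        weak_Lyapunov_pair \<Gamma> domf f T domV V W \<and>
        continuous_on (domf \<inter> (V_proj domV \<times> \<Gamma>)) W \<and>
        condition_i \<Gamma> domf f domV W \<and> condition_ii \<Gamma> domf f domV W)
       \<or>
       (finite \<Gamma> \<and>
        F_weak_Lyapunov_pair \<Gamma> domf f T domV V W \<and>
        condition_i \<Gamma> domf f domV W \<and> condition_ii \<Gamma> domf f domV W)
       \<longrightarrow> LAS T \<and> (V_proj domV = UNIV \<and> radially_unbounded \<Gamma> domf domV V \<longrightarrow> GAS T)"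
proof (intro allI impI, goal_cases)
  case (1 domV V W)
  then have ad: "admissible_pair \<Gamma> domf f T domV V W" unfolding admissible_pair_def by blast
  show ?case
    using admissible_pair_LAS[OF assms(1-4,6,7) ad] admissible_pair_GAS[OF assms(1-4,6,7) ad] by blast
qed

end
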